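(* Let $m\ge2$, let $d_1,\dots,d_m\ge1$ be integers, $d=d_1+\cdots+d_m$. There are constants $c_{m,d},C_{m,d}>0$, depending only on $m$ and $d$, such that the following holds. Let $\mathcal D=\mathcal D^1\times\cdots\times\mathcal D^m$ be a product of dyadic cube grids $\mathcal D^i$ in $\mathbb R^{d_i}$, and suppose $\mathcal G\subset\mathcal D$ satisfies $$I,J\in\mathcal G,\quad I\subset J\quad\Longrightarrow\quad I^i=J^i\ \text{ for some } i\in\{1,\dots,m\}.$$ Then, for every $1<p\le2$ and every real-valued $f\in L^p(\mathbb R^d)$, $$\|M_{\mathcal G}f\|_p\le C_{m,d}\,(p')^{m-1}\|f\|_p,\qquad p'=\frac p{p-1}.$$ If moreover $\mathcal G$ is $\eta$-sparse for some $\eta\in(0,1]$ and has finite shadow, i.e. $|\mathrm{sh}(\mathcal G)|<\infty$, then also $$\|h_{\mathcal G}\|_q\le C_{m,d}\,\eta^{-1}q^{m-1}|\mathrm{sh}(\mathcal G)|^{1/q},\qquad 2\le q<\infty,$$ and $$\int_{\mathrm{sh}(\mathcal G)}\left[\exp\left(c_{m,d}(\eta h_{\mathcal G})^{1/(m-1)}\right)-1\right]\le C_{m,d}|\mathrm{sh}(\mathcal G)|.$$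
   Context: A dyadic (cube) grid in $\mathbb R^n$ is a collection of half-open axis-parallel cubes with side lengths $2^k$, $k\in\mathbb Z$, such that for every $k\in\mathbb Z$ the cubes of side length $2^k$ in the collection partition $\mathbb R^n$, and any two intersecting cubes of the collection are nested. Elements of $\mathcal D$ are the rectangles $I=I^1\times\cdots\times I^m\subset\mathbb R^d=\mathbb R^{d_1}\times\cdots\times\mathbb R^{d_m}$ with $I^i\in\mathcal D^i$. Inclusion $\subset$ allows equality. For $\mathcal G\subset\mathcal D$, $$M_{\mathcal G}f(x)=\sup_{I\in\mathcal G,\ x\in I}\frac1{|I|}\int_I|f|\ \ (\text{empty supremum}=0),\qquad h_{\mathcal G}=\sum_{I\in\mathcal G}\mathbf 1_I,\qquad \mathrm{sh}(\mathcal G)=\bigcup_{I\in\mathcal G}I.$$ $\mathcal G$ is $\eta$-sparse if there are pairwise disjoint measurable sets $E_I\subset I$, $I\in\mathcal G$, with $|E_I|\ge\eta|I|$. $\|\cdot\|_p$ is the $L^p(\mathbb R^d)$ norm and $|\cdot|$ Lebesgue measure. *)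

theory Defs
  imports "HOL-Analysis.Analysis"
begin

text \<open>
  The dimensions \<open>d\<^sub>1, \<dots>, d\<^sub>m\<close> are bound inside the theorem (its constants depend on them
  only through \<open>m\<close> and their sum), so they cannot be types. A vector of \<open>\<real>\<^sup>k\<close> is a
  function on \<open>{..<k}\<close> extended by \<^term>\<open>undefined\<close>, and a point \<open>x\<close> of
  \<open>\<real>\<^sup>d = \<real>\<^bsup>d\<^sub>1\<^esup> \<times> \<dots> \<times> \<real>\<^bsup>d\<^sub>m\<^esup>\<close> is a function on \<open>{..<m}\<close> with
  \<open>x i \<in> \<real>\<^bsup>n i\<^esup>\<close>. Blocks are counted from \<open>0\<close>: \<open>n i\<close> is \<open>d\<^bsub>i+1\<^esub>\<close>.
\<close>

type_synonym vec = "nat \<Rightarrow> real"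
type_synonym point = "nat \<Rightarrow> vec"

definition euc :: "nat \<Rightarrow> vec set" where
  "euc k = (\<Pi>\<^sub>E j\<in>{..<k}. UNIV)"

text \<open>The completion turns the Borel product measure into Lebesgue measure on \<open>\<real>\<^sup>d\<close>.\<close>

definition leb :: "nat \<Rightarrow> (nat \<Rightarrow> nat) \<Rightarrow> point measure" where
  "leb m n = completion (\<Pi>\<^sub>M i\<in>{..<m}. \<Pi>\<^sub>M j\<in>{..<n i}. lborel)"

definition is_cube :: "nat \<Rightarrow> real \<Rightarrow> vec set \<Rightarrow> bool" where
  "is_cube k l Q \<longleftrightarrow> (\<exists>a. Q = (\<Pi>\<^sub>E j\<in>{..<k}. {a j..<a j + l}))"

definition dyadic_grid :: "nat \<Rightarrow> vec set set \<Rightarrow> bool" where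
  "dyadic_grid k \<Q> \<longleftrightarrow>
     (\<forall>Q\<in>\<Q>. \<exists>s::int. is_cube k (2 powi s) Q) \<and>
     (\<forall>s::int. partition_on (euc k) {Q\<in>\<Q>. is_cube k (2 powi s) Q}) \<and>
     (\<forall>Q\<in>\<Q>. \<forall>R\<in>\<Q>. Q \<inter> R \<noteq> {} \<longrightarrow> Q \<subseteq> R \<or> R \<subseteq> Q)"

definition dyadic_rectangles :: "nat \<Rightarrow> (nat \<Rightarrow> vec set set) \<Rightarrow> point set set" where
  "dyadic_rectangles m \<D> = {(\<Pi>\<^sub>E i\<in>{..<m}. K i) | K. \<forall>i<m. K i \<in> \<D> i}"

text \<open>
  The factor \<open>I\<^sup>i\<close> of a rectangle \<open>I\<close>. Cubes are nonempty, so projecting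
  \<open>\<Pi>\<^sub>E i\<in>{..<m}. K i\<close> to coordinate \<open>i < m\<close> gives back \<open>K i\<close>.
\<close>

definition factor :: "nat \<Rightarrow> point set \<Rightarrow> vec set" where
  "factor i I = (\<lambda>x. x i) ` I"

text \<open>
  Maximal and counting functions may be infinite at some points, so they, their norms and the
  exponential integral take values in \<^typ>\<open>ennreal\<close>. Families of dyadic rectangles are
  countable, hence these functions and the shadow are measurable.
\<close>

definition maximal_fun :: "'a measure \<Rightarrow> 'a set set \<Rightarrow> ('a \<Rightarrow> real) \<Rightarrow> 'a \<Rightarrow> ennreal" where
  "maximal_fun M \<G> f x =
     (SUP I\<in>{I\<in>\<G>. x \<in> I}. (\<integral>\<^sup>+y\<in>I. ennreal \<bar>f y\<bar> \<partial>M) / emeasure M I)"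

definition counting_fun :: "'a set set \<Rightarrow> 'a \<Rightarrow> ennreal" where
  "counting_fun \<G> x = (\<Sum>\<^sub>\<infinity>I\<in>\<G>. indicator I x)"

definition shadow :: "'a set set \<Rightarrow> 'a set" where
  "shadow \<G> = \<Union>\<G>"

definition sparse_family :: "'a measure \<Rightarrow> real \<Rightarrow> 'a set set \<Rightarrow> bool" where
  "sparse_family M \<eta> \<G> \<longleftrightarrow>
     (\<exists>E. disjoint_family_on E \<G> \<and>
        (\<forall>I\<in>\<G>. E I \<in> sets M \<and> E I \<subseteq> I \<and> emeasure M (E I) \<ge> ennreal \<eta> * emeasure M I))"

text \<open>Only used for exponents \<open>a > 0\<close>, whence the value at infinity.\<close>

definition ennreal_powr :: "ennreal \<Rightarrow> real \<Rightarrow> ennreal" where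
  "ennreal_powr t a = (if t = \<infinity> then \<infinity> else ennreal (enn2real t powr a))"

definition ennreal_exp :: "ennreal \<Rightarrow> ennreal" where
  "ennreal_exp t = (if t = \<infinity> then \<infinity> else ennreal (exp (enn2real t)))"

definition Lp_norm :: "'a measure \<Rightarrow> real \<Rightarrow> ('a \<Rightarrow> ennreal) \<Rightarrow> ennreal" where
  "Lp_norm M p F = ennreal_powr (\<integral>\<^sup>+x. ennreal_powr (F x) p \<partial>M) (1 / p)"

definition in_Lp :: "'a measure \<Rightarrow> real \<Rightarrow> ('a \<Rightarrow> real) \<Rightarrow> bool" where
  "in_Lp M p f \<longleftrightarrow> f \<in> borel_measurable M \<and> Lp_norm M p (\<lambda>x. ennreal \<bar>f x\<bar>) < \<infinity>"

end

theory Submission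
  imports Defs
begin

text \<open>
  By monotone convergence the family \<open>G\<close> may be taken finite, and then everything lives on finitely many equal
  cells. Expand \<open>f\<close> into product martingale differences and let \<open>f\<^sub>D\<close> be the part of the expansion on rectangles
  that lie above a member of \<open>G\<close>. Since no member of \<open>G\<close> is strictly smaller in every coordinate than another
  one containing it, inclusion-exclusion writes the average of \<open>f\<close> over a member of \<open>G\<close> as a combination of averages of
  \<open>f\<^sub>D\<close> that leave some coordinate \<open>j\<close> untouched. A good-\<open>\<lambda>\<close> inequality in the other \<open>m - 1\<close> coordinates controls
  these by a square function \<open>S\<^sub>j\<close>. In the \<open>j\<close>-th coordinate the terms of \<open>S\<^sub>j\<close> are averages at the first level that
  meets \<open>G\<close>, where the averages of \<open>f\<close> are again bounded by the maximal function; hence \<open>S\<^sub>j\<^sup>2\<close> is at most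
  \<open>(M f)\<^bsup>2-p\<^esup>\<close> times an energy built from \<open>a\<^sup>2 / b\<^bsup>2-p\<^esup>\<close>. The joint convexity of this weight bounds the energy in
  one coordinate with constant \<open>O(1/(p-1))\<close>, which yields \<open>m - 1\<close> powers of \<open>p'\<close>, and Young's inequality absorbs
  \<open>M f\<close>. The bounds for sparse families follow by duality and by summing the exponential series.
\<close>

text \<open>Iterating a one-parameter maximal inequality costs a factor p' in every coordinate, m
  factors in all, so one coordinate has to be treated for free. Summed over its levels, the
  expansion in coordinate \<open>j\<close> telescopes to one average at a stopping level, and
  Jensen's inequality for the convex weight removes that average without a constant. Each other
  coordinate costs 1 / (p - 1): the weight owes its convexity to the concavity of b^s with s = 2 -
  p, and the second derivative of b^s vanishes linearly as s tends to 1. Whether a term of the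
  expansion is kept is decided on the parent rectangle. A factor constant there does not disturb the
  vanishing averages of a martingale difference, so the kept terms stay orthogonal. For p up to 3/2
  the strong maximal function enters only in L^2, at a cost independent of p; above 3/2, p' is
  bounded and iterated Doob inequalities suffice. The absorption is legitimate because all sums in
  the discrete model are finite.\<close>

section \<open>Quantitative joint convexity of a^2 / b^s\<close>

text \<open>On (0, K] the second derivative of \<open>t powr s\<close> has absolute value at least s
  * (1 - s) / K^2, and s >= 1/2 turns half of this into the stated constant. The factor 1 - s, later
  p - 1, is where the powers of p' originate.\<close>

lemma powr_second_order:
  fixes s t K :: real
  assumes s: "1/2 \<le> s" "s < 1" and t: "0 < t" "t \<le> K" and K: "1 \<le> K"
  shows "1 + s * (t - 1) - t powr s \<ge> (1 - s) / (4 * K\<^sup>2) * (t - 1)\<^sup>2"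
proof -
  define c where "c = (1 - s) / (4 * K\<^sup>2)"
  define g where "g = (\<lambda>u::real. 1 + s * (u - 1) - u powr s - c * (u - 1)\<^sup>2)"
  define g' where "g' = (\<lambda>u::real. s - s * u powr (s - 1) - 2 * c * (u - 1))"
  define g'' where "g'' = (\<lambda>u::real. s * (1 - s) * u powr (s - 2) - 2 * c)"
  have d1: "(g has_real_derivative g' u) (at u)" if "0 < u" for u
    unfolding g_def g'_def using that by (auto intro!: derivative_eq_intros simp: algebra_simps)
  have d2: "(g' has_real_derivative g'' u) (at u)" if "0 < u" for u
    unfolding g'_def g''_def using that
    by (auto intro!: derivative_eq_intros simp: algebra_simps)
  have pos: "g'' u \<ge> 0" if u: "u \<in> {0<..K}" for u
  proof -
    have "K powr (s - 2) \<le> u powr (s - 2)"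
      using u s by (intro powr_mono2') auto
    moreover have "K powr (-2) \<le> K powr (s - 2)" using K s by (intro powr_mono) auto
    ultimately have "1 / K\<^sup>2 \<le> u powr (s - 2)" using K by (simp add: powr_minus powr_realpow divide_inverse)
    then have "s * (1 - s) * (1 / K\<^sup>2) \<le> s * (1 - s) * u powr (s - 2)"
      using s by (intro mult_left_mono) auto
    moreover have "(1/2) * ((1 - s) * (1 / K\<^sup>2)) \<le> s * ((1 - s) * (1 / K\<^sup>2))"
      using s by (intro mult_right_mono) auto
    moreover have "2 * c = (1/2) * ((1 - s) * (1 / K\<^sup>2))" by (simp add: c_def divide_simps)
    ultimately show ?thesis unfolding g''_def by (simp add: mult.assoc)
  qed
  \<comment> \<open>Both \<open>g\<close> and \<open>g'\<close> vanish at 1, so convexity alone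
    gives \<open>0 \<le> g t\<close>.\<close>
  have "g' 1 * (t - 1) \<le> g t - g 1"
    by (rule f''_imp_f'[where C = "{0<..K}" and f'' = g'']) (use d1 d2 pos t K in auto)
  then show ?thesis by (simp add: g_def g'_def c_def)
qed

lemma powr_diff_le:
  fixes s t :: real
  assumes "0 \<le> s" "s \<le> 1" "0 < t"
  shows "\<bar>t powr s - 1\<bar> \<le> \<bar>t - 1\<bar>"
proof (cases "t \<ge> 1")
  case True
  have "t powr 0 \<le> t powr s" "t powr s \<le> t powr 1" using assms True by (intro powr_mono; simp)+
  then show ?thesis using True assms by simp
next
  case False
  have "t powr s \<le> t powr 0" "t powr 1 \<le> t powr s" using assms False by (intro powr_mono'; simp)+
  then show ?thesis using False assms by simp
qed

text \<open>The jointly convex weight \<open>a\<^sup>2 / b\<^sup>s\<close>; the energy of \<open>f\<close> in the exponent \<open>p\<close> is measured with \<open>s = 2 - p\<close>.\<close>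

definition quot_sq :: "real \<Rightarrow> real \<Rightarrow> real \<Rightarrow> real" where
  "quot_sq s a b = a\<^sup>2 * b powr (- s)"

lemma quot_sq_nonneg: "0 \<le> quot_sq s a b"
  by (simp add: quot_sq_def)

text \<open>For every \<theta>, a^2 b^(-s) >= 2 \<theta> a - \<theta>^2 b^s, with equality at
  \<theta> = a b^(-s). Freezing \<theta> at its value for (a0, b0) and replacing the concave b^s by
  its tangent gives the tangent plane. A square is discarded in the first step and a concavity
  defect in the second; together they control \<open>a1 - a0\<close>.\<close>

lemma quot_sq_tangent_gain:
  fixes a0 a1 b0 b1 s K :: real
  assumes s: "1/2 \<le> s" "s < 1" and b: "0 < b0" "0 < b1" "b1 \<le> K * b0" and K: "1 \<le> K"
  shows "quot_sq s a1 b1 \<ge>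
    2 * (a0 * b0 powr (- s)) * a1 - (a0 * b0 powr (- s))\<^sup>2 * (b0 powr s + s * b0 powr (s - 1) * (b1 - b0))
     + (1 - s) / (8 * K\<^sup>2) * quot_sq s (a1 - a0) b0"
proof -
  define \<theta> where "\<theta> = a0 * b0 powr (- s)"
  define t where "t = b1 / b0"
  \<comment> \<open>\<open>a1 - a0 = u + v\<close>, where \<open>u\<close> measures how far \<theta>
    is from optimal at (a1, b1) and \<open>v\<close> comes from the change of b^s.\<close>
  define u where "u = a1 - \<theta> * b1 powr s"
  define v where "v = \<theta> * (b1 powr s - b0 powr s)"
  have t: "0 < t" "t \<le> K" using b by (auto simp: t_def field_simps)
  have b1: "b1 = t * b0" using b by (simp add: t_def)
  have inv: "b0 powr s * b0 powr (-s) = 1" "b1 powr s * b1 powr (-s) = 1"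
    using b by (simp_all add: powr_add[symmetric])
  have a0: "a0 = \<theta> * b0 powr s" using inv by (simp add: \<theta>_def algebra_simps)
  have q: "quot_sq s a1 b1 = 2 * \<theta> * a1 - \<theta>\<^sup>2 * b1 powr s + b1 powr (-s) * u\<^sup>2"
  proof -
    have "b1 powr (-s) * u\<^sup>2 = a1\<^sup>2 * b1 powr (-s) - 2 * \<theta> * a1 * (b1 powr s * b1 powr (-s))
        + \<theta>\<^sup>2 * b1 powr s * (b1 powr s * b1 powr (-s))"
      by (simp add: u_def power2_eq_square algebra_simps)
    then show ?thesis using inv by (simp add: quot_sq_def)
  qed
  define g where "g = (1 - s) / (8 * K\<^sup>2)"
  have g: "0 \<le> g" "2 * g = (1 - s) / (4 * K\<^sup>2)" using s K by (simp_all add: g_def divide_simps)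
  have K2: "1 \<le> K\<^sup>2" using K by (simp add: one_le_power)
  have part1: "2 * g * (b0 powr (-s) * u\<^sup>2) \<le> b1 powr (-s) * u\<^sup>2"
  proof -
    have "K powr (- 1) \<le> K powr (- s)" using K s by (intro powr_mono) auto
    moreover have "(K * b0) powr (-s) \<le> b1 powr (-s)" using b s by (intro powr_mono2') auto
    ultimately have "K powr (-1) * b0 powr (-s) \<le> b1 powr (-s)"
      using K b by (smt (verit) powr_ge_zero powr_mult mult_right_mono)
    moreover have "2 * g \<le> K powr (-1)"
    proof -
      have "(1 - s) / (4 * K\<^sup>2) \<le> 1 / K\<^sup>2" using s K by (simp add: field_simps)
      also have "\<dots> \<le> 1 / K" using K by (simp add: field_simps power2_eq_square)
      also have "\<dots> = K powr (-1)" using K by (simp add: powr_minus divide_inverse)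
      finally show ?thesis unfolding g(2) .
    qed
    then have "2 * g * b0 powr (-s) \<le> K powr (-1) * b0 powr (-s)"
      by (intro mult_right_mono) auto
    ultimately have "2 * g * b0 powr (-s) \<le> b1 powr (-s)" by linarith
    then show ?thesis by (metis mult.assoc mult_right_mono zero_le_power2)
  qed
  have part2: "2 * g * (b0 powr (-s) * v\<^sup>2) \<le> \<theta>\<^sup>2 * (b0 powr s + s * b0 powr (s - 1) * (b1 - b0) - b1 powr s)"
  proof -
    have e1: "b1 powr s = t powr s * b0 powr s" using t b by (simp add: b1 powr_mult)
    have e2: "b0 powr (s - 1) * (b1 - b0) = b0 powr s * (t - 1)"
      using b by (simp add: b1 powr_diff field_simps)
    have "b0 powr s + s * b0 powr (s - 1) * (b1 - b0) - b1 powr s = b0 powr s * (1 + s * (t - 1) - t powr s)"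
      by (simp only: e1 mult.assoc e2) (simp add: algebra_simps)
    moreover have "(t powr s - 1)\<^sup>2 \<le> (t - 1)\<^sup>2"
      using powr_diff_le[of s t] s t by (simp add: abs_le_square_iff)
    then have "2 * g * (t powr s - 1)\<^sup>2 \<le> 2 * g * (t - 1)\<^sup>2"
      using g by (intro mult_left_mono) auto
    then have "2 * g * (t powr s - 1)\<^sup>2 \<le> 1 + s * (t - 1) - t powr s"
      using powr_second_order[OF s t K] unfolding g(2) by linarith
    then have "\<theta>\<^sup>2 * (b0 powr s * (2 * g * (t powr s - 1)\<^sup>2)) \<le> \<theta>\<^sup>2 * (b0 powr s * (1 + s * (t - 1) - t powr s))"
      by (intro mult_left_mono) auto
    moreover have "2 * g * (b0 powr (-s) * v\<^sup>2) = \<theta>\<^sup>2 * (b0 powr s * (2 * g * (t powr s - 1)\<^sup>2)) * (b0 powr s * b0 powr (-s))"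
      by (simp add: v_def e1 power2_eq_square algebra_simps)
    ultimately show ?thesis
      using \<open>b0 powr s + s * b0 powr (s - 1) * (b1 - b0) - b1 powr s = _\<close> inv
      by (simp only: mult_1_right)
  qed
  have "a1 - a0 = u + v" by (simp add: a0 u_def v_def algebra_simps)
  moreover have "(u + v)\<^sup>2 \<le> 2 * u\<^sup>2 + 2 * v\<^sup>2" using sum_squares_bound[of u v] by (simp add: power2_sum)
  ultimately have "(a1 - a0)\<^sup>2 \<le> 2 * u\<^sup>2 + 2 * v\<^sup>2" by simp
  then have "b0 powr (-s) * (a1 - a0)\<^sup>2 \<le> b0 powr (-s) * (2 * u\<^sup>2 + 2 * v\<^sup>2)"
    by (rule mult_left_mono) simp
  then have "g * quot_sq s (a1 - a0) b0 \<le> g * (b0 powr (-s) * (2 * u\<^sup>2 + 2 * v\<^sup>2))"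
    unfolding quot_sq_def by (intro mult_left_mono) (use g(1) in \<open>simp_all add: mult.commute\<close>)
  also have "\<dots> = 2 * g * (b0 powr (-s) * u\<^sup>2) + 2 * g * (b0 powr (-s) * v\<^sup>2)"
    by (simp add: algebra_simps)
  finally have "quot_sq s a1 b1 \<ge> 2 * \<theta> * a1 - \<theta>\<^sup>2 * (b0 powr s + s * b0 powr (s - 1) * (b1 - b0)) + g * quot_sq s (a1 - a0) b0"
    using part1 part2 q by (simp add: algebra_simps)
  then show ?thesis by (simp add: \<theta>_def g_def)
qed

subsection \<open>Block averages\<close>

text \<open>
  The discrete model of the product grid: \<open>X\<close> is the set of finest cells and \<open>b k x\<close> is the set of cells in
  the rectangle through \<open>x\<close> whose \<open>i\<close>-th factor has side \<open>2\<close> to the power \<open>k i\<close> (relative to the cells, and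
  capped at \<open>L\<close>). Assumptions \<open>b_inter\<close> and \<open>b_card\<close> say that averaging at level \<open>k\<close> after averaging at
  level \<open>l\<close> is averaging at the coordinatewise maximum.
\<close>

locale block_averages =
  fixes X :: "'x set" and b :: "(nat \<Rightarrow> nat) \<Rightarrow> 'x \<Rightarrow> 'x set" and m L :: nat and K :: real
  assumes fin: "finite X" and K1: "1 \<le> K"
    and b_sub: "x \<in> X \<Longrightarrow> b k x \<subseteq> X"
    and b_self: "x \<in> X \<Longrightarrow> x \<in> b k x"
    and b_eq: "x \<in> X \<Longrightarrow> y \<in> b k x \<Longrightarrow> b k y = b k x"
    and b_inter: "x \<in> X \<Longrightarrow> z \<in> X \<Longrightarrow> b k x \<inter> b l z \<noteq> {} \<Longrightarrow> z \<in> b (\<lambda>i. max (k i) (l i)) x"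
    and b_card: "x \<in> X \<Longrightarrow> z \<in> b (\<lambda>i. max (k i) (l i)) x \<Longrightarrow>
       card (b k x \<inter> b l z) * card (b (\<lambda>i. max (k i) (l i)) x) = card (b k x) * card (b l z)"
    and b_zero: "x \<in> X \<Longrightarrow> (\<And>i. i < m \<Longrightarrow> k i = 0) \<Longrightarrow> b k x = {x}"
    and b_mono: "x \<in> X \<Longrightarrow> (\<And>i. i < m \<Longrightarrow> k i \<le> l i) \<Longrightarrow> b k x \<subseteq> b l x"
    and b_reg: "x \<in> X \<Longrightarrow> real (card (b (k(i := Suc (k i))) x)) \<le> K * real (card (b k x))"
begin

definition E :: "(nat \<Rightarrow> nat) \<Rightarrow> ('x \<Rightarrow> real) \<Rightarrow> 'x \<Rightarrow> real" where
  "E k f x = (if x \<in> X then (\<Sum>y\<in>b k x. f y) / real (card (b k x)) else 0)"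

definition meas :: "(nat \<Rightarrow> nat) \<Rightarrow> ('x \<Rightarrow> 'c) \<Rightarrow> bool" where
  "meas k g \<longleftrightarrow> (\<forall>x\<in>X. \<forall>y\<in>b k x. g y = g x)"

lemma b_fin: "x \<in> X \<Longrightarrow> finite (b k x)"
  using b_sub fin finite_subset by blast

lemma b_card_pos: "x \<in> X \<Longrightarrow> 0 < card (b k x)"
  using b_fin b_self card_gt_0_iff by blast

lemma b_sym: "x \<in> X \<Longrightarrow> y \<in> b k x \<Longrightarrow> x \<in> b k y"
  using b_eq b_self by blast

lemma b_iff: "x \<in> X \<Longrightarrow> y \<in> X \<Longrightarrow> y \<in> b k x \<longleftrightarrow> x \<in> b k y"
  using b_sym by blast

lemma b_in: "x \<in> X \<Longrightarrow> y \<in> b k x \<Longrightarrow> y \<in> X"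
  using b_sub by blast

lemma b_cong:
  assumes "x \<in> X" "\<And>i. i < m \<Longrightarrow> k i = l i"
  shows "b k x = b l x"
  using b_mono[OF assms(1), of k l] b_mono[OF assms(1), of l k] assms(2) by simp

lemma E_cong_index: "(\<And>i. i < m \<Longrightarrow> k i = l i) \<Longrightarrow> E k f = E l f"
  by (rule ext) (simp add: E_def b_cong[of _ k l])

lemma E_off: "x \<notin> X \<Longrightarrow> E k f x = 0"
  by (simp add: E_def)

lemma E_cong: "(\<And>x. x \<in> X \<Longrightarrow> f x = g x) \<Longrightarrow> E k f = E k g"
proof (rule ext)
  fix x assume "\<And>x. x \<in> X \<Longrightarrow> f x = g x"
  then have "x \<in> X \<Longrightarrow> (\<Sum>y\<in>b k x. f y) = (\<Sum>y\<in>b k x. g y)"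
    using b_in by (intro sum.cong) auto
  then show "E k f x = E k g x" by (simp add: E_def)
qed

lemma E_diff: "E k (\<lambda>x. f x - g x) x = E k f x - E k g x"
  by (simp add: E_def sum_subtractf diff_divide_distrib)

lemma E_scale: "E k (\<lambda>x. c * f x) x = c * E k f x"
  by (simp add: E_def sum_distrib_left[symmetric])

lemma E_zero: "E k (\<lambda>x. 0) = (\<lambda>x. 0)"
  by (rule ext) (simp add: E_def)

lemma E_sum: "E k (\<lambda>x. \<Sum>i\<in>I. f i x) x = (\<Sum>i\<in>I. E k (f i) x)"
proof (cases "x \<in> X")
  case True
  have "(\<Sum>y\<in>b k x. \<Sum>i\<in>I. f i y) = (\<Sum>i\<in>I. \<Sum>y\<in>b k x. f i y)" by (rule sum.swap)
  then show ?thesis using True by (simp add: E_def sum_divide_distrib)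
qed (simp add: E_def)

lemma E_mono: "(\<And>x. x \<in> X \<Longrightarrow> f x \<le> g x) \<Longrightarrow> E k f x \<le> E k g x"
  unfolding E_def by (auto intro!: divide_right_mono sum_mono dest: b_in)

lemma E_const: "x \<in> X \<Longrightarrow> E k (\<lambda>x. c) x = c"
  using b_card_pos[of x k] by (simp add: E_def)

lemma E_nonneg: "(\<And>x. x \<in> X \<Longrightarrow> 0 \<le> f x) \<Longrightarrow> 0 \<le> E k f x"
  using E_mono[of "\<lambda>x. 0" f k x] by (simp add: E_zero)

lemma E_pos:
  assumes "\<And>x. x \<in> X \<Longrightarrow> 0 < f x" "x \<in> X"
  shows "0 < E k f x"
proof -
  have "0 < (\<Sum>y\<in>b k x. f y)"
    using assms(1) b_fin[OF assms(2), of k] b_self[OF assms(2), of k] b_in[OF assms(2), of _ k] by (intro sum_pos) auto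
  then show ?thesis using assms b_card_pos by (simp add: E_def)
qed

lemma E_abs: "\<bar>E k f x\<bar> \<le> E k (\<lambda>x. \<bar>f x\<bar>) x"
  by (auto simp: E_def abs_divide intro!: divide_right_mono)

lemma E_mult_meas:
  assumes "meas k g"
  shows "E k (\<lambda>x. g x * f x) x = g x * E k f x"
proof (cases "x \<in> X")
  case True
  have "(\<Sum>y\<in>b k x. g y * f y) = (\<Sum>y\<in>b k x. g x * f y)"
    using assms True by (intro sum.cong) (auto simp: meas_def)
  then show ?thesis using True by (simp add: E_def sum_distrib_left)
qed (simp add: E_def)

lemma E_of_meas: "meas k g \<Longrightarrow> x \<in> X \<Longrightarrow> E k g x = g x"
  using E_mult_meas[of k g "\<lambda>x. 1" x] by (simp add: E_const)

lemma meas_E: "meas k (E k f)"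
  unfolding meas_def
proof (intro ballI)
  fix x y assume x: "x \<in> X" and y: "y \<in> b k x"
  then have "y \<in> X" by (rule b_in)
  with x b_eq[OF x y] show "E k f y = E k f x" by (simp add: E_def)
qed

lemma meas_mono: "meas l g \<Longrightarrow> (\<And>i. i < m \<Longrightarrow> k i \<le> l i) \<Longrightarrow> meas k g"
  unfolding meas_def using b_mono by blast

text \<open>The averaging kernel is symmetric: \<open>y \<in> b k x\<close> is a symmetric relation,
  and related points have the same block, hence the same denominator.\<close>

lemma E_sum_X: "(\<Sum>x\<in>X. E k f x * g x) = (\<Sum>x\<in>X. f x * E k g x)"
proof -
  have "(\<Sum>x\<in>X. E k f x * g x) = (\<Sum>x\<in>X. \<Sum>y\<in>X. if y \<in> b k x then f y * g x / real (card (b k x)) else 0)"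
  proof (intro sum.cong refl)
    fix x assume x: "x \<in> X"
    have "E k f x * g x = (\<Sum>y\<in>b k x. f y * g x / real (card (b k x)))"
      using x by (simp add: E_def sum_divide_distrib sum_distrib_right)
    also have "\<dots> = (\<Sum>y\<in>X. if y \<in> b k x then f y * g x / real (card (b k x)) else 0)"
      using fin b_sub[OF x, of k] by (simp add: sum.inter_restrict[symmetric] Int_absorb1)
    finally show "E k f x * g x = \<dots>" .
  qed
  also have "\<dots> = (\<Sum>y\<in>X. \<Sum>x\<in>X. if y \<in> b k x then f y * g x / real (card (b k x)) else 0)"
    by (rule sum.swap)
  also have "\<dots> = (\<Sum>y\<in>X. f y * E k g y)"
  proof (intro sum.cong refl)
    fix y assume y: "y \<in> X"
    have "(\<Sum>x\<in>X. if y \<in> b k x then f y * g x / real (card (b k x)) else 0)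
        = (\<Sum>x\<in>X. if x \<in> b k y then f y * g x / real (card (b k y)) else 0)"
    proof (intro sum.cong refl)
      fix x assume x: "x \<in> X"
      show "(if y \<in> b k x then f y * g x / real (card (b k x)) else 0)
          = (if x \<in> b k y then f y * g x / real (card (b k y)) else 0)"
        using b_iff[OF x y, of k] b_eq[OF x, of y k] by simp
    qed
    also have "\<dots> = (\<Sum>x\<in>b k y. f y * g x / real (card (b k y)))"
      using fin b_sub[OF y, of k] by (simp add: sum.inter_restrict[symmetric] Int_absorb1)
    also have "\<dots> = f y * E k g y"
      using y by (simp add: E_def sum_divide_distrib sum_distrib_left)
    finally show "(\<Sum>x\<in>X. if y \<in> b k x then f y * g x / real (card (b k x)) else 0) = f y * E k g y" .
  qed
  finally show ?thesis .
qed

lemma sum_E: "(\<Sum>x\<in>X. E k f x) = (\<Sum>x\<in>X. f x)"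
  using E_sum_X[of k f "\<lambda>x. 1"] by (simp add: E_const)

text \<open>In the double average a point z has weight \<open>card (b k x \<inter> b l z)\<close>
  divided by both block sizes. By \<open>b_card\<close> this is constant on the block of maximal
  level, and by \<open>b_inter\<close> it vanishes outside.\<close>

lemma E_comp: "E k (E l f) = E (\<lambda>i. max (k i) (l i)) f"
proof (rule ext)
  fix x
  let ?s = "\<lambda>i. max (k i) (l i)"
  show "E k (E l f) x = E ?s f x"
  proof (cases "x \<in> X")
    case x: True
    have "(\<Sum>y\<in>b k x. E l f y) = (\<Sum>y\<in>b k x. \<Sum>z\<in>X. if z \<in> b l y then f z / real (card (b l z)) else 0)"
    proof (intro sum.cong refl)
      fix y assume "y \<in> b k x"
      then have y: "y \<in> X" using x b_in by blast
      have "E l f y = (\<Sum>z\<in>b l y. f z / real (card (b l z)))"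
        using y b_eq[OF y] by (simp add: E_def sum_divide_distrib)
      also have "\<dots> = (\<Sum>z\<in>X. if z \<in> b l y then f z / real (card (b l z)) else 0)"
        using fin b_sub[OF y, of l] by (simp add: sum.inter_restrict[symmetric] Int_absorb1)
      finally show "E l f y = \<dots>" .
    qed
    also have "\<dots> = (\<Sum>z\<in>X. \<Sum>y\<in>b k x. if z \<in> b l y then f z / real (card (b l z)) else 0)"
      by (rule sum.swap)
    also have "\<dots> = (\<Sum>z\<in>X. if z \<in> b ?s x then f z * (real (card (b k x)) / real (card (b ?s x))) else 0)"
    proof (intro sum.cong refl)
      fix z assume z: "z \<in> X"
      have "(\<Sum>y\<in>b k x. if z \<in> b l y then f z / real (card (b l z)) else 0)
          = (\<Sum>y\<in>b k x. if y \<in> b l z then f z / real (card (b l z)) else 0)"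
      proof (intro sum.cong refl)
        fix y assume "y \<in> b k x"
        then have "z \<in> b l y \<longleftrightarrow> y \<in> b l z" using b_iff z b_in[OF x] by blast
        then show "(if z \<in> b l y then f z / real (card (b l z)) else 0)
          = (if y \<in> b l z then f z / real (card (b l z)) else 0)" by simp
      qed
      also have "\<dots> = real (card (b k x \<inter> b l z)) * (f z / real (card (b l z)))"
        by (subst sum.inter_restrict[symmetric]) (use b_fin[OF x] in simp_all)
      finally have *: "(\<Sum>y\<in>b k x. if z \<in> b l y then f z / real (card (b l z)) else 0)
         = real (card (b k x \<inter> b l z)) * (f z / real (card (b l z)))" .
      show "(\<Sum>y\<in>b k x. if z \<in> b l y then f z / real (card (b l z)) else 0)
         = (if z \<in> b ?s x then f z * (real (card (b k x)) / real (card (b ?s x))) else 0)"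
      proof (cases "z \<in> b ?s x")
        case True
        have "real (card (b k x \<inter> b l z)) * real (card (b ?s x)) = real (card (b k x)) * real (card (b l z))"
          using b_card[OF x True] by (metis of_nat_mult)
        then have "real (card (b k x \<inter> b l z)) / real (card (b l z)) = real (card (b k x)) / real (card (b ?s x))"
          using b_card_pos[OF x, of ?s] b_card_pos[OF z, of l] by (simp add: field_simps)
        then have "real (card (b k x \<inter> b l z)) * (f z / real (card (b l z)))
            = f z * (real (card (b k x)) / real (card (b ?s x)))"
          by (metis mult.commute times_divide_eq_left times_divide_eq_right)
        then show ?thesis unfolding * using True by simp
      next
        case False
        then have "b k x \<inter> b l z = {}" using b_inter[OF x z] by blast
        then show ?thesis using False * by simp
      qed
    qed
    also have "\<dots> = (\<Sum>z\<in>b ?s x. f z * (real (card (b k x)) / real (card (b ?s x))))"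
      using fin b_sub[OF x, of ?s] by (simp add: sum.inter_restrict[symmetric] Int_absorb1)
    finally show ?thesis using x b_card_pos[OF x, of k]
      by (simp add: E_def sum_divide_distrib[symmetric] sum_distrib_right[symmetric])
  qed (simp add: E_def)
qed

lemma E_id: "x \<in> X \<Longrightarrow> (\<And>i. i < m \<Longrightarrow> k i = 0) \<Longrightarrow> E k f x = f x"
  using b_zero[of x k] by (simp add: E_def)

lemma E_absorb: "(\<And>i. i < m \<Longrightarrow> l i \<le> k i) \<Longrightarrow> E k (E l f) = E k f"
  unfolding E_comp by (rule E_cong_index) simp

lemma E_comm: "E k (E l f) = E l (E k f)"
  by (simp add: E_comp max.commute)

text \<open>Supplies the hypothesis \<open>b1 \<le> K * b0\<close> of
  \<open>quot_sq_tangent_gain\<close> for averages at consecutive levels.\<close>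

lemma E_regular:
  assumes f: "\<And>x. x \<in> X \<Longrightarrow> 0 \<le> f x" and x: "x \<in> X"
  shows "E k f x \<le> K * E (k(i := Suc (k i))) f x"
proof -
  let ?k = "k(i := Suc (k i))"
  have le: "(\<Sum>y\<in>b k x. f y) \<le> (\<Sum>y\<in>b ?k x. f y)"
    using b_fin[OF x] b_mono[OF x, of k ?k] f b_in[OF x] by (intro sum_mono2) auto
  have nn: "0 \<le> (\<Sum>y\<in>b ?k x. f y)" using f b_in[OF x] by (intro sum_nonneg) auto
  have "E k f x \<le> (\<Sum>y\<in>b ?k x. f y) / real (card (b k x))"
    using x le by (simp add: E_def divide_right_mono)
  also have "\<dots> \<le> K * ((\<Sum>y\<in>b ?k x. f y) / real (card (b ?k x)))"
  proof -
    have "(\<Sum>y\<in>b ?k x. f y) * real (card (b ?k x)) \<le> (\<Sum>y\<in>b ?k x. f y) * (K * real (card (b k x)))"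
      using b_reg[OF x, of k i] nn by (intro mult_left_mono) auto
    then show ?thesis using b_card_pos[OF x, of k] b_card_pos[OF x, of ?k] by (simp add: field_simps)
  qed
  finally show ?thesis using x by (simp add: E_def)
qed

end

section \<open>Tangent planes and scalar power inequalities\<close>

text \<open>No bound on b1 / b0 is available here, so K is taken from that ratio itself and the
  gain, whose constant then depends on the point, is dropped.\<close>

lemma quot_sq_tangent:
  assumes s: "1/2 \<le> s" "s < 1" and b: "0 < b0" "0 < b1"
  shows "quot_sq s a1 b1 \<ge> 2 * (a0 * b0 powr (- s)) * a1
    - (a0 * b0 powr (- s))\<^sup>2 * (b0 powr s + s * b0 powr (s - 1) * (b1 - b0))"
proof -
  define K where "K = max 1 (b1 / b0)"
  have K: "1 \<le> K" and "b1 / b0 \<le> K" by (simp_all add: K_def)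
  then have "b1 \<le> K * b0" using b by (simp add: field_simps)
  moreover have "0 \<le> (1 - s) / (8 * K\<^sup>2) * quot_sq s (a1 - a0) b0"
    using s quot_sq_nonneg by simp
  ultimately show ?thesis using quot_sq_tangent_gain[where ?a1.0 = a1 and ?a0.0 = a0, OF s b _ K] by linarith
qed

lemma quot_sq_tangent_value:
  assumes "0 < b"
  shows "2 * (a * b powr (- s)) * a - (a * b powr (- s))\<^sup>2 * b powr s = quot_sq s a b"
proof -
  have "b powr s * b powr (- s) = 1" using assms by (simp add: powr_add[symmetric])
  then have "(a * b powr (- s))\<^sup>2 * b powr s = a\<^sup>2 * b powr (- s)"
    by (simp add: power2_eq_square algebra_simps)
  show ?thesis unfolding \<open>(a * b powr (- s))\<^sup>2 * b powr s = _\<close>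
    by (simp add: quot_sq_def power2_eq_square algebra_simps)
qed

text \<open>The reason for s = 2 - p: with f both as numerator and as denominator the weight is
  f^p.\<close>

lemma quot_sq_diag:
  assumes "0 < b"
  shows "quot_sq s b b = b powr (2 - s)"
  using assms by (simp add: quot_sq_def powr_diff powr_minus divide_inverse)

text \<open>Young's inequality for the cross term. It is applied to the jumps of a running maximum,
  with r the old maximum and t the new average, and produces the factor of Doob's
  inequality.\<close>

lemma power_increment_bound:
  fixes r t p :: real
  assumes p: "1 < p" and r: "0 \<le> r" "0 \<le> t"
  shows "t powr p - r powr p \<le> p / (p - 1) * (t * (t powr (p - 1) - r powr (p - 1)))"
proof -
  have "t * r powr (p - 1) \<le> t powr p / p + (r powr (p - 1)) powr (p / (p - 1)) / (p / (p - 1))"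
    using p r by (intro Youngs_inequality) (auto simp: field_simps)
  also have "(r powr (p - 1)) powr (p / (p - 1)) = r powr p"
    using p by (simp add: powr_powr)
  finally have "p / (p - 1) * (t * r powr (p - 1)) \<le> p / (p - 1) * (t powr p / p + r powr p / (p / (p - 1)))"
    using p by (intro mult_left_mono) auto
  also have "\<dots> = t powr p / (p - 1) + r powr p" using p by (simp add: field_simps)
  finally have *: "p / (p - 1) * (t * r powr (p - 1)) \<le> t powr p / (p - 1) + r powr p" .
  have "t * t powr (p - 1) = t powr p" using r p by (cases "t = 0") (simp_all add: powr_diff)
  then have "p / (p - 1) * (t * (t powr (p - 1) - r powr (p - 1)))
      = p / (p - 1) * t powr p - p / (p - 1) * (t * r powr (p - 1))" by (simp add: algebra_simps)
  moreover have "p / (p - 1) * t powr p = t powr p + t powr p / (p - 1)" using p by (simp add: field_simps)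
  ultimately show ?thesis using * by linarith
qed

text \<open>A form of Young's inequality with explicit constants, by comparing r with a * g. The
  term r^p / a is the one absorbed in \<open>doob\<close>.\<close>

lemma mult_powr_split:
  fixes a g r p :: real
  assumes "1 < p" "0 < a" "0 \<le> g" "0 \<le> r"
  shows "g * r powr (p - 1) \<le> a powr (p - 1) * g powr p + r powr p / a"
proof (cases "r \<le> a * g")
  case True
  have "r powr (p - 1) \<le> (a * g) powr (p - 1)" using True assms by (intro powr_mono2) auto
  then have "g * r powr (p - 1) \<le> g * (a powr (p - 1) * g powr (p - 1))"
    using assms by (simp add: powr_mult mult_left_mono)
  also have "\<dots> = a powr (p - 1) * g powr p"
    using assms by (cases "g = 0") (simp_all add: powr_diff)
  finally show ?thesis using assms by (smt (verit) divide_nonneg_pos powr_ge_zero)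
next
  case False
  then have "g \<le> r / a" using assms by (simp add: field_simps)
  then have "g * r powr (p - 1) \<le> r / a * r powr (p - 1)" by (intro mult_right_mono) auto
  also have "\<dots> = r powr p / a" using assms by (cases "r = 0") (simp_all add: powr_diff)
  finally show ?thesis by (smt (verit) mult_nonneg_nonneg powr_ge_zero)
qed

section \<open>Energy of martingale differences\<close>

context block_averages
begin

definition e :: "nat \<Rightarrow> nat \<Rightarrow> ('x \<Rightarrow> real) \<Rightarrow> 'x \<Rightarrow> real" where
  "e i c = E ((\<lambda>_. 0)(i := c))"

text \<open>At the coarsest level \<open>L\<close> the difference is the average itself, so that the differences telescope to \<open>f\<close>.\<close>

definition d :: "nat \<Rightarrow> nat \<Rightarrow> ('x \<Rightarrow> real) \<Rightarrow> 'x \<Rightarrow> real" where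
  "d i c f = (\<lambda>x. e i c f x - (if c < L then e i (Suc c) f x else 0))"

text \<open>The tangent plane at the pair of averages is affine, so averaging the pointwise
  inequality evaluates the plane at its base point.\<close>

lemma E_jensen:
  assumes s: "1/2 \<le> s" "s < 1" and pos: "\<And>x. x \<in> X \<Longrightarrow> 0 < \<beta> x" and x: "x \<in> X"
  shows "quot_sq s (E k \<alpha> x) (E k \<beta> x) \<le> E k (\<lambda>y. quot_sq s (\<alpha> y) (\<beta> y)) x"
proof -
  define a0 b0 where "a0 = E k \<alpha> x" and "b0 = E k \<beta> x"
  have b0: "0 < b0" unfolding b0_def by (rule E_pos[OF pos x])
  define \<theta> where "\<theta> = a0 * b0 powr (- s)"
  define u v where "u = \<theta>\<^sup>2 * (s * b0 powr (s - 1))" and "v = \<theta>\<^sup>2 * (b0 powr s - s * b0 powr (s - 1) * b0)"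
  have "E k (\<lambda>y. (2 * \<theta> * \<alpha> y - u * \<beta> y) - v) x \<le> E k (\<lambda>y. quot_sq s (\<alpha> y) (\<beta> y)) x"
  proof (rule E_mono)
    fix y assume "y \<in> X"
    from quot_sq_tangent[OF s b0 pos[OF this], where ?a0.0 = a0 and ?a1.0 = "\<alpha> y"]
    show "2 * \<theta> * \<alpha> y - u * \<beta> y - v \<le> quot_sq s (\<alpha> y) (\<beta> y)"
      unfolding \<theta>_def[symmetric] u_def v_def by (simp add: algebra_simps)
  qed
  also have "E k (\<lambda>y. (2 * \<theta> * \<alpha> y - u * \<beta> y) - v) x = 2 * \<theta> * a0 - u * b0 - v"
    by (simp add: E_diff E_scale E_const[OF x] a0_def b0_def)
  also have "\<dots> = 2 * \<theta> * a0 - \<theta>\<^sup>2 * b0 powr s" by (simp add: u_def v_def algebra_simps)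
  also have "\<dots> = quot_sq s a0 b0" unfolding \<theta>_def by (rule quot_sq_tangent_value[OF b0])
  finally show ?thesis by (simp add: a0_def b0_def)
qed

lemma sum_meas_E: "meas k g \<Longrightarrow> (\<Sum>x\<in>X. g x * E k f x) = (\<Sum>x\<in>X. g x * f x)"
  using E_sum_X[of k f g] E_of_meas[of k g] by (simp add: mult.commute)

text \<open>The tangent planes are taken at the coarser averages. Their slopes \<theta> and
  \<open>w\<close> are constant on coarser blocks, so they pair equally with the finer and the
  coarser average; in the sum all linear terms cancel and only the gain is left, with its
  denominators on the coarser level.\<close>

lemma energy_gain:
  fixes k :: "nat \<Rightarrow> nat" and i :: nat
  assumes s: "1/2 \<le> s" "s < 1" and pos: "\<And>x. x \<in> X \<Longrightarrow> 0 < \<beta> x"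
  defines "l \<equiv> k(i := Suc (k i))"
  shows "(1 - s) / (8 * K\<^sup>2) * (\<Sum>x\<in>X. quot_sq s (E k \<alpha> x - E l \<alpha> x) (E l \<beta> x))
    \<le> (\<Sum>x\<in>X. quot_sq s (E k \<alpha> x) (E k \<beta> x)) - (\<Sum>x\<in>X. quot_sq s (E l \<alpha> x) (E l \<beta> x))"
proof -
  define \<theta> where "\<theta> x = E l \<alpha> x * E l \<beta> x powr (- s)" for x
  define w where "w x = (\<theta> x)\<^sup>2 * (s * E l \<beta> x powr (s - 1))" for x
  have mE: "meas l (E l f)" for f by (rule meas_E)
  have kl: "meas l g \<Longrightarrow> meas k g" for g :: "'x \<Rightarrow> real"
    by (rule meas_mono[of l]) (auto simp: l_def)
  have m\<theta>: "meas l \<theta>" and mw: "meas l w"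
    using mE[of \<alpha>] mE[of \<beta>] by (auto simp: meas_def \<theta>_def w_def)
  have sw: "(\<Sum>x\<in>X. g x * E k f x) = (\<Sum>x\<in>X. g x * E l f x)" if "meas l g" for f g
    using sum_meas_E[OF that] sum_meas_E[OF kl[OF that]] by simp
  have "(\<Sum>x\<in>X. quot_sq s (E l \<alpha> x) (E l \<beta> x)) =
      (\<Sum>x\<in>X. 2 * (\<theta> x * E l \<alpha> x) - (\<theta> x)\<^sup>2 * E l \<beta> x powr s)"
    using E_pos[OF pos] by (intro sum.cong) (simp_all add: \<theta>_def quot_sq_tangent_value[symmetric])
  also have "\<dots> = 2 * (\<Sum>x\<in>X. \<theta> x * E l \<alpha> x) - (\<Sum>x\<in>X. (\<theta> x)\<^sup>2 * E l \<beta> x powr s)"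
    by (simp add: sum_subtractf sum_distrib_left)
  also have "\<dots> = 2 * (\<Sum>x\<in>X. \<theta> x * E k \<alpha> x) - (\<Sum>x\<in>X. (\<theta> x)\<^sup>2 * E l \<beta> x powr s)
      - ((\<Sum>x\<in>X. w x * E k \<beta> x) - (\<Sum>x\<in>X. w x * E l \<beta> x))"
    using sw[OF m\<theta>] sw[OF mw] by simp
  also have "\<dots> = (\<Sum>x\<in>X. 2 * \<theta> x * E k \<alpha> x
      - (\<theta> x)\<^sup>2 * (E l \<beta> x powr s + s * E l \<beta> x powr (s - 1) * (E k \<beta> x - E l \<beta> x)))"
    unfolding sum_distrib_left sum_subtractf[symmetric]
    by (intro sum.cong) (simp_all add: w_def algebra_simps)
  finally have 1: "(\<Sum>x\<in>X. quot_sq s (E l \<alpha> x) (E l \<beta> x)) = \<dots>" .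
  have "(\<Sum>x\<in>X. quot_sq s (E l \<alpha> x) (E l \<beta> x))
      + (\<Sum>x\<in>X. (1 - s) / (8 * K\<^sup>2) * quot_sq s (E k \<alpha> x - E l \<alpha> x) (E l \<beta> x))
      \<le> (\<Sum>x\<in>X. quot_sq s (E k \<alpha> x) (E k \<beta> x))"
    unfolding 1 sum.distrib[symmetric]
  proof (rule sum_mono)
    fix x assume x: "x \<in> X"
    have "E k \<beta> x \<le> K * E l \<beta> x"
      unfolding l_def using pos x by (intro E_regular) (auto intro: less_imp_le)
    from quot_sq_tangent_gain[OF s E_pos[OF pos x] E_pos[OF pos x] this K1, where ?a1.0 = "E k \<alpha> x" and ?a0.0 = "E l \<alpha> x"]
    show "2 * \<theta> x * E k \<alpha> x
        - (\<theta> x)\<^sup>2 * (E l \<beta> x powr s + s * E l \<beta> x powr (s - 1) * (E k \<beta> x - E l \<beta> x))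
        + (1 - s) / (8 * K\<^sup>2) * quot_sq s (E k \<alpha> x - E l \<alpha> x) (E l \<beta> x)
        \<le> quot_sq s (E k \<alpha> x) (E k \<beta> x)"
      by (simp add: \<theta>_def)
  qed
  then show ?thesis by (simp add: sum_distrib_left)
qed

lemma e_zero: "x \<in> X \<Longrightarrow> e i 0 f x = f x"
  by (simp add: e_def E_id)

text \<open>Summing \<open>energy_gain\<close> over the levels telescopes. The summand c = L is the
  energy left over at the coarsest level, which the cap \<open>min (Suc c) L\<close> makes fit, and
  \<open>g \<le> 1\<close> lets it join the sum at no extra cost.\<close>

lemma energy_coordinate:
  assumes s: "1/2 \<le> s" "s < 1" and pos: "\<And>x. x \<in> X \<Longrightarrow> 0 < \<beta> x"
  shows "(\<Sum>c\<le>L. \<Sum>x\<in>X. quot_sq s (d i c \<alpha> x) (e i (min (Suc c) L) \<beta> x))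
    \<le> 8 * K\<^sup>2 / (1 - s) * (\<Sum>x\<in>X. quot_sq s (\<alpha> x) (\<beta> x))"
proof -
  define g where "g = (1 - s) / (8 * K\<^sup>2)"
  define S where "S c = (\<Sum>x\<in>X. quot_sq s (e i c \<alpha> x) (e i c \<beta> x))" for c
  define T where "T c = (\<Sum>x\<in>X. quot_sq s (d i c \<alpha> x) (e i (min (Suc c) L) \<beta> x))" for c
  have "1 \<le> K\<^sup>2" using K1 by (simp add: one_le_power)
  then have "0 < 8 * K\<^sup>2" "1 - s \<le> 8 * K\<^sup>2" using s by linarith+
  then have g: "0 < g" "g \<le> 1"
    using s divide_le_eq_1_pos[of "8 * K\<^sup>2" "1 - s"] unfolding g_def by (auto intro!: divide_pos_pos)
  have T: "g * T c \<le> S c - S (Suc c)" if "c < L" for c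
    using energy_gain[OF s pos, where k = "(\<lambda>_. 0)(i := c)" and i = i and \<alpha> = \<alpha>] that
    by (simp add: T_def S_def e_def d_def g_def)
  have S0: "0 \<le> S c" for c unfolding S_def by (intro sum_nonneg quot_sq_nonneg)
  have "g * (\<Sum>c\<le>L. T c) = (\<Sum>c<L. g * T c) + g * T L"
    by (simp add: lessThan_Suc_atMost[symmetric] sum_distrib_left distrib_left)
  also have "\<dots> \<le> (\<Sum>c<L. S c - S (Suc c)) + 1 * T L"
    using T g by (intro add_mono sum_mono mult_right_mono) (auto simp: T_def intro!: sum_nonneg quot_sq_nonneg)
  also have "T L = S L" by (simp add: T_def S_def d_def)
  also have "(\<Sum>c<L. S c - S (Suc c)) = S 0 - S L" by (rule sum_lessThan_telescope')
  finally have "g * (\<Sum>c\<le>L. T c) \<le> S 0" by simp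
  also have "S 0 = (\<Sum>x\<in>X. quot_sq s (\<alpha> x) (\<beta> x))" unfolding S_def by (intro sum.cong) (simp_all add: e_zero)
  finally have "(\<Sum>c\<le>L. T c) \<le> 1 / g * (\<Sum>x\<in>X. quot_sq s (\<alpha> x) (\<beta> x))"
    using g by (simp add: field_simps)
  then show ?thesis by (simp add: T_def g_def)
qed

text \<open>Level vectors on the coordinates \<open>i < n\<close> in \<open>T\<close>; the other entries are \<open>0\<close>, that is, no averaging.\<close>

definition levels :: "nat \<Rightarrow> nat set \<Rightarrow> (nat \<Rightarrow> nat) set" where
  "levels n T = {l. \<forall>i. (i < n \<and> i \<in> T \<longrightarrow> l i \<le> L) \<and> (\<not> (i < n \<and> i \<in> T) \<longrightarrow> l i = 0)}"

fun Dl :: "nat \<Rightarrow> nat set \<Rightarrow> (nat \<Rightarrow> nat) \<Rightarrow> ('x \<Rightarrow> real) \<Rightarrow> 'x \<Rightarrow> real" where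
  "Dl 0 T l f = f"
| "Dl (Suc n) T l f = (if n \<in> T then d n (l n) (Dl n T l f) else Dl n T l f)"

text \<open>Parent levels in the coordinates of T. Factors constant on the parent rectangle are
  compatible with product differences (\<open>pure_mult\<close>), so cut-offs and denominators are
  taken there.\<close>

definition up :: "nat \<Rightarrow> nat set \<Rightarrow> (nat \<Rightarrow> nat) \<Rightarrow> nat \<Rightarrow> nat" where
  "up n T l = (\<lambda>i. if i < n \<and> i \<in> T then min (Suc (l i)) L else 0)"

lemma levels_0: "levels 0 T = {\<lambda>_. 0}"
  by (auto simp: levels_def)

lemma levels_Suc_notin: "n \<notin> T \<Longrightarrow> levels (Suc n) T = levels n T"
  unfolding levels_def by (auto simp: less_Suc_eq)

lemma levels_insert_bij:
  assumes "j \<in> T" "j < n"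
  shows "bij_betw (\<lambda>(l, c). l(j := c)) (levels n (T - {j}) \<times> {..L}) (levels n T)"
proof (rule bij_betwI[where g = "\<lambda>l. (l(j := 0), l j)"])
  show "(\<lambda>(l, c). l(j := c)) \<in> levels n (T - {j}) \<times> {..L} \<rightarrow> levels n T"
    using assms by (auto simp: levels_def)
  show "(\<lambda>l. (l(j := 0), l j)) \<in> levels n T \<rightarrow> levels n (T - {j}) \<times> {..L}"
    using assms by (auto simp: levels_def)
qed (auto simp: levels_def fun_eq_iff)

lemma levels_Suc_diff: "levels (Suc n) (T - {n}) = levels n T"
  unfolding levels_def by (auto simp: less_Suc_eq)

lemma finite_levels: "finite (levels n T)"
proof (induction n)
  case (Suc n)
  show ?case
  proof (cases "n \<in> T")
    case True
    have "finite (levels (Suc n) (T - {n}) \<times> {..L})" using Suc by (simp add: levels_Suc_diff)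
    then show ?thesis using levels_insert_bij[OF True, of "Suc n"] bij_betw_finite by blast
  qed (simp add: levels_Suc_notin Suc)
qed (simp add: levels_0)

lemma sum_levels_insert:
  assumes "j \<in> T" "j < n"
  shows "(\<Sum>l\<in>levels n T. g l) = (\<Sum>l\<in>levels n (T - {j}). \<Sum>c\<le>L. g (l(j := c)))"
  using sum.reindex_bij_betw[OF levels_insert_bij[OF assms], of g, symmetric]
  by (simp add: sum.cartesian_product split_beta)

lemma sum_levels_Suc:
  "n \<in> T \<Longrightarrow> (\<Sum>l\<in>levels (Suc n) T. g l) = (\<Sum>l\<in>levels n T. \<Sum>c\<le>L. g (l(n := c)))"
  using sum_levels_insert[of n T "Suc n" g] by (simp add: levels_Suc_diff)

lemma Dl_cong: "(\<And>i. i < n \<Longrightarrow> i \<in> T \<Longrightarrow> l i = l' i) \<Longrightarrow> Dl n T l f = Dl n T l' f"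
  by (induction n) auto

text \<open>Coordinates are treated one at a time. After n of them the denominator is again an
  average of f, hence positive, so \<open>energy_coordinate\<close> applies to the new pair and
  contributes one more factor; the induction starts from \<open>quot_sq_diag\<close>.\<close>

lemma energy_product:
  assumes s: "1/2 \<le> s" "s < 1" and pos: "\<And>x. x \<in> X \<Longrightarrow> 0 < f x"
  shows "(\<Sum>l\<in>levels n T. \<Sum>x\<in>X. quot_sq s (Dl n T l f x) (E (up n T l) f x))
    \<le> (8 * K\<^sup>2 / (1 - s)) ^ card (T \<inter> {..<n}) * (\<Sum>x\<in>X. f x powr (2 - s))"
proof (induction n)
  case 0
  show ?case using pos by (simp add: levels_0 up_def E_id quot_sq_diag)
next
  case (Suc n)
  let ?C = "8 * K\<^sup>2 / (1 - s)"
  have C: "0 \<le> ?C" using s by simp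
  show ?case
  proof (cases "n \<in> T")
    case True
    have "T \<inter> {..<Suc n} = insert n (T \<inter> {..<n})" using True by auto
    then have card: "card (T \<inter> {..<Suc n}) = Suc (card (T \<inter> {..<n}))" by simp
    have "(\<Sum>l\<in>levels (Suc n) T. \<Sum>x\<in>X. quot_sq s (Dl (Suc n) T l f x) (E (up (Suc n) T l) f x))
      = (\<Sum>l\<in>levels n T. \<Sum>c\<le>L. \<Sum>x\<in>X. quot_sq s (d n c (Dl n T l f) x) (e n (min (Suc c) L) (E (up n T l) f) x))"
      unfolding sum_levels_Suc[OF True]
    proof (intro sum.cong refl)
      fix l c x
      have "Dl (Suc n) T (l(n := c)) f = d n c (Dl n T l f)"
        using True Dl_cong[of n T "l(n := c)" l f] by simp
      moreover have "E (up (Suc n) T (l(n := c))) f = e n (min (Suc c) L) (E (up n T l) f)"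
        unfolding e_def E_comp using True by (intro E_cong_index) (auto simp: up_def)
      ultimately show "quot_sq s (Dl (Suc n) T (l(n := c)) f x) (E (up (Suc n) T (l(n := c))) f x)
        = quot_sq s (d n c (Dl n T l f) x) (e n (min (Suc c) L) (E (up n T l) f) x)" by simp
    qed
    also have "\<dots> \<le> (\<Sum>l\<in>levels n T. ?C * (\<Sum>x\<in>X. quot_sq s (Dl n T l f x) (E (up n T l) f x)))"
      using E_pos[OF pos] by (intro sum_mono energy_coordinate s) auto
    also have "\<dots> = ?C * (\<Sum>l\<in>levels n T. \<Sum>x\<in>X. quot_sq s (Dl n T l f x) (E (up n T l) f x))"
      by (simp add: sum_distrib_left)
    also have "\<dots> \<le> ?C * (?C ^ card (T \<inter> {..<n}) * (\<Sum>x\<in>X. f x powr (2 - s)))"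
      using Suc C by (intro mult_left_mono) auto
    finally show ?thesis by (simp add: card mult.assoc)
  next
    case False
    have "T \<inter> {..<Suc n} = T \<inter> {..<n}" using False by (auto simp: less_Suc_eq)
    moreover have "up (Suc n) T l = up n T l" for l using False by (auto simp: up_def less_Suc_eq)
    ultimately show ?thesis using Suc False by (simp add: levels_Suc_notin)
  qed
qed

section \<open>Doob's inequality and the iterated maximal function\<close>

fun mx :: "nat \<Rightarrow> nat \<Rightarrow> ('x \<Rightarrow> real) \<Rightarrow> 'x \<Rightarrow> real" where
  "mx i 0 g x = e i L g x"
| "mx i (Suc c) g x = max (mx i c g x) (e i (L - Suc c) g x)"

text \<open>\<open>mx i c\<close> runs over the levels \<open>L - c, \<dots>, L\<close>, from coarse to fine.\<close>

lemma meas_mx: "meas ((\<lambda>_. 0)(i := L - c)) (mx i c g)"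
proof (induction c)
  case (Suc c)
  have "meas ((\<lambda>_. 0)(i := L - Suc c)) (mx i c g)" by (rule meas_mono[OF Suc]) auto
  with meas_E[of "(\<lambda>_. 0)(i := L - Suc c)" g]
  have "mx i (Suc c) g y = mx i (Suc c) g x" if "x \<in> X" "y \<in> b ((\<lambda>_. 0)(i := L - Suc c)) x" for x y
    unfolding mx.simps e_def using that by (simp only: meas_def)
  then show ?case by (simp only: meas_def) blast
next
  case 0
  have "mx i 0 g = E ((\<lambda>_. 0)(i := L)) g" by (rule ext) (simp add: e_def)
  then show ?case using meas_E by (simp only: diff_zero)
qed

lemma mx_nonneg: "(\<And>x. x \<in> X \<Longrightarrow> 0 \<le> g x) \<Longrightarrow> 0 \<le> mx i c g x"
  by (induction c) (auto simp: e_def E_nonneg le_max_iff_disj)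

lemma e_le_mx: "L - c \<le> k \<Longrightarrow> k \<le> L \<Longrightarrow> e i k g x \<le> mx i c g x"
proof (induction c)
  case (Suc c)
  then show ?case by (cases "k = L - Suc c") (auto simp: le_max_iff_disj)
next
  case 0
  then have "k = L" by simp
  show ?case unfolding \<open>k = L\<close> by simp
qed

text \<open>The maximum changes only where the new average exceeds it, and there
  \<open>power_increment_bound\<close> applies. The increment of the (p - 1)-st power is constant on
  the blocks of the new average, so under the sum that average may be replaced by g.\<close>

lemma doob_pre:
  assumes p: "1 < p" and g: "\<And>x. x \<in> X \<Longrightarrow> 0 \<le> g x"
  shows "(\<Sum>x\<in>X. mx i c g x powr p) \<le> p / (p - 1) * (\<Sum>x\<in>X. g x * mx i c g x powr (p - 1))"
proof (induction c)
  case 0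
  let ?k = "(\<lambda>_. 0)(i := L)"
  have "(\<Sum>x\<in>X. mx i 0 g x powr p) = (\<Sum>x\<in>X. mx i 0 g x powr (p - 1) * E ?k g x)"
  proof (intro sum.cong refl)
    fix x
    have "0 \<le> E ?k g x" by (rule E_nonneg[OF g])
    then show "mx i 0 g x powr p = mx i 0 g x powr (p - 1) * E ?k g x"
      using p by (cases "E ?k g x = 0") (simp_all add: e_def powr_diff)
  qed
  also have "\<dots> = (\<Sum>x\<in>X. mx i 0 g x powr (p - 1) * g x)"
    using meas_mx[of i 0 g] by (intro sum_meas_E) (auto simp: meas_def)
  also have "\<dots> = 1 * (\<Sum>x\<in>X. g x * mx i 0 g x powr (p - 1))" by (simp add: mult.commute)
  also have "\<dots> \<le> p / (p - 1) * (\<Sum>x\<in>X. g x * mx i 0 g x powr (p - 1))"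
    using p g by (intro mult_right_mono sum_nonneg) auto
  finally show ?case by simp
next
  case (Suc c)
  let ?k = "(\<lambda>_. 0)(i := L - Suc c)"
  let ?q = "p / (p - 1)"
  define h where "h x = mx i (Suc c) g x powr (p - 1) - mx i c g x powr (p - 1)" for x
  have mh: "meas ?k h"
  proof -
    have "meas ?k (mx i c g)" by (rule meas_mono[OF meas_mx]) auto
    with meas_mx[of i "Suc c" g] show ?thesis by (auto simp: meas_def h_def simp del: mx.simps)
  qed
  have "(\<Sum>x\<in>X. mx i (Suc c) g x powr p - mx i c g x powr p) \<le> (\<Sum>x\<in>X. ?q * (h x * E ?k g x))"
  proof (rule sum_mono)
    fix x
    have nn: "0 \<le> mx i c g x" "0 \<le> E ?k g x" using mx_nonneg[OF g] E_nonneg[OF g] by auto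
    show "mx i (Suc c) g x powr p - mx i c g x powr p \<le> ?q * (h x * E ?k g x)"
    proof (cases "mx i c g x \<le> E ?k g x")
      case True
      then have "mx i (Suc c) g x = E ?k g x" by (simp add: e_def)
      then show ?thesis using power_increment_bound[OF p nn] by (simp add: h_def mult.commute)
    next
      case False
      then have "mx i (Suc c) g x = mx i c g x" by (simp add: e_def)
      then show ?thesis by (simp add: h_def)
    qed
  qed
  also have "\<dots> = ?q * (\<Sum>x\<in>X. h x * g x)"
    unfolding sum_distrib_left[symmetric] sum_meas_E[OF mh] ..
  also have "\<dots> = ?q * (\<Sum>x\<in>X. g x * mx i (Suc c) g x powr (p - 1)) - ?q * (\<Sum>x\<in>X. g x * mx i c g x powr (p - 1))"
    by (simp add: h_def algebra_simps sum_subtractf del: mx.simps)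
  finally show ?case using Suc by (simp add: sum_subtractf del: mx.simps)
qed

text \<open>With a = 2 p / (p - 1), the last term of \<open>mult_powr_split\<close>, multiplied by p
  / (p - 1) = a / 2, is half of the left-hand side and is absorbed.\<close>

lemma doob:
  assumes p: "1 < p" and g: "\<And>x. x \<in> X \<Longrightarrow> 0 \<le> g x"
  shows "(\<Sum>x\<in>X. mx i c g x powr p) \<le> (2 * p / (p - 1)) powr p * (\<Sum>x\<in>X. g x powr p)"
proof -
  define a where "a = 2 * p / (p - 1)"
  define S where "S = (\<Sum>x\<in>X. mx i c g x powr p)"
  have a: "0 < a" using p by (simp add: a_def)
  have "(\<Sum>x\<in>X. g x * mx i c g x powr (p - 1)) \<le> (\<Sum>x\<in>X. a powr (p - 1) * g x powr p + mx i c g x powr p / a)"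
    using p a g mx_nonneg[OF g] by (intro sum_mono mult_powr_split) auto
  also have "\<dots> = a powr (p - 1) * (\<Sum>x\<in>X. g x powr p) + S / a"
    by (simp add: S_def sum.distrib sum_distrib_left sum_divide_distrib)
  finally have "a / 2 * (\<Sum>x\<in>X. g x * mx i c g x powr (p - 1))
      \<le> a / 2 * (a powr (p - 1) * (\<Sum>x\<in>X. g x powr p) + S / a)"
    using a by (intro mult_left_mono) auto
  moreover have "S \<le> a / 2 * (\<Sum>x\<in>X. g x * mx i c g x powr (p - 1))"
  proof -
    have "S \<le> p / (p - 1) * (\<Sum>x\<in>X. g x * mx i c g x powr (p - 1))"
      unfolding S_def by (rule doob_pre[OF p g])
    moreover have "p / (p - 1) = a / 2" using p by (simp add: a_def field_simps)
    ultimately show ?thesis by simp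
  qed
  moreover have "a / 2 * (a powr (p - 1) * (\<Sum>x\<in>X. g x powr p) + S / a)
      = (a * a powr (p - 1)) / 2 * (\<Sum>x\<in>X. g x powr p) + S / 2"
    using a by (simp add: field_simps)
  moreover have "a * a powr (p - 1) = a powr p" using a by (simp add: powr_diff)
  ultimately show ?thesis by (simp add: S_def a_def[symmetric])
qed

fun strong_max :: "nat \<Rightarrow> ('x \<Rightarrow> real) \<Rightarrow> 'x \<Rightarrow> real" where
  "strong_max 0 g = g"
| "strong_max (Suc n) g = mx n L (strong_max n g)"

lemma strong_max_nonneg: "(\<And>x. x \<in> X \<Longrightarrow> 0 \<le> g x) \<Longrightarrow> x \<in> X \<Longrightarrow> 0 \<le> strong_max n g x"
  by (induction n arbitrary: x) (auto intro: mx_nonneg)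

lemma strong_max_bound:
  assumes p: "1 < p" and g: "\<And>x. x \<in> X \<Longrightarrow> 0 \<le> g x"
  shows "(\<Sum>x\<in>X. strong_max n g x powr p) \<le> ((2 * p / (p - 1)) powr p) ^ n * (\<Sum>x\<in>X. g x powr p)"
proof (induction n)
  case (Suc n)
  have "(\<Sum>x\<in>X. strong_max (Suc n) g x powr p) \<le> (2 * p / (p - 1)) powr p * (\<Sum>x\<in>X. strong_max n g x powr p)"
    unfolding strong_max.simps by (rule doob[OF p strong_max_nonneg[OF g]])
  also have "\<dots> \<le> (2 * p / (p - 1)) powr p * (((2 * p / (p - 1)) powr p) ^ n * (\<Sum>x\<in>X. g x powr p))"
    using Suc by (intro mult_left_mono) auto
  finally show ?case by (simp add: mult.assoc)
qed simp

text \<open>A rectangle average is a composition of one-coordinate averages, each dominated by the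
  maximum over the levels of its coordinate.\<close>

lemma E_le_strong_max:
  assumes g: "\<And>x. x \<in> X \<Longrightarrow> 0 \<le> g x" and k: "\<And>i. i < m \<Longrightarrow> k i \<le> L" and x: "x \<in> X"
  shows "E k g x \<le> strong_max m g x"
proof -
  have "E (\<lambda>i. if i < n then k i else 0) g x \<le> strong_max n g x" if "n \<le> m" "x \<in> X" for n x
    using that
  proof (induction n arbitrary: x)
    case (Suc n)
    have "E (\<lambda>i. if i < Suc n then k i else 0) g x = e n (k n) (E (\<lambda>i. if i < n then k i else 0) g) x"
      unfolding e_def E_comp by (rule fun_cong[OF E_cong_index]) (auto simp: less_Suc_eq)
    also have "\<dots> \<le> e n (k n) (strong_max n g) x"
      unfolding e_def using Suc by (intro E_mono) auto
    also have "\<dots> \<le> strong_max (Suc n) g x" using k[of n] Suc.prems by (simp add: e_le_mx)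
    finally show ?case .
  qed (simp add: E_id)
  from this[of m x] x show ?thesis using E_cong_index[of "\<lambda>i. if i < m then k i else 0" k g] by simp
qed


section \<open>Orthogonality and telescoping of product martingale differences\<close>

lemma E_fun_diff: "E k (\<lambda>x. f x - g x) = (\<lambda>x. E k f x - E k g x)"
  by (rule ext) (rule E_diff)

lemma e_e: "e i k (e i c f) = e i (max k c) f"
  unfolding e_def E_comp by (rule E_cong_index) auto

lemma E_e_comm: "E k (e i c f) = e i c (E k f)"
  unfolding e_def by (rule E_comm)

lemma E_d_comm: "E k (d i c f) = d i c (E k f)"
  by (cases "c < L") (simp_all add: d_def E_fun_diff E_e_comm)

lemma d_zero: "d i c (\<lambda>x. 0) = (\<lambda>x. 0)"
  by (auto simp: d_def e_def E_zero)

lemma e_d_absorb: "k \<le> c \<Longrightarrow> e i k (d i c f) = d i c f"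
  by (cases "c < L") (simp_all add: d_def E_fun_diff[where k = "(\<lambda>_. 0)(i := k)", folded e_def] e_e)

lemma e_d_kill: "c < k \<Longrightarrow> k \<le> L \<Longrightarrow> e i k (d i c f) = (\<lambda>x. 0)"
  by (simp add: d_def E_fun_diff[where k = "(\<lambda>_. 0)(i := k)", folded e_def] e_e)

lemma d_cong: "(\<And>x. x \<in> X \<Longrightarrow> f x = g x) \<Longrightarrow> d i c f = d i c g"
proof -
  assume "\<And>x. x \<in> X \<Longrightarrow> f x = g x"
  then have "E k f = E k g" for k by (rule E_cong)
  then show ?thesis unfolding d_def e_def by presburger
qed

lemma sum_d: "k \<le> L \<Longrightarrow> (\<Sum>c=k..L. d i c f x) = e i k f x"
proof (induction "L - k" arbitrary: k)
  case 0
  then have k: "k = L" by simp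
  show ?case unfolding k by (simp add: d_def)
next
  case (Suc n)
  then have "k < L" by simp
  then have "(\<Sum>c=k..L. d i c f x) = d i k f x + (\<Sum>c=Suc k..L. d i c f x)"
    by (simp add: sum.atLeast_Suc_atMost)
  also have "(\<Sum>c=Suc k..L. d i c f x) = e i (Suc k) f x"
    using Suc.hyps(1)[of "Suc k"] Suc.hyps(2) \<open>k < L\<close> by simp
  finally show ?case using \<open>k < L\<close> by (simp add: d_def)
qed

lemma levels_le: "l \<in> levels n T \<Longrightarrow> l i \<le> L"
  by (cases "i < n \<and> i \<in> T") (simp_all add: levels_def)

lemma levels_out: "l \<in> levels n T \<Longrightarrow> \<not> (i < n \<and> i \<in> T) \<Longrightarrow> l i = 0"
  unfolding levels_def by blast

text \<open>\<open>F\<close> is a martingale difference of level \<open>l i\<close> in each coordinate \<open>i \<in> T\<close>.\<close>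

definition pure :: "nat set \<Rightarrow> (nat \<Rightarrow> nat) \<Rightarrow> ('x \<Rightarrow> real) \<Rightarrow> bool" where
  "pure T l F \<longleftrightarrow> meas (\<lambda>i. if i \<in> T then l i else 0) F \<and>
     (\<forall>i<m. i \<in> T \<longrightarrow> l i < L \<longrightarrow> (\<forall>x\<in>X. e i (Suc (l i)) F x = 0))"

lemma E_meas_imp_meas: "(\<And>x. x \<in> X \<Longrightarrow> E k F x = F x) \<Longrightarrow> meas k F"
  using meas_E[of k F] b_in unfolding meas_def by (metis (full_types))

lemma Dl_absorb:
  assumes "\<And>i. i < m \<Longrightarrow> k i \<le> (if i < n \<and> i \<in> T then l i else 0)" "x \<in> X"
  shows "E k (Dl n T l f) x = Dl n T l f x"
  using assms
proof (induction n arbitrary: k x)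
  case 0
  then show ?case by (simp add: E_id)
next
  case (Suc n)
  show ?case
  proof (cases "n \<in> T")
    case True
    have "E k g = e n (k n) (E (k(n := 0)) g)" for g
      unfolding e_def E_comp by (rule E_cong_index) auto
    moreover have "E (k(n := 0)) (d n (l n) (Dl n T l f)) = d n (l n) (Dl n T l f)"
      unfolding E_d_comm by (rule d_cong, rule Suc.IH) (use Suc.prems in \<open>force simp: less_Suc_eq split: if_splits\<close>)+
    moreover have "e n (k n) (d n (l n) (Dl n T l f)) x = d n (l n) (Dl n T l f) x"
    proof (cases "n < m")
      case n: True
      then have "k n \<le> l n" using Suc.prems(1)[of n] True by simp
      then show ?thesis by (simp add: e_d_absorb)
    next
      case False
      \<comment> \<open>Coordinates from m on are invisible to \<open>b\<close>, so any level there
        acts like level 0.\<close>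
      then have "e n (k n) F = e n 0 F" for F unfolding e_def by (intro E_cong_index) auto
      then show ?thesis by (simp add: e_d_absorb)
    qed
    ultimately show ?thesis using True by simp
  next
    case False
    have "E k (Dl n T l f) x = Dl n T l f x"
      by (rule Suc.IH) (use Suc.prems False in \<open>force simp: less_Suc_eq split: if_splits\<close>)+
    then show ?thesis using False by simp
  qed
qed

lemma Dl_kill: "i < n \<Longrightarrow> i \<in> T \<Longrightarrow> l i < k \<Longrightarrow> k \<le> L \<Longrightarrow> e i k (Dl n T l f) = (\<lambda>x. 0)"
proof (induction n)
  case (Suc n)
  show ?case
  proof (cases "i = n")
    case True
    then show ?thesis using Suc.prems by (simp add: e_d_kill)
  next
    case False
    then have "e i k (Dl n T l f) = (\<lambda>x. 0)" using Suc by simp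
    then show ?thesis using E_d_comm[of "(\<lambda>_. 0)(i := k)" n] by (simp add: e_def[symmetric] d_zero)
  qed
qed simp

lemma pure_Dl: "pure T l (Dl m T l f)"
  unfolding pure_def
proof (intro conjI allI impI ballI)
  show "meas (\<lambda>i. if i \<in> T then l i else 0) (Dl m T l f)"
    by (intro E_meas_imp_meas Dl_absorb) auto
qed (simp add: Dl_kill)

text \<open>A factor constant on the parents comes out of the averages at level
  \<open>Suc (l i)\<close>, so these still vanish. This allows differences to be cut off pointwise
  without losing orthogonality.\<close>

lemma pure_mult:
  assumes F: "pure T l F" and g: "meas (up m T l) g" and l: "\<And>i. i < m \<Longrightarrow> i \<in> T \<Longrightarrow> l i \<le> L"
  shows "pure T l (\<lambda>x. g x * F x)"
  unfolding pure_def
proof (intro conjI allI impI ballI)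
  have "meas (\<lambda>i. if i \<in> T then l i else 0) g"
    by (rule meas_mono[OF g]) (use l in \<open>auto simp: up_def\<close>)
  then show "meas (\<lambda>i. if i \<in> T then l i else 0) (\<lambda>x. g x * F x)"
    using F by (simp add: pure_def meas_def)
next
  fix i x assume i: "i < m" "i \<in> T" "l i < L" and x: "x \<in> X"
  have "meas ((\<lambda>_. 0)(i := Suc (l i))) g"
    by (rule meas_mono[OF g]) (use i in \<open>auto simp: up_def\<close>)
  then have "e i (Suc (l i)) (\<lambda>x. g x * F x) x = g x * e i (Suc (l i)) F x"
    unfolding e_def by (rule E_mult_meas)
  then show "e i (Suc (l i)) (\<lambda>x. g x * F x) x = 0" using F i x by (simp add: pure_def)
qed

lemma pure_subset:
  assumes "pure T l F" "T' \<subseteq> T" "\<And>i. i \<in> T' \<Longrightarrow> l i = l' i"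
  shows "pure T' l' F"
  unfolding pure_def
proof (intro conjI allI impI ballI)
  have "meas (\<lambda>i. if i \<in> T then l i else 0) F" using assms(1) by (simp add: pure_def)
  then show "meas (\<lambda>i. if i \<in> T' then l' i else 0) F"
    by (rule meas_mono) (use assms in auto)
next
  fix i x assume "i < m" "i \<in> T'" "l' i < L" "x \<in> X"
  then show "e i (Suc (l' i)) F x = 0" using assms(1,2) assms(3)[of i] by (auto simp: pure_def)
qed

lemma pure_sum: "(\<And>c. c \<in> I \<Longrightarrow> pure T l (F c)) \<Longrightarrow> pure T l (\<lambda>x. \<Sum>c\<in>I. F c x)"
  by (simp add: pure_def meas_def e_def E_sum)

lemma pure_absorb:
  assumes "pure T l F" "\<And>i. i < m \<Longrightarrow> k i \<le> (if i \<in> T then l i else 0)" "x \<in> X"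
  shows "E k F x = F x"
proof -
  have "meas k F" by (rule meas_mono[of "\<lambda>i. if i \<in> T then l i else 0"]) (use assms in \<open>auto simp: pure_def\<close>)
  then show ?thesis using assms(3) by (rule E_of_meas)
qed

lemma pure_kill:
  assumes "pure T l F" "i < m" "i \<in> T" "l i < k i" "k i \<le> L"
  shows "E k F x = 0"
proof (cases "x \<in> X")
  case True
  have "E k F = E k (e i (Suc (l i)) F)"
    unfolding e_def by (rule E_absorb[symmetric]) (use assms in auto)
  also have "\<dots> = E k (\<lambda>x. 0)"
    using assms by (intro E_cong) (auto simp: pure_def)
  finally show ?thesis by (simp add: E_zero)
qed (simp add: E_off)

text \<open>The all-or-nothing form matters: the average at x depends on F only through
  \<open>F x\<close>, so in \<open>good_lambda\<close> a cut-off of F is felt only through its value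
  at x.\<close>

lemma pure_E:
  assumes "pure T l F" "x \<in> X" "\<And>i. i < m \<Longrightarrow> k i \<le> L" "\<And>i. i < m \<Longrightarrow> i \<notin> T \<Longrightarrow> k i = 0"
  shows "E k F x = (if \<forall>i<m. i \<in> T \<longrightarrow> k i \<le> l i then F x else 0)"
proof (cases "\<forall>i<m. i \<in> T \<longrightarrow> k i \<le> l i")
  case True
  have "E k F x = F x" by (rule pure_absorb[OF assms(1) _ assms(2)]) (use True assms(4) in auto)
  then show ?thesis using True by simp
next
  case False
  then obtain i where "i < m" "i \<in> T" "l i < k i" by (auto simp: not_le)
  then have "E k F x = 0" using assms(3) by (intro pure_kill[OF assms(1)]) auto
  then show ?thesis unfolding if_not_P[OF False] .
qed

text \<open>In the coordinate where the levels differ, F' is constant on blocks over which F has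
  mean zero.\<close>

lemma pure_orthogonal_aux:
  assumes F: "pure T l F" and F': "pure T l' F'" and i: "i < m" "i \<in> T" "l i < l' i" "l' i \<le> L"
  shows "(\<Sum>x\<in>X. F' x * F x) = 0"
proof -
  have "meas ((\<lambda>_. 0)(i := Suc (l i))) F'"
    by (rule meas_mono[of "\<lambda>i. if i \<in> T then l' i else 0"]) (use F' i in \<open>auto simp: pure_def\<close>)
  from sum_meas_E[OF this, of F] have "(\<Sum>x\<in>X. F' x * F x) = (\<Sum>x\<in>X. F' x * e i (Suc (l i)) F x)"
    by (simp add: e_def)
  also have "\<dots> = 0" using F i by (intro sum.neutral) (auto simp: pure_def)
  finally show ?thesis .
qed

lemma pure_orthogonal:
  assumes F: "pure T l F" and F': "pure T l' F'" and l: "l \<in> levels m T" "l' \<in> levels m T" "l \<noteq> l'"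
  shows "(\<Sum>x\<in>X. F x * F' x) = 0"
proof -
  obtain i where "l i \<noteq> l' i" using l(3) by (auto simp: fun_eq_iff)
  then have i: "i < m" "i \<in> T" "l i \<le> L" "l' i \<le> L"
    using levels_le levels_out[OF l(1)] levels_out[OF l(2)] l(1,2) by metis+
  show ?thesis
  proof (cases "l i < l' i")
    case True
    then show ?thesis using pure_orthogonal_aux[OF F F' i(1,2) True i(4)] by (simp add: mult.commute)
  next
    case False
    then have "l' i < l i" using \<open>l i \<noteq> l' i\<close> by simp
    then show ?thesis using pure_orthogonal_aux[OF F' F i(1,2) _ i(3)] by simp
  qed
qed

lemma pure_sum_square:
  assumes F: "\<And>l. l \<in> levels m T \<Longrightarrow> pure T l (F l)"
  shows "(\<Sum>x\<in>X. (\<Sum>l\<in>levels m T. F l x)\<^sup>2) = (\<Sum>l\<in>levels m T. \<Sum>x\<in>X. (F l x)\<^sup>2)"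
proof -
  have "(\<Sum>x\<in>X. (\<Sum>l\<in>levels m T. F l x)\<^sup>2) = (\<Sum>x\<in>X. \<Sum>l\<in>levels m T. \<Sum>l'\<in>levels m T. F l x * F l' x)"
    by (simp add: power2_eq_square sum_product)
  also have "\<dots> = (\<Sum>l\<in>levels m T. \<Sum>x\<in>X. \<Sum>l'\<in>levels m T. F l x * F l' x)"
    by (rule sum.swap)
  also have "\<dots> = (\<Sum>l\<in>levels m T. \<Sum>l'\<in>levels m T. \<Sum>x\<in>X. F l x * F l' x)"
    by (intro sum.cong refl) (rule sum.swap)
  also have "\<dots> = (\<Sum>l\<in>levels m T. \<Sum>x\<in>X. (F l x)\<^sup>2)"
  proof (intro sum.cong refl)
    fix l assume l: "l \<in> levels m T"
    have "(\<Sum>l'\<in>levels m T. \<Sum>x\<in>X. F l x * F l' x)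
        = (\<Sum>l'\<in>levels m T. if l' = l then (\<Sum>x\<in>X. (F l x)\<^sup>2) else 0)"
      using pure_orthogonal[OF F F l] l by (intro sum.cong) (auto simp: power2_eq_square)
    then show "(\<Sum>l'\<in>levels m T. \<Sum>x\<in>X. F l x * F l' x) = (\<Sum>x\<in>X. (F l x)\<^sup>2)"
      using l finite_levels by simp
  qed
  finally show ?thesis .
qed

text \<open>Differences in distinct coordinates commute, so the one in coordinate j may be taken
  last.\<close>

lemma Dl_split: "j < n \<Longrightarrow> j \<in> T \<Longrightarrow> Dl n T l f = d j (l j) (Dl n (T - {j}) l f)"
proof (induction n)
  case (Suc n)
  have comm: "d n c (d j c' g) = d j c' (d n c g)" for c c' g
  proof -
    have "e n k (d j c' g) = d j c' (e n k g)" for k unfolding e_def by (rule E_d_comm)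
    moreover have "d j c' (\<lambda>x. g1 x - g2 x) = (\<lambda>x. d j c' g1 x - d j c' g2 x)" for g1 g2
      by (auto simp: d_def E_fun_diff e_def)
    ultimately show ?thesis by (cases "c < L") (simp_all add: d_def[of n])
  qed
  show ?case
  proof (cases "j = n")
    case True
    have "Dl n (T - {n}) l f = Dl n T l f" 
    proof -
      have "k \<le> n \<Longrightarrow> Dl k (T - {n}) l f = Dl k T l f" for k by (induction k) auto
      then show ?thesis by simp
    qed
    then show ?thesis using True Suc.prems by simp
  next
    case False
    then have "Dl n T l f = d j (l j) (Dl n (T - {j}) l f)" using Suc by simp
    then show ?thesis using False comm by simp
  qed
qed simp

text \<open>In each coordinate the differences at levels \<open>k i\<close> to \<open>L\<close>
  telescope to the average at level \<open>k i\<close>.\<close>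

lemma E_expand:
  assumes k: "\<And>i. k i \<le> L" and x: "x \<in> X"
  shows "E (\<lambda>i. if i < n then k i else 0) f x
    = (\<Sum>l\<in>levels n UNIV. if \<forall>i<n. k i \<le> l i then Dl n UNIV l f x else 0)"
  using x
proof (induction n arbitrary: x)
  case 0
  then show ?case by (simp add: levels_0 E_id)
next
  case (Suc n)
  let ?E = "E (\<lambda>i. if i < n then k i else 0) f"
  let ?S = "\<lambda>x. \<Sum>l\<in>levels n UNIV. if \<forall>i<n. k i \<le> l i then Dl n UNIV l f x else 0"
  have "E (\<lambda>i. if i < Suc n then k i else 0) f = e n (k n) ?E"
    unfolding e_def E_comp by (intro E_cong_index) (auto simp: less_Suc_eq)
  also have "\<dots> = e n (k n) ?S"
    unfolding e_def by (rule E_cong) (rule Suc.IH)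
  finally have "E (\<lambda>i. if i < Suc n then k i else 0) f x = e n (k n) ?S x" by (rule fun_cong)
  also have "\<dots> = (\<Sum>l\<in>levels n UNIV. if \<forall>i<n. k i \<le> l i then e n (k n) (Dl n UNIV l f) x else 0)"
    unfolding e_def E_sum
  proof (intro sum.cong refl)
    fix l
    show "E ((\<lambda>_. 0)(n := k n)) (\<lambda>x. if \<forall>i<n. k i \<le> l i then Dl n UNIV l f x else 0) x
      = (if \<forall>i<n. k i \<le> l i then E ((\<lambda>_. 0)(n := k n)) (Dl n UNIV l f) x else 0)"
      by (cases "\<forall>i<n. k i \<le> l i") (simp_all only: if_P if_not_P if_True if_False E_zero)
  qed
  also have "\<dots> = (\<Sum>l\<in>levels n UNIV. \<Sum>c\<le>L. if \<forall>i<Suc n. k i \<le> (l(n := c)) i then Dl (Suc n) UNIV (l(n := c)) f x else 0)"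
  proof (rule sum.cong[OF refl])
    fix l
    have "(\<Sum>c\<le>L. if \<forall>i<Suc n. k i \<le> (l(n := c)) i then Dl (Suc n) UNIV (l(n := c)) f x else 0)
        = (\<Sum>c\<le>L. if k n \<le> c then (if \<forall>i<n. k i \<le> l i then d n c (Dl n UNIV l f) x else 0) else 0)"
    proof (rule sum.cong[OF refl])
      fix c
      have "Dl n UNIV (l(n := c)) f = Dl n UNIV l f" by (rule Dl_cong) simp
      then show "(if \<forall>i<Suc n. k i \<le> (l(n := c)) i then Dl (Suc n) UNIV (l(n := c)) f x else 0)
        = (if k n \<le> c then (if \<forall>i<n. k i \<le> l i then d n c (Dl n UNIV l f) x else 0) else 0)"
        by (auto simp: less_Suc_eq)
    qed
    also have "\<dots> = (\<Sum>c=k n..L. if \<forall>i<n. k i \<le> l i then d n c (Dl n UNIV l f) x else 0)"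
      by (rule sum.mono_neutral_cong_right) auto
    also have "\<dots> = (if \<forall>i<n. k i \<le> l i then e n (k n) (Dl n UNIV l f) x else 0)"
    proof (cases "\<forall>i<n. k i \<le> l i")
      case True
      show ?thesis unfolding if_P[OF True] by (rule sum_d[OF k])
    next
      case False
      show ?thesis unfolding if_not_P[OF False] by simp
    qed
    finally show "(if \<forall>i<n. k i \<le> l i then e n (k n) (Dl n UNIV l f) x else 0)
      = (\<Sum>c\<le>L. if \<forall>i<Suc n. k i \<le> (l(n := c)) i then Dl (Suc n) UNIV (l(n := c)) f x else 0)" ..
  qed
  also have "\<dots> = (\<Sum>l\<in>levels (Suc n) UNIV. if \<forall>i<Suc n. k i \<le> l i then Dl (Suc n) UNIV l f x else 0)"
    by (rule sum_levels_Suc[symmetric]) simp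
  finally show ?case .
qed

end

subsection \<open>Stopped averages\<close>

text \<open>
  For a family of rectangles, \<open>D l x\<close> will mean that the parent of the rectangle of level \<open>l\<close> at \<open>x\<close> contains
  a member of the family with sides at most \<open>l\<close>.
\<close>

locale stopped_averages = block_averages X b m L K for X :: "'x set" and b m L K +
  fixes D :: "(nat \<Rightarrow> nat) \<Rightarrow> 'x \<Rightarrow> bool" and f :: "'x \<Rightarrow> real"
  assumes D_up: "x \<in> X \<Longrightarrow> l \<in> levels m UNIV \<Longrightarrow> l' \<in> levels m UNIV \<Longrightarrow>
      (\<And>i. i < m \<Longrightarrow> l i \<le> l' i) \<Longrightarrow> D l x \<Longrightarrow> D l' x"
    and D_meas: "l \<in> levels m UNIV \<Longrightarrow> meas (up m UNIV l) (D l)"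
    and f_pos: "x \<in> X \<Longrightarrow> 0 < f x"
begin

definition A :: "(nat \<Rightarrow> nat) \<Rightarrow> 'x \<Rightarrow> real" where
  "A l x = of_bool (D l x) * Dl m UNIV l f x"

definition fD :: "'x \<Rightarrow> real" where
  "fD x = (\<Sum>l\<in>levels m UNIV. A l x)"

text \<open>The hypothesis on the family makes the level of a member admissible at all of its points.\<close>

definition adm :: "(nat \<Rightarrow> nat) \<Rightarrow> 'x \<Rightarrow> bool" where
  "adm k x \<longleftrightarrow> k \<in> levels m UNIV \<and> D k x \<and> (\<forall>l\<in>levels m UNIV. D l x \<longrightarrow> (\<exists>i<m. k i \<le> l i))"

lemma pure_A:
  assumes l: "l \<in> levels m UNIV"
  shows "pure UNIV l (A l)"
proof -
  have "meas (up m UNIV l) (\<lambda>x. of_bool (D l x) :: real)"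
    using D_meas[OF l] by (simp add: meas_def)
  from pure_mult[OF pure_Dl this] show ?thesis
    unfolding A_def[abs_def] using levels_le[OF l] by blast
qed

lemma E_fD:
  assumes "x \<in> X" "\<And>i. i < m \<Longrightarrow> k i \<le> L"
  shows "E k fD x = (\<Sum>l\<in>levels m UNIV. if \<forall>i<m. k i \<le> l i then A l x else 0)"
proof -
  have "E k fD x = (\<Sum>l\<in>levels m UNIV. E k (A l) x)"
    unfolding fD_def[abs_def] by (rule E_sum)
  also have "\<dots> = (\<Sum>l\<in>levels m UNIV. if \<forall>i<m. k i \<le> l i then A l x else 0)"
    by (rule sum.cong[OF refl], subst pure_E[OF pure_A]) (use assms in auto)
  finally show ?thesis .
qed

text \<open>
  At an admissible point no \<open>l\<close> with \<open>D l x\<close> lies strictly below \<open>k\<close>, so the product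
  \<open>\<Prod>\<^sub>i (1 - [k\<^sub>i \<le> l\<^sub>i])\<close> vanishes on the support of \<open>f\<^sub>D\<close>; expanding it expresses the full average
  over \<open>k\<close> by averages of \<open>f\<^sub>D\<close> that leave at least one coordinate untouched.
\<close>

lemma adm_average_bound:
  assumes adm: "adm k x" and x: "x \<in> X"
    and N: "\<And>j k'. j < m \<Longrightarrow> k' j = 0 \<Longrightarrow> (\<And>i. i < m \<Longrightarrow> k' i \<le> L) \<Longrightarrow> \<bar>E k' fD x\<bar> \<le> N j"
  shows "\<bar>E k f x\<bar> \<le> 2 ^ m * (\<Sum>j<m. N j)"
proof -
  have kL: "k i \<le> L" for i using adm levels_le[of k] by (auto simp: adm_def)
  define r where "r S i = (if i \<in> S then k i else 0)" for S :: "nat set" and i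
  have rL: "r S i \<le> L" for S i using kL by (simp add: r_def)
  define a where "a l i = (of_bool (k i \<le> l i) :: real)" for l :: "nat \<Rightarrow> nat" and i
  have ind: "(\<Prod>i\<in>S. a l i) = of_bool (\<forall>i\<in>S. k i \<le> l i)" if "finite S" for S l
    using that by (induction S rule: finite_induct) (auto simp: a_def)
  have rS: "E (r S) fD x = (\<Sum>l\<in>levels m UNIV. A l x * (\<Prod>i\<in>S. a l i))" if "S \<subseteq> {..<m}" for S
  proof -
    have "finite S" using that finite_subset by blast
    moreover have "(\<forall>i<m. r S i \<le> l i) \<longleftrightarrow> (\<forall>i\<in>S. k i \<le> l i)" for l
      using that by (auto simp: r_def)
    ultimately show ?thesis using E_fD[OF x, of "r S"] rL ind by (auto intro!: sum.cong)
  qed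
  have expand: "(\<Prod>i<m. - a l i + 1) = (\<Sum>S\<in>Pow {..<m}. (-1) ^ card S * (\<Prod>i\<in>S. a l i))" for l
  proof -
    have "(\<Prod>i<m. - a l i + 1) = (\<Sum>S\<in>Pow {..<m}. (\<Prod>i\<in>S. - a l i) * (\<Prod>i\<in>{..<m} - S. 1))"
      by (rule prod_add) simp
    also have "\<dots> = (\<Sum>S\<in>Pow {..<m}. (-1) ^ card S * (\<Prod>i\<in>S. a l i))"
      by (simp add: prod_uminus)
    finally show ?thesis .
  qed
  have "0 = (\<Sum>l\<in>levels m UNIV. A l x * (\<Prod>i<m. - a l i + 1))"
  proof (rule sum.neutral[symmetric], rule ballI)
    fix l assume l: "l \<in> levels m UNIV"
    show "A l x * (\<Prod>i<m. - a l i + 1) = 0"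
    proof (cases "D l x")
      case True
      then obtain i where "i < m" "k i \<le> l i" using adm l by (auto simp: adm_def)
      then have "(\<Prod>i<m. - a l i + 1) = 0" by (auto simp: a_def)
      then show ?thesis by simp
    qed (simp add: A_def)
  qed
  also have "\<dots> = (\<Sum>l\<in>levels m UNIV. \<Sum>S\<in>Pow {..<m}. (-1) ^ card S * (A l x * (\<Prod>i\<in>S. a l i)))"
    unfolding expand sum_distrib_left by (simp add: mult.left_commute)
  also have "\<dots> = (\<Sum>S\<in>Pow {..<m}. (-1) ^ card S * (\<Sum>l\<in>levels m UNIV. A l x * (\<Prod>i\<in>S. a l i)))"
    by (subst sum.swap) (simp add: sum_distrib_left)
  also have "\<dots> = (\<Sum>S\<in>Pow {..<m}. (-1) ^ card S * E (r S) fD x)"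
    using rS by (intro sum.cong) auto
  also have "\<dots> = (-1) ^ card {..<m} * E (r {..<m}) fD x + (\<Sum>S\<in>Pow {..<m} - {{..<m}}. (-1) ^ card S * E (r S) fD x)"
    by (rule sum.remove) auto
  finally have 0: "(-1) ^ m * E (r {..<m}) fD x = - (\<Sum>S\<in>Pow {..<m} - {{..<m}}. (-1) ^ card S * E (r S) fD x)"
    by simp
  \<comment> \<open>Every level above the admissible k satisfies D by monotonicity, so the cut-off
    is invisible at x and the telescoping returns the average of f itself.\<close>
  have full: "E (r {..<m}) fD x = E k f x"
  proof -
    have "E (r {..<m}) fD x = (\<Sum>l\<in>levels m UNIV. if \<forall>i<m. k i \<le> l i then A l x else 0)"
      using E_fD[OF x, of "r {..<m}"] kL by (simp add: r_def)
    also have "\<dots> = (\<Sum>l\<in>levels m UNIV. if \<forall>i<m. k i \<le> l i then Dl m UNIV l f x else 0)"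
    proof (intro sum.cong refl)
      fix l assume l: "l \<in> levels m UNIV"
      have "D l x" if "\<forall>i<m. k i \<le> l i"
        using adm l that by (intro D_up[OF x, of k l]) (auto simp: adm_def)
      then have "A l x = Dl m UNIV l f x" if "\<forall>i<m. k i \<le> l i" unfolding A_def using that by simp
      then show "(if \<forall>i<m. k i \<le> l i then A l x else 0) = (if \<forall>i<m. k i \<le> l i then Dl m UNIV l f x else 0)"
        by meson
    qed
    also have "\<dots> = E (\<lambda>i. if i < m then k i else 0) f x" by (rule E_expand[OF kL x, symmetric])
    also have "\<dots> = E k f x" by (rule fun_cong[OF E_cong_index]) simp
    finally show ?thesis .
  qed
  have "\<bar>E k f x\<bar> = \<bar>(-1) ^ m * E (r {..<m}) fD x\<bar>" by (simp add: full abs_mult)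
  also have "\<dots> \<le> (\<Sum>S\<in>Pow {..<m} - {{..<m}}. \<bar>(-1) ^ card S * E (r S) fD x\<bar>)"
    unfolding 0 abs_minus by (rule sum_abs)
  also have "\<dots> \<le> (\<Sum>S\<in>Pow {..<m} - {{..<m}}. \<Sum>j<m. N j)"
  proof (rule sum_mono)
    fix S assume S: "S \<in> Pow {..<m} - {{..<m}}"
    then obtain j where j: "j < m" "j \<notin> S" by auto
    have N0: "0 \<le> N j" if "j < m" for j
      using N[OF that, of "\<lambda>_. 0"] by (smt (verit) zero_le)
    have "\<bar>(-1) ^ card S * E (r S) fD x\<bar> = \<bar>E (r S) fD x\<bar>" by (simp add: abs_mult)
    also have "\<dots> \<le> N j" using j rL by (intro N) (auto simp: r_def)
    also have "\<dots> \<le> (\<Sum>j<m. N j)" using j N0 by (intro member_le_sum) auto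
    finally show "\<bar>(-1) ^ card S * E (r S) fD x\<bar> \<le> (\<Sum>j<m. N j)" .
  qed
  also have "\<dots> = real (card (Pow {..<m} - {{..<m}})) * (\<Sum>j<m. N j)" by simp
  also have "\<dots> \<le> 2 ^ m * (\<Sum>j<m. N j)"
  proof (rule mult_right_mono)
    have "card (Pow {..<m} - {{..<m}}) \<le> card (Pow {..<m})" by (intro card_mono) auto
    also have "\<dots> = 2 ^ m" by (simp add: card_Pow)
    finally show "real (card (Pow {..<m} - {{..<m}})) \<le> 2 ^ m" by (metis of_nat_le_iff of_nat_numeral of_nat_power)
    show "0 \<le> (\<Sum>j<m. N j)" using N[of _ "\<lambda>_. 0"] by (intro sum_nonneg) (smt (verit) lessThan_iff zero_le)
  qed
  finally show ?thesis .
qed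

section \<open>Summing out one coordinate\<close>

definition act :: "nat \<Rightarrow> (nat \<Rightarrow> nat) \<Rightarrow> 'x \<Rightarrow> bool" where
  "act j l x \<longleftrightarrow> (\<exists>c\<le>L. D (l(j := c)) x)"

text \<open>The stopping level: where \<open>act\<close> holds, monotonicity of D makes the kept
  differences in coordinate j exactly those of level at least \<kappa>.\<close>

definition \<kappa> :: "nat \<Rightarrow> (nat \<Rightarrow> nat) \<Rightarrow> 'x \<Rightarrow> nat" where
  "\<kappa> j l x = (LEAST c. D (l(j := c)) x)"

text \<open>The part of \<open>fD\<close> with levels l in the other coordinates. Since the kept
  differences in coordinate j start at \<kappa>, they telescope to one average
  (\<open>U_eq\<close>), which is why coordinate j costs no power of p'.\<close>

definition U :: "nat \<Rightarrow> (nat \<Rightarrow> nat) \<Rightarrow> 'x \<Rightarrow> real" where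
  "U j l x = (\<Sum>c\<le>L. A (l(j := c)) x)"

text \<open>The average of \<open>f\<close> over the rectangle on which the \<open>j\<close>-th coordinate of \<open>U j l\<close> lives.\<close>

definition W :: "nat \<Rightarrow> (nat \<Rightarrow> nat) \<Rightarrow> 'x \<Rightarrow> real" where
  "W j l x = e j (\<kappa> j l x) (E (up m (- {j}) l) f) x"

context
  fixes j assumes j: "j < m"
begin

lemma upd_levels: "l \<in> levels m (- {j}) \<Longrightarrow> c \<le> L \<Longrightarrow> l(j := c) \<in> levels m UNIV"
  using j by (auto simp: levels_def)

lemma D_kappa:
  assumes "l \<in> levels m (- {j})" "x \<in> X" "act j l x"
  shows "\<kappa> j l x \<le> L" "D (l(j := \<kappa> j l x)) x" "c \<le> L \<Longrightarrow> D (l(j := c)) x \<longleftrightarrow> \<kappa> j l x \<le> c"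
proof -
  obtain c0 where c0: "c0 \<le> L" "D (l(j := c0)) x" using assms(3) by (auto simp: act_def)
  show 1: "D (l(j := \<kappa> j l x)) x" unfolding \<kappa>_def by (rule LeastI) (rule c0)
  have le: "\<kappa> j l x \<le> c" if "D (l(j := c)) x" for c unfolding \<kappa>_def by (rule Least_le) (rule that)
  show 2: "\<kappa> j l x \<le> L" using le[OF c0(2)] c0(1) by simp
  show "D (l(j := c)) x \<longleftrightarrow> \<kappa> j l x \<le> c" if "c \<le> L"
  proof
    assume "\<kappa> j l x \<le> c"
    then show "D (l(j := c)) x"
      by (intro D_up[OF assms(2) upd_levels[OF assms(1) 2] upd_levels[OF assms(1) that] _ 1]) auto
  qed (rule le)
qed

lemma Dl_upd:
  "Dl m UNIV (l(j := c)) f = d j c (Dl m (- {j}) l f)"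
proof -
  have "Dl m UNIV (l(j := c)) f = d j c (Dl m (UNIV - {j}) (l(j := c)) f)"
    using Dl_split[OF j, of UNIV "l(j := c)" f] by simp
  also have "Dl m (UNIV - {j}) (l(j := c)) f = Dl m (- {j}) l f"
    unfolding Compl_eq_Diff_UNIV[symmetric] by (rule Dl_cong) auto
  finally show ?thesis .
qed

lemma U_eq:
  assumes l: "l \<in> levels m (- {j})" and x: "x \<in> X"
  shows "U j l x = (if act j l x then e j (\<kappa> j l x) (Dl m (- {j}) l f) x else 0)"
proof (cases "act j l x")
  case True
  note k = D_kappa[OF l x True]
  have "U j l x = (\<Sum>c\<le>L. if \<kappa> j l x \<le> c then d j c (Dl m (- {j}) l f) x else 0)"
    unfolding U_def A_def Dl_upd using k(3) by (intro sum.cong) auto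
  also have "\<dots> = (\<Sum>c=\<kappa> j l x..L. d j c (Dl m (- {j}) l f) x)"
    by (rule sum.mono_neutral_cong_right) auto
  also have "\<dots> = e j (\<kappa> j l x) (Dl m (- {j}) l f) x" by (rule sum_d[OF k(1)])
  finally show ?thesis using True by simp
next
  case False
  then show ?thesis by (auto simp: U_def A_def act_def intro!: sum.neutral)
qed

lemma pure_U:
  assumes l: "l \<in> levels m (- {j})"
  shows "pure (- {j}) l (U j l)"
  unfolding U_def[abs_def]
proof (rule pure_sum)
  fix c assume "c \<in> {..L}"
  then have "pure UNIV (l(j := c)) (A (l(j := c)))" using upd_levels[OF l] by (intro pure_A) auto
  then show "pure (- {j}) l (A (l(j := c)))" by (rule pure_subset) auto
qed

lemma fD_U: "fD x = (\<Sum>l\<in>levels m (- {j}). U j l x)"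
  unfolding fD_def U_def sum_levels_insert[OF UNIV_I j] Compl_eq_Diff_UNIV ..

lemma meas_act: "l \<in> levels m (- {j}) \<Longrightarrow> meas (up m (- {j}) l) (act j l)"
  and meas_D_upd: "l \<in> levels m (- {j}) \<Longrightarrow> c \<le> L \<Longrightarrow> meas (up m (- {j}) l) (D (l(j := c)))"
proof -
  have *: "meas (up m (- {j}) l) (D (l(j := c)))" if "l \<in> levels m (- {j})" "c \<le> L" for l c
    using D_meas[OF upd_levels[OF that]] by (rule meas_mono) (auto simp: up_def)
  then show "l \<in> levels m (- {j}) \<Longrightarrow> c \<le> L \<Longrightarrow> meas (up m (- {j}) l) (D (l(j := c)))" by blast
  show "meas (up m (- {j}) l) (act j l)" if "l \<in> levels m (- {j})"
    using *[OF that] by (auto simp: meas_def act_def)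
qed

lemma kappa_const:
  assumes l: "l \<in> levels m (- {j})" and x: "x \<in> X" and y: "y \<in> b (up m (- {j}) l) x" and a: "act j l x"
  shows "\<kappa> j l y = \<kappa> j l x"
proof -
  have yX: "y \<in> X" using b_in[OF x y] .
  have ay: "act j l y" using meas_act[OF l] x y a by (simp add: meas_def)
  have "D (l(j := c)) y \<longleftrightarrow> D (l(j := c)) x" if "c \<le> L" for c
    using meas_D_upd[OF l that] x y by (simp add: meas_def)
  then have "\<kappa> j l y \<le> c \<longleftrightarrow> \<kappa> j l x \<le> c" if "c \<le> L" for c
    using D_kappa(3)[OF l x a that] D_kappa(3)[OF l yX ay that] that by simp
  then show ?thesis using D_kappa(1)[OF l x a] D_kappa(1)[OF l yX ay] by (meson antisym order_refl)
qed

lemma W_const: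
  assumes l: "l \<in> levels m (- {j})" and x: "x \<in> X" and y: "y \<in> b (up m (- {j}) l) x" and a: "act j l x"
  shows "W j l y = W j l x"
proof -
  have eq: "e j c (E (up m (- {j}) l) f) = E ((up m (- {j}) l)(j := c)) f" for c
    unfolding e_def E_comp by (rule E_cong_index) (auto simp: up_def)
  have "meas (up m (- {j}) l) (e j c (E (up m (- {j}) l) f))" for c
    unfolding eq by (rule meas_mono[OF meas_E]) (auto simp: up_def)
  then show ?thesis using x y unfolding W_def kappa_const[OF l x y a] by (simp add: meas_def)
qed

text \<open>The witness has level \<kappa> in coordinate j and the parent level of l elsewhere. A
  level l' strictly below it is at most l off j, so \<open>D l' x\<close> would give
  \<open>\<kappa> j l x \<le> l' j\<close>, a contradiction. Hence the denominators W are averages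
  over admissible rectangles.\<close>

lemma W_adm:
  assumes l: "l \<in> levels m (- {j})" and x: "x \<in> X" and a: "act j l x"
  shows "\<exists>k. adm k x \<and> W j l x = E k f x"
proof -
  define k where "k = (up m (- {j}) l)(j := \<kappa> j l x)"
  note kap = D_kappa[OF l x a]
  have k: "k \<in> levels m UNIV" using j kap(1) by (auto simp: k_def levels_def up_def)
  have "W j l x = E k f x"
    unfolding W_def k_def e_def E_comp by (rule fun_cong[OF E_cong_index]) (auto simp: up_def)
  moreover have "adm k x" unfolding adm_def
  proof (intro conjI ballI impI k)
    show "D k x"
      by (rule D_up[OF x upd_levels[OF l kap(1)] k _ kap(2)])
         (use levels_le[OF l] levels_out[OF l] in \<open>auto simp: k_def up_def\<close>)
    fix l' assume l': "l' \<in> levels m UNIV" "D l' x"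
    show "\<exists>i<m. k i \<le> l' i"
    proof (rule ccontr)
      assume "\<not> (\<exists>i<m. k i \<le> l' i)"
      then have lt: "l' i < k i" if "i < m" for i using that by (auto simp: not_le)
      have l'L: "l' j \<le> L" by (rule levels_le[OF l'(1)])
      have "l' i \<le> (l(j := l' j)) i" if "i < m" for i
        using lt[OF that] that by (auto simp: k_def up_def split: if_splits)
      then have "D (l(j := l' j)) x" by (rule D_up[OF x l'(1) upd_levels[OF l l'L] _ l'(2)])
      then have "\<kappa> j l x \<le> l' j" using kap(3)[OF l'L] by simp
      then show False using lt[OF j] by (simp add: k_def)
    qed
  qed
  ultimately show ?thesis by blast
qed

lemma W_pos: "x \<in> X \<Longrightarrow> 0 < W j l x"
  unfolding W_def e_def by (intro E_pos f_pos)

text \<open>At a point with \<kappa> = c, U and W are averages at level c in coordinate j of the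
  difference and of the denominator in the other coordinates. Jensen's inequality undoes these
  averages without a constant, because the set \<kappa> = c consists of blocks of that level; the
  energy in m - 1 coordinates remains.\<close>

lemma stopped_energy:
  assumes s: "1/2 \<le> s" "s < 1"
  shows "(\<Sum>l\<in>levels m (- {j}). \<Sum>x\<in>X. quot_sq s (U j l x) (W j l x))
    \<le> (8 * K\<^sup>2 / (1 - s)) ^ (m - 1) * (\<Sum>x\<in>X. f x powr (2 - s))"
proof -
  have "(\<Sum>l\<in>levels m (- {j}). \<Sum>x\<in>X. quot_sq s (U j l x) (W j l x))
    \<le> (\<Sum>l\<in>levels m (- {j}). \<Sum>x\<in>X. quot_sq s (Dl m (- {j}) l f x) (E (up m (- {j}) l) f x))"
  proof (rule sum_mono)
    fix l assume l: "l \<in> levels m (- {j})"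
    define \<alpha> \<beta> where "\<alpha> = Dl m (- {j}) l f" and "\<beta> = E (up m (- {j}) l) f"
    have \<beta>: "0 < \<beta> x" if "x \<in> X" for x unfolding \<beta>_def by (intro E_pos f_pos that)
    define I where "I c x = (of_bool (act j l x \<and> \<kappa> j l x = c) :: real)" for c x
    have I: "meas ((\<lambda>_. 0)(j := c)) (I c)" if c: "c \<le> L" for c
    proof -
      have eq: "(act j l x \<and> \<kappa> j l x = c) \<longleftrightarrow> D (l(j := c)) x \<and> (c = 0 \<or> \<not> D (l(j := c - 1)) x)" if x: "x \<in> X" for x
      proof (cases "act j l x")
        case True
        show ?thesis using D_kappa(3)[OF l x True c] D_kappa(3)[OF l x True, of "c - 1"] c True by auto
      next
        case False
        then show ?thesis using c by (auto simp: act_def)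
      qed
      have m1: "meas ((\<lambda>_. 0)(j := c)) (D (l(j := c)))"
        using D_meas[OF upd_levels[OF l c]] by (rule meas_mono) (use c in \<open>auto simp: up_def\<close>)
      \<comment> \<open>\<open>D\<close> lives on parents, and the parent level of c - 1 is exactly
        c. So whether \<kappa> equals c is decided on blocks of level c, where the average at level
        c can be undone.\<close>
      have m2: "meas ((\<lambda>_. 0)(j := c)) (D (l(j := c - 1)))" if "c \<noteq> 0"
        using D_meas[OF upd_levels[OF l, of "c - 1"]] 
        by (rule meas_mono) (use c that in \<open>auto simp: up_def\<close>)
      have "I c y = I c x" if "x \<in> X" "y \<in> b ((\<lambda>_. 0)(j := c)) x" for x y
        unfolding I_def eq[OF that(1)] eq[OF b_in[OF that]]
        using m1 m2 that by (cases "c = 0") (auto simp: meas_def)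
      then show ?thesis by (simp add: meas_def)
    qed
    have "(\<Sum>x\<in>X. quot_sq s (U j l x) (W j l x)) = (\<Sum>x\<in>X. \<Sum>c\<le>L. I c x * quot_sq s (e j c \<alpha> x) (e j c \<beta> x))"
    proof (rule sum.cong[OF refl])
      fix x assume x: "x \<in> X"
      show "quot_sq s (U j l x) (W j l x) = (\<Sum>c\<le>L. I c x * quot_sq s (e j c \<alpha> x) (e j c \<beta> x))"
      proof (cases "act j l x")
        case True
        then have "(\<Sum>c\<le>L. I c x * quot_sq s (e j c \<alpha> x) (e j c \<beta> x))
          = (\<Sum>c\<le>L. if c = \<kappa> j l x then quot_sq s (e j c \<alpha> x) (e j c \<beta> x) else 0)"
          by (intro sum.cong) (auto simp: I_def)
        then show ?thesis using True D_kappa(1)[OF l x True] U_eq[OF l x] by (simp add: W_def \<alpha>_def \<beta>_def)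
      next
        case False
        then show ?thesis using U_eq[OF l x] by (simp add: I_def quot_sq_def)
      qed
    qed
    also have "\<dots> \<le> (\<Sum>x\<in>X. \<Sum>c\<le>L. I c x * e j c (\<lambda>y. quot_sq s (\<alpha> y) (\<beta> y)) x)"
      unfolding e_def using E_jensen[OF s \<beta>] by (intro sum_mono mult_left_mono) (auto simp: I_def)
    also have "\<dots> = (\<Sum>c\<le>L. \<Sum>x\<in>X. I c x * e j c (\<lambda>y. quot_sq s (\<alpha> y) (\<beta> y)) x)"
      by (rule sum.swap)
    also have "\<dots> = (\<Sum>c\<le>L. \<Sum>x\<in>X. I c x * quot_sq s (\<alpha> x) (\<beta> x))"
      unfolding e_def using I by (intro sum.cong refl sum_meas_E) auto
    also have "\<dots> = (\<Sum>x\<in>X. \<Sum>c\<le>L. I c x * quot_sq s (\<alpha> x) (\<beta> x))"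
      by (rule sum.swap)
    also have "\<dots> \<le> (\<Sum>x\<in>X. quot_sq s (\<alpha> x) (\<beta> x))"
    proof (rule sum_mono)
      fix x
      have "(\<Sum>c\<le>L. I c x) \<le> (\<Sum>c\<le>L. if c = \<kappa> j l x then 1 else 0)"
        by (intro sum_mono) (auto simp: I_def)
      also have "\<dots> \<le> 1" by simp
      finally have "(\<Sum>c\<le>L. I c x) * quot_sq s (\<alpha> x) (\<beta> x) \<le> 1 * quot_sq s (\<alpha> x) (\<beta> x)"
        by (intro mult_right_mono quot_sq_nonneg)
      then show "(\<Sum>c\<le>L. I c x * quot_sq s (\<alpha> x) (\<beta> x)) \<le> quot_sq s (\<alpha> x) (\<beta> x)"
        by (simp add: sum_distrib_right)
    qed
    finally show "(\<Sum>x\<in>X. quot_sq s (U j l x) (W j l x))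
      \<le> (\<Sum>x\<in>X. quot_sq s (Dl m (- {j}) l f x) (E (up m (- {j}) l) f x))" by (simp add: \<alpha>_def \<beta>_def)
  qed
  also have "\<dots> \<le> (8 * K\<^sup>2 / (1 - s)) ^ card (- {j} \<inter> {..<m}) * (\<Sum>x\<in>X. f x powr (2 - s))"
    by (rule energy_product[OF s f_pos])
  also have "- {j} \<inter> {..<m} = {..<m} - {j}" by auto
  also have "card ({..<m} - {j}) = m - 1" using j by simp
  finally show ?thesis .
qed

end

end

subsection \<open>The good-\<lambda> inequality\<close>

lemma one_le_mult: "1 \<le> x \<Longrightarrow> 1 \<le> y \<Longrightarrow> 1 \<le> x * (y :: real)"
  using mult_mono[of 1 x 1 y] by simp

text \<open>Subtracting a^p makes the induction with a doubled close: 2 a^p <= (2 a)^p pays for the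
  first summand.\<close>

lemma dyadic_sum_below:
  fixes a p S :: real
  assumes "1 \<le> p" "0 < a" "0 \<le> S"
  shows "(\<Sum>k<n. if a * 2 ^ k < S then (a * 2 ^ k) powr p else 0) \<le> max 0 ((2 * S) powr p - a powr p)"
  using assms(2)
proof (induction n arbitrary: a)
  case (Suc n)
  have dbl: "a * 2 ^ Suc k = 2 * a * 2 ^ k" for k :: nat by simp
  have shift: "(\<Sum>k<Suc n. if a * 2 ^ k < S then (a * 2 ^ k) powr p else 0)
    = (if a < S then a powr p else 0) + (\<Sum>k<n. if (2 * a) * 2 ^ k < S then ((2 * a) * 2 ^ k) powr p else 0)"
    unfolding sum.lessThan_Suc_shift dbl by simp
  have IH: "(\<Sum>k<n. if (2 * a) * 2 ^ k < S then ((2 * a) * 2 ^ k) powr p else 0) \<le> max 0 ((2 * S) powr p - (2 * a) powr p)"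
    by (rule Suc.IH) (use Suc.prems in simp)
  show ?case
  proof (cases "a < S")
    case True
    have "(2 * a) powr p \<le> (2 * S) powr p" using True Suc.prems assms by (intro powr_mono2) auto
    moreover have "2 * a powr p \<le> (2 * a) powr p"
    proof -
      have "(2::real) powr 1 \<le> 2 powr p" using assms by (intro powr_mono) auto
      then have "2 * a powr p \<le> 2 powr p * a powr p" by (intro mult_right_mono) auto
      then show ?thesis using Suc.prems by (simp add: powr_mult)
    qed
    ultimately show ?thesis using shift IH True by simp
  next
    case False
    have "(\<Sum>k<n. if (2 * a) * 2 ^ k < S then ((2 * a) * 2 ^ k) powr p else 0) = 0"
    proof (rule sum.neutral, rule ballI)
      fix k
      have "a \<le> 2 * a * 2 ^ k" using Suc.prems one_le_power[of "2::real" k]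
        by (smt (verit) mult_left_mono mult_cancel_left1)
      then show "(if 2 * a * 2 ^ k < S then (2 * a * 2 ^ k) powr p else 0) = 0" using False by simp
    qed
    then show ?thesis using shift False by simp
  qed
qed simp

text \<open>A geometric series; p <= 3/2 keeps its ratio 2^(p - 2) at most 3/4, whence the factor
  4.\<close>

lemma dyadic_sum_above:
  fixes a p S :: real
  assumes "p \<le> 3/2" "0 < a" "0 < S"
  shows "(\<Sum>k<n. if a * 2 ^ k < S then 0 else (a * 2 ^ k) powr (p - 2)) \<le> 4 * max S a powr (p - 2)"
  using assms(2)
proof (induction n arbitrary: a)
  case (Suc n)
  have dbl: "a * 2 ^ Suc k = 2 * a * 2 ^ k" for k :: nat by simp
  have shift: "(\<Sum>k<Suc n. if a * 2 ^ k < S then 0 else (a * 2 ^ k) powr (p - 2))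
    = (if a < S then 0 else a powr (p - 2)) + (\<Sum>k<n. if (2 * a) * 2 ^ k < S then 0 else ((2 * a) * 2 ^ k) powr (p - 2))"
    unfolding sum.lessThan_Suc_shift dbl by simp
  have IH: "(\<Sum>k<n. if (2 * a) * 2 ^ k < S then 0 else ((2 * a) * 2 ^ k) powr (p - 2)) \<le> 4 * max S (2 * a) powr (p - 2)"
    by (rule Suc.IH) (use Suc.prems in simp)
  show ?case
  proof (cases "a < S")
    case True
    have "max S (2 * a) powr (p - 2) \<le> S powr (p - 2)" using assms by (intro powr_mono2') auto
    then show ?thesis using shift IH True by (simp add: max_def)
  next
    case False
    have "(2::real) powr (p - 2) \<le> 2 powr (-1/2)" using assms by (intro powr_mono) auto
    also have "\<dots> \<le> 3/4"
    proof -
      have "((2::real) powr (-1/2))\<^sup>2 = 2 powr (-1/2 + -1/2)" unfolding power2_eq_square powr_add ..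
      also have "\<dots> \<le> (3/4)\<^sup>2" by (simp add: power2_eq_square)
      finally show ?thesis by (rule power2_le_imp_le) simp
    qed
    finally have "2 powr (p - 2) * a powr (p - 2) \<le> 3/4 * a powr (p - 2)" by (intro mult_right_mono) auto
    then have "4 * (2 * a) powr (p - 2) \<le> 3 * a powr (p - 2)" using Suc.prems by (simp add: powr_mult)
    moreover have "max S (2 * a) = 2 * a" "max S a = a" using False Suc.prems by (simp_all add: max_def)
    ultimately show ?thesis using shift IH False by simp
  qed
qed simp

lemma powr_le_dyadic_sum:
  fixes a p y :: real
  assumes p: "1 < p" "p \<le> 2" and a: "0 < a" and y: "0 \<le> y" "y \<le> a * 2 ^ n"
  shows "y powr p \<le> a powr p + 4 * (\<Sum>k<n. if a * 2 ^ k < y then (a * 2 ^ k) powr p else 0)"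
  using y(2)
proof (induction n)
  case 0
  then have "y powr p \<le> a powr p" using y p by (intro powr_mono2) auto
  then show ?case by simp
next
  case (Suc n)
  show ?case
  proof (cases "y \<le> a * 2 ^ n")
    case True
    then show ?thesis using Suc.IH by simp
  next
    case False
    have "y powr p \<le> (2 * (a * 2 ^ n)) powr p" using Suc.prems y p by (intro powr_mono2) auto
    also have "\<dots> = 2 powr p * (a * 2 ^ n) powr p" using a by (simp add: powr_mult)
    also have "\<dots> \<le> 2 powr 2 * (a * 2 ^ n) powr p"
      using p by (intro mult_right_mono powr_mono) auto
    finally have "y powr p \<le> 4 * (a * 2 ^ n) powr p" by simp
    moreover have "0 \<le> (\<Sum>k<n. if a * 2 ^ k < y then (a * 2 ^ k) powr p else 0)"
      by (intro sum_nonneg) auto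
    moreover have "0 \<le> a powr p" by simp
    ultimately show ?thesis using False unfolding sum.lessThan_Suc by (smt (verit))
  qed
qed

text \<open>A layer-cake sum over the thresholds a * 2^k. Values of N up to a are paid for by card X
  * a^p, which disappears as a tends to 0. The constant is 4 from \<open>powr_le_dyadic_sum\<close>
  times 4, a bound for both dyadic sums.\<close>

lemma weak_to_strong:
  fixes N S :: "'x \<Rightarrow> real"
  assumes p: "1 < p" "p \<le> 3/2" and X: "finite X" and AB: "0 \<le> A" "0 \<le> B"
    and N: "\<And>x. x \<in> X \<Longrightarrow> 0 \<le> N x" and S: "\<And>x. x \<in> X \<Longrightarrow> 0 \<le> S x"
    and weak: "\<And>t. 0 < t \<Longrightarrow> real (card {x\<in>X. t < N x})
        \<le> A * real (card {x\<in>X. t < S x}) + B / t\<^sup>2 * (\<Sum>x\<in>{x\<in>X. S x \<le> t}. (S x)\<^sup>2)"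
  shows "(\<Sum>x\<in>X. N x powr p) \<le> 16 * (A + B) * (\<Sum>x\<in>X. S x powr p)"
proof -
  have main: "(\<Sum>x\<in>X. N x powr p) \<le> real (card X) * a powr p + 16 * (A + B) * (\<Sum>x\<in>X. S x powr p)"
    if a: "0 < a" for a
  proof -
    define V where "V = (\<Sum>x\<in>X. N x)"
    obtain n where "V / a < 2 ^ n" using real_arch_pow[of 2 "V / a"] by auto
    then have V: "V \<le> a * 2 ^ n" using a by (simp add: field_simps)
    have NV: "N x \<le> a * 2 ^ n" if "x \<in> X" for x
      using member_le_sum[OF that _ X, of N] N V by (force simp: V_def)
    define t where "t k = a * 2 ^ k" for k :: nat
    have t: "0 < t k" for k using a by (simp add: t_def)
    have "(\<Sum>x\<in>X. N x powr p) \<le> (\<Sum>x\<in>X. a powr p + 4 * (\<Sum>k<n. if t k < N x then t k powr p else 0))"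
      unfolding t_def using p a N NV by (intro sum_mono powr_le_dyadic_sum) auto
    also have "\<dots> = real (card X) * a powr p + 4 * (\<Sum>k<n. \<Sum>x\<in>X. if t k < N x then t k powr p else 0)"
      by (subst sum.swap) (simp add: sum.distrib sum_distrib_left)
    also have "\<dots> = real (card X) * a powr p + 4 * (\<Sum>k<n. t k powr p * real (card {x\<in>X. t k < N x}))"
    proof -
      have "(\<Sum>x\<in>X. if t k < N x then t k powr p else 0) = t k powr p * real (card {x\<in>X. t k < N x})" for k
        using X by (simp add: sum.inter_filter[symmetric])
      then show ?thesis by simp
    qed
    also have "\<dots> \<le> real (card X) * a powr p + 4 * (\<Sum>k<n. t k powr p *
        (A * real (card {x\<in>X. t k < S x}) + B / (t k)\<^sup>2 * (\<Sum>x\<in>{x\<in>X. S x \<le> t k}. (S x)\<^sup>2)))"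
      using weak[OF t] by (intro add_left_mono mult_left_mono sum_mono) auto
    also have "(\<Sum>k<n. t k powr p *
        (A * real (card {x\<in>X. t k < S x}) + B / (t k)\<^sup>2 * (\<Sum>x\<in>{x\<in>X. S x \<le> t k}. (S x)\<^sup>2)))
      = (\<Sum>k<n. \<Sum>x\<in>X. A * (if t k < S x then t k powr p else 0)
            + B * (S x)\<^sup>2 * (if t k < S x then 0 else t k powr (p - 2)))"
    proof (intro sum.cong refl)
      fix k
      have tp: "t k powr p * (B / (t k)\<^sup>2) = B * t k powr (p - 2)"
        using t[of k] by (simp add: powr_diff)
      have 1: "real (card {x\<in>X. t k < S x}) = (\<Sum>x\<in>X. if t k < S x then 1 else 0)"
        using X by (simp add: sum.inter_filter[symmetric])
      have 2: "(\<Sum>x\<in>{x\<in>X. S x \<le> t k}. (S x)\<^sup>2) = (\<Sum>x\<in>X. if t k < S x then 0 else (S x)\<^sup>2)"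
        using X by (subst sum.inter_filter[OF X]) (auto intro!: sum.cong)
      have "t k powr p * (A * real (card {x\<in>X. t k < S x}) + B / (t k)\<^sup>2 * (\<Sum>x\<in>{x\<in>X. S x \<le> t k}. (S x)\<^sup>2))
        = A * t k powr p * (\<Sum>x\<in>X. if t k < S x then 1 else 0)
          + (t k powr p * (B / (t k)\<^sup>2)) * (\<Sum>x\<in>X. if t k < S x then 0 else (S x)\<^sup>2)"
        unfolding 1 2 by (simp add: algebra_simps)
      also have "\<dots> = (\<Sum>x\<in>X. A * (if t k < S x then t k powr p else 0)
            + B * (S x)\<^sup>2 * (if t k < S x then 0 else t k powr (p - 2)))"
        unfolding tp sum_distrib_left sum.distrib[symmetric] by (intro sum.cong) auto
      finally show "t k powr p * (A * real (card {x\<in>X. t k < S x}) + B / (t k)\<^sup>2 * (\<Sum>x\<in>{x\<in>X. S x \<le> t k}. (S x)\<^sup>2))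
        = (\<Sum>x\<in>X. A * (if t k < S x then t k powr p else 0)
            + B * (S x)\<^sup>2 * (if t k < S x then 0 else t k powr (p - 2)))" .
    qed
    also have "\<dots> = (\<Sum>x\<in>X. A * (\<Sum>k<n. if t k < S x then t k powr p else 0)
            + B * ((S x)\<^sup>2 * (\<Sum>k<n. if t k < S x then 0 else t k powr (p - 2))))"
      by (subst sum.swap) (simp add: sum.distrib sum_distrib_left mult.assoc)
    also have "\<dots> \<le> (\<Sum>x\<in>X. A * (4 * S x powr p) + B * (4 * S x powr p))"
    proof (intro sum_mono add_mono mult_left_mono AB)
      fix x assume x: "x \<in> X"
      have "(\<Sum>k<n. if t k < S x then t k powr p else 0) \<le> max 0 ((2 * S x) powr p - a powr p)"
        unfolding t_def using p a S[OF x] by (intro dyadic_sum_below) auto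
      also have "\<dots> \<le> (2 * S x) powr p" by simp
      also have "\<dots> = 2 powr p * S x powr p" using S[OF x] by (simp add: powr_mult)
      also have "\<dots> \<le> 2 powr 2 * S x powr p" using p by (intro mult_right_mono powr_mono) auto
      finally show "(\<Sum>k<n. if t k < S x then t k powr p else 0) \<le> 4 * S x powr p" by simp
      show "(S x)\<^sup>2 * (\<Sum>k<n. if t k < S x then 0 else t k powr (p - 2)) \<le> 4 * S x powr p"
      proof (cases "S x = 0")
        case False
        then have pos: "0 < S x" using S[OF x] by simp
        have "(\<Sum>k<n. if t k < S x then 0 else t k powr (p - 2)) \<le> 4 * max (S x) a powr (p - 2)"
          unfolding t_def using p a pos by (intro dyadic_sum_above) auto
        also have "\<dots> \<le> 4 * S x powr (p - 2)"
          using p pos by (intro mult_left_mono powr_mono2') auto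
        finally have "(S x)\<^sup>2 * (\<Sum>k<n. if t k < S x then 0 else t k powr (p - 2)) \<le> (S x)\<^sup>2 * (4 * S x powr (p - 2))"
          by (intro mult_left_mono) auto
        also have "\<dots> = 4 * S x powr p" using pos by (simp add: powr_diff)
        finally show ?thesis .
      qed simp
    qed
    also have "\<dots> = 4 * (A + B) * (\<Sum>x\<in>X. S x powr p)"
      by (simp add: sum.distrib sum_distrib_left[symmetric] algebra_simps)
    finally show ?thesis by (simp add: algebra_simps)
  qed
  show ?thesis
  proof (rule field_le_epsilon)
    fix \<epsilon> :: real assume \<epsilon>: "0 < \<epsilon>"
    define a where "a = (\<epsilon> / (real (card X) + 1)) powr (1 / p)"
    have "a powr p = \<epsilon> / (real (card X) + 1)" using \<epsilon> p by (simp add: a_def powr_powr)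
    moreover have "0 < a" using \<epsilon> by (simp add: a_def add_nonneg_eq_0_iff)
    moreover have "real (card X) * (\<epsilon> / (real (card X) + 1)) \<le> \<epsilon>"
      using \<epsilon> by (simp add: divide_simps add_nonneg_pos)
    ultimately show "(\<Sum>x\<in>X. N x powr p) \<le> 16 * (A + B) * (\<Sum>x\<in>X. S x powr p) + \<epsilon>"
      using main[of a] by simp
  qed
qed

text \<open>Dividing by z^p leaves t^(p/2) <= \<eta> + t / \<eta>^2 for t = e / z^p, checked below
  \<eta>^2, between \<eta>^2 and 1, and above 1. The coefficients do not depend on p.\<close>

lemma young_absorb:
  fixes z e p \<eta> :: real
  assumes p: "1 < p" "p < 2" and z: "0 \<le> z" "0 \<le> e" and \<eta>: "0 < \<eta>" "\<eta> \<le> 1"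
  shows "(z powr (2 - p) * e) powr (p / 2) \<le> \<eta> * z powr p + e / \<eta>\<^sup>2"
proof (cases "z = 0")
  case False
  then have z0: "0 < z powr p" using z by simp
  obtain t where e: "e = t * z powr p" using z0 by (metis nonzero_mult_div_cancel_right mult.commute less_irrefl times_divide_eq_right)
  have t: "0 \<le> t" using z z0 by (simp add: e zero_le_mult_iff)
  have "z powr (2 - p) * e = t * z powr 2"
    unfolding e by (simp add: powr_add[symmetric] mult.left_commute)
  then have "(z powr (2 - p) * e) powr (p / 2) = t powr (p / 2) * (z powr 2) powr (p / 2)"
    using t by (simp only: powr_mult powr_ge_zero)
  also have "(z powr 2) powr (p / 2) = z powr p" unfolding powr_powr by simp
  finally have eq: "(z powr (2 - p) * e) powr (p / 2) = t powr (p / 2) * z powr p" .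
  have "t powr (p / 2) \<le> \<eta> + t / \<eta>\<^sup>2"
  proof -
    have \<eta>2: "0 < \<eta>\<^sup>2" "\<eta>\<^sup>2 \<le> 1" using \<eta> by (simp_all add: power_le_one)
    consider "t \<le> \<eta>\<^sup>2" | "\<eta>\<^sup>2 < t" "t < 1" | "1 \<le> t" by linarith
    then show ?thesis
    proof cases
      case 1
      have "t powr (p / 2) \<le> (\<eta>\<^sup>2) powr (p / 2)" using 1 p t by (intro powr_mono2) auto
      also have "(\<eta>\<^sup>2) powr (p / 2) = \<eta> powr p"
      proof -
        have "\<eta>\<^sup>2 = \<eta> powr 2" using \<eta> by simp
        then show ?thesis by (simp only: powr_powr) simp
      qed
      also have "\<dots> \<le> \<eta> powr 1" using \<eta> p by (intro powr_mono') auto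
      finally have "t powr (p / 2) \<le> \<eta>" using \<eta> by simp
      moreover have "0 \<le> t / \<eta>\<^sup>2" using t by simp
      ultimately show ?thesis by linarith
    next
      case 2
      have "t powr (p / 2) \<le> t powr 0" using 2 p t by (intro powr_mono') auto
      also have "\<dots> \<le> 1" by simp
      also have "\<dots> \<le> t / \<eta>\<^sup>2" using 2(1) \<eta>2 by (subst pos_le_divide_eq) auto
      finally show ?thesis using \<eta> by linarith
    next
      case 3
      have "t powr (p / 2) \<le> t powr 1" using 3 p by (intro powr_mono) auto
      also have "\<dots> = t" using 3 by simp
      also have "\<dots> \<le> t / \<eta>\<^sup>2" using \<eta>2 t by (subst pos_le_divide_eq) (auto intro: mult_left_le)
      finally show ?thesis using \<eta> by linarith
    qed
  qed
  then have "t powr (p / 2) * z powr p \<le> (\<eta> + t / \<eta>\<^sup>2) * z powr p" by (rule mult_right_mono) simp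
  also have "\<dots> = \<eta> * z powr p + e / \<eta>\<^sup>2" unfolding e by (simp add: distrib_right)
  finally show ?thesis unfolding eq .
qed (use z in simp)

section \<open>Square functions, the good-lambda argument and absorption\<close>

context stopped_averages
begin

text \<open>A conditional square function: U^2 is averaged over parent rectangles, so each summand
  is constant on the blocks on which \<open>good_lambda\<close> decides its cut-off.\<close>

definition square_fn :: "nat \<Rightarrow> 'x \<Rightarrow> real" where
  "square_fn j x = (\<Sum>l\<in>levels m (- {j}). E (up m (- {j}) l) (\<lambda>y. (U j l y)\<^sup>2) x)"

definition energy_fn :: "real \<Rightarrow> nat \<Rightarrow> 'x \<Rightarrow> real" where
  "energy_fn s j x = (\<Sum>l\<in>levels m (- {j}). E (up m (- {j}) l) (\<lambda>y. quot_sq s (U j l y) (W j l y)) x)"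

definition partial_max :: "nat \<Rightarrow> 'x \<Rightarrow> real" where
  "partial_max j x = Max ((\<lambda>k. \<bar>E k fD x\<bar>) ` levels m (- {j}))"

text \<open>The stand-in for the maximal function. It dominates the averages of f over members of
  the family (\<open>rect_adm\<close>) and also the denominators W (\<open>W_adm\<close>).\<close>

definition adm_max :: "'x \<Rightarrow> real" where
  "adm_max x = Max (insert 0 ((\<lambda>k. E k f x) ` {k \<in> levels m UNIV. adm k x}))"

lemma zero_levels: "(\<lambda>_. 0) \<in> levels m T"
  by (simp add: levels_def)

lemma partial_max_upper:
  assumes "k j = 0" "\<And>i. i < m \<Longrightarrow> k i \<le> L"
  shows "\<bar>E k fD x\<bar> \<le> partial_max j x"
proof -
  define k' where "k' i = (if i < m then k i else 0)" for i
  have "k' \<in> levels m (- {j})" using assms by (auto simp: levels_def k'_def)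
  then have "\<bar>E k' fD x\<bar> \<le> partial_max j x" unfolding partial_max_def by (intro Max_ge) (auto simp: finite_levels)
  moreover have "E k' fD = E k fD" by (rule E_cong_index) (simp add: k'_def)
  ultimately show ?thesis by simp
qed

lemma partial_max_nonneg: "0 \<le> partial_max j x"
  using partial_max_upper[of "\<lambda>_. 0" j x] by simp

lemma finite_adm: "finite {k \<in> levels m UNIV. adm k x}"
  using finite_levels by simp

lemma adm_max_nonneg: "0 \<le> adm_max x"
  unfolding adm_max_def using finite_adm by (intro Max_ge) auto

lemma adm_max_upper: "adm k x \<Longrightarrow> E k f x \<le> adm_max x"
  unfolding adm_max_def using finite_adm by (intro Max_ge) (auto simp: adm_def)

lemma adm_max_le_partial_max:
  assumes x: "x \<in> X"
  shows "adm_max x \<le> 2 ^ m * (\<Sum>j<m. partial_max j x)"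
proof -
  have "E k f x \<le> 2 ^ m * (\<Sum>j<m. partial_max j x)" if "adm k x" for k
    using adm_average_bound[OF that x, of "\<lambda>j. partial_max j x"] partial_max_upper by fastforce
  moreover have "0 \<le> 2 ^ m * (\<Sum>j<m. partial_max j x)" using partial_max_nonneg by (simp add: sum_nonneg)
  ultimately show ?thesis unfolding adm_max_def using finite_adm by (subst Max_le_iff) auto
qed

lemma square_fn_nonneg: "0 \<le> square_fn j x"
  unfolding square_fn_def by (intro sum_nonneg E_nonneg) simp

lemma energy_fn_nonneg: "0 \<le> energy_fn s j x"
  unfolding energy_fn_def by (intro sum_nonneg E_nonneg quot_sq_nonneg)

text \<open>U^2 is W^s times the weight. Where \<open>act\<close> holds, W^s is constant on the
  parent rectangle, leaves the average and is at most \<open>adm_max\<close> to the power s;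
  elsewhere U vanishes.\<close>

lemma square_fn_le_energy_fn:
  assumes j: "j < m" and x: "x \<in> X" and s: "0 \<le> s"
  shows "square_fn j x \<le> adm_max x powr s * energy_fn s j x"
  unfolding square_fn_def energy_fn_def sum_distrib_left
proof (rule sum_mono)
  fix l assume l: "l \<in> levels m (- {j})"
  let ?u = "up m (- {j}) l"
  define h where "h y = of_bool (act j l y) * W j l y powr s" for y
  have mh: "meas ?u h"
    unfolding meas_def
  proof (intro ballI)
    fix y z assume y: "y \<in> X" and z: "z \<in> b ?u y"
    have "act j l z = act j l y" using meas_act[OF j l] y z by (simp add: meas_def)
    then show "h z = h y" using W_const[OF j l y z] by (simp add: h_def)
  qed
  have "E ?u (\<lambda>y. (U j l y)\<^sup>2) = E ?u (\<lambda>y. h y * quot_sq s (U j l y) (W j l y))"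
  proof (rule E_cong)
    fix y assume y: "y \<in> X"
    have "W j l y powr s * W j l y powr (- s) = 1" using W_pos[OF j y, of l] by (simp add: powr_add[symmetric])
    then show "(U j l y)\<^sup>2 = h y * quot_sq s (U j l y) (W j l y)"
      using U_eq[OF j l y] by (simp add: h_def quot_sq_def algebra_simps)
  qed
  then have "E ?u (\<lambda>y. (U j l y)\<^sup>2) x = h x * E ?u (\<lambda>y. quot_sq s (U j l y) (W j l y)) x"
    using E_mult_meas[OF mh] by simp
  also have "\<dots> \<le> adm_max x powr s * E ?u (\<lambda>y. quot_sq s (U j l y) (W j l y)) x"
  proof (rule mult_right_mono)
    show "h x \<le> adm_max x powr s"
    proof (cases "act j l x")
      case True
      have "W j l x \<le> adm_max x" using W_adm[OF j l x True] adm_max_upper by auto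
      then show ?thesis using s W_pos[OF j x, of l] True by (simp add: h_def powr_mono2)
    qed (simp add: h_def)
  qed (intro E_nonneg quot_sq_nonneg)
  finally show "E ?u (\<lambda>y. (U j l y)\<^sup>2) x \<le> adm_max x powr s * E ?u (\<lambda>y. quot_sq s (U j l y) (W j l y)) x" .
qed

lemma sum_energy_fn:
  assumes "j < m" "1/2 \<le> s" "s < 1"
  shows "(\<Sum>x\<in>X. energy_fn s j x) \<le> (8 * K\<^sup>2 / (1 - s)) ^ (m - 1) * (\<Sum>x\<in>X. f x powr (2 - s))"
proof -
  have "(\<Sum>x\<in>X. energy_fn s j x) = (\<Sum>l\<in>levels m (- {j}). \<Sum>x\<in>X. quot_sq s (U j l x) (W j l x))"
    unfolding energy_fn_def by (subst sum.swap) (simp add: sum_E)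
  then show ?thesis using stopped_energy[OF assms] by simp
qed

lemma sum_square_strong_max:
  assumes "\<And>x. x \<in> X \<Longrightarrow> 0 \<le> g x"
  shows "(\<Sum>x\<in>X. (strong_max m g x)\<^sup>2) \<le> 16 ^ m * (\<Sum>x\<in>X. (g x)\<^sup>2)"
proof -
  have "(\<Sum>x\<in>X. strong_max m g x powr 2) \<le> ((2 * 2 / (2 - 1)) powr 2) ^ m * (\<Sum>x\<in>X. g x powr 2)"
    by (rule strong_max_bound) (use assms in auto)
  moreover have "(\<Sum>x\<in>X. strong_max m g x powr 2) = (\<Sum>x\<in>X. (strong_max m g x)\<^sup>2)"
    using strong_max_nonneg[OF assms] by (intro sum.cong) auto
  moreover have "(\<Sum>x\<in>X. g x powr 2) = (\<Sum>x\<in>X. (g x)\<^sup>2)"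
    using assms by (intro sum.cong) auto
  ultimately show ?thesis by simp
qed

text \<open>
  Replacing \<open>U\<close> by \<open>0\<close> on the blocks half covered by \<open>{square_fn > t\<^sup>2}\<close> changes the averages of \<open>f\<^sub>D\<close> only on
  a set of comparable size, and what is left is bounded in \<open>L\<^sup>2\<close> by \<open>square_fn\<close> on \<open>{square_fn \<le> t\<^sup>2}\<close>.
\<close>

lemma good_lambda:
  assumes j: "j < m" and t: "0 < t"
  shows "real (card {x\<in>X. t < partial_max j x}) \<le> 4 * 16 ^ m * real (card {x\<in>X. t\<^sup>2 < square_fn j x})
    + 2 * 16 ^ m / t\<^sup>2 * (\<Sum>x\<in>{x\<in>X. square_fn j x \<le> t\<^sup>2}. square_fn j x)"
proof -
  define \<omega> where "\<omega> x = (of_bool (t\<^sup>2 < square_fn j x) :: real)" for x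
  let ?T = "- {j}"
  define G where "G l x = (of_bool (E (up m ?T l) \<omega> x < 1/2) :: real)" for l x
  define v where "v x = (\<Sum>l\<in>levels m ?T. G l x * U j l x)" for x
  have mG: "meas (up m ?T l) (G l)" for l
    using meas_E[of "up m ?T l" \<omega>] by (simp add: meas_def G_def)
  have pG: "pure ?T l (\<lambda>x. G l x * U j l x)" if "l \<in> levels m ?T" for l
    using levels_le[OF that] by (intro pure_mult pure_U[OF j that] mG) auto
  have \<omega>0: "0 \<le> \<omega> x" for x by (simp add: \<omega>_def)
  have upL: "up m ?T l i \<le> L" for l i by (simp add: up_def)
  have "partial_max j x \<le> strong_max m (\<lambda>x. \<bar>v x\<bar>) x" if x: "x \<in> X" and small: "strong_max m \<omega> x < 1/2" for x
  proof -
    \<comment> \<open>All averages of \<omega> at x are below 1/2, so no U is cut off at x.\<close>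
    have G1: "G l x = 1" for l
      using E_le_strong_max[of \<omega> "up m ?T l" x] \<omega>0 upL x small by (simp add: G_def)
    have "\<bar>E k fD x\<bar> \<le> strong_max m (\<lambda>x. \<bar>v x\<bar>) x" if k: "k \<in> levels m ?T" for k
    proof -
      have k0: "k i \<le> L" "i < m \<Longrightarrow> i \<notin> ?T \<Longrightarrow> k i = 0" for i
        using levels_le[OF k] levels_out[OF k] by auto
      have "E k fD x = (\<Sum>l\<in>levels m ?T. E k (U j l) x)"
        unfolding fD_U[OF j, abs_def] by (rule E_sum)
      also have "\<dots> = (\<Sum>l\<in>levels m ?T. E k (\<lambda>x. G l x * U j l x) x)"
      proof (rule sum.cong[OF refl])
        fix l assume l: "l \<in> levels m ?T"
        show "E k (U j l) x = E k (\<lambda>x. G l x * U j l x) x"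
          using pure_E[OF pure_U[OF j l] x, of k] pure_E[OF pG[OF l] x, of k] k0 G1 by auto
      qed
      also have "\<dots> = E k v x" unfolding v_def[abs_def] by (rule E_sum[symmetric])
      finally have "\<bar>E k fD x\<bar> \<le> E k (\<lambda>x. \<bar>v x\<bar>) x" using E_abs by simp
      also have "\<dots> \<le> strong_max m (\<lambda>x. \<bar>v x\<bar>) x" using k0 x by (intro E_le_strong_max) auto
      finally show ?thesis .
    qed
    moreover have "levels m ?T \<noteq> {}" using zero_levels by blast
    ultimately show ?thesis unfolding partial_max_def using finite_levels by (subst Max_le_iff) auto
  qed
  then have "{x\<in>X. t < partial_max j x} \<subseteq> {x\<in>X. 1/2 \<le> strong_max m \<omega> x} \<union> {x\<in>X. t < strong_max m (\<lambda>x. \<bar>v x\<bar>) x}"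
    by force
  then have "card {x\<in>X. t < partial_max j x}
      \<le> card ({x\<in>X. 1/2 \<le> strong_max m \<omega> x} \<union> {x\<in>X. t < strong_max m (\<lambda>x. \<bar>v x\<bar>) x})"
    using fin by (intro card_mono) auto
  also have "\<dots> \<le> card {x\<in>X. 1/2 \<le> strong_max m \<omega> x} + card {x\<in>X. t < strong_max m (\<lambda>x. \<bar>v x\<bar>) x}"
    by (rule card_Un_le)
  finally have "real (card {x\<in>X. t < partial_max j x})
      \<le> real (card {x\<in>X. 1/2 \<le> strong_max m \<omega> x} + card {x\<in>X. t < strong_max m (\<lambda>x. \<bar>v x\<bar>) x})"
    by (simp only: of_nat_le_iff)
  then have 1: "real (card {x\<in>X. t < partial_max j x})
      \<le> real (card {x\<in>X. 1/2 \<le> strong_max m \<omega> x}) + real (card {x\<in>X. t < strong_max m (\<lambda>x. \<bar>v x\<bar>) x})"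
    by (simp only: of_nat_add)
  have cheb: "real (card {x\<in>X. P x}) \<le> c * (\<Sum>x\<in>X. (g x)\<^sup>2)"
    if "0 \<le> c" "\<And>x. x \<in> X \<Longrightarrow> P x \<Longrightarrow> 1 \<le> c * (g x)\<^sup>2" for P c and g :: "'x \<Rightarrow> real"
  proof -
    have "real (card {x\<in>X. P x}) = (\<Sum>x\<in>X. if P x then 1 else 0)"
      using fin by (simp add: sum.inter_filter[symmetric])
    also have "\<dots> \<le> (\<Sum>x\<in>X. c * (g x)\<^sup>2)" using that by (intro sum_mono) auto
    finally show ?thesis by (simp add: sum_distrib_left)
  qed
  have 2: "real (card {x\<in>X. 1/2 \<le> strong_max m \<omega> x}) \<le> 4 * (\<Sum>x\<in>X. (strong_max m \<omega> x)\<^sup>2)"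
  proof (rule cheb)
    fix x assume "1/2 \<le> strong_max m \<omega> x"
    then have "(1/2)\<^sup>2 \<le> (strong_max m \<omega> x)\<^sup>2" by (intro power_mono) auto
    then show "1 \<le> 4 * (strong_max m \<omega> x)\<^sup>2" by (simp add: power2_eq_square)
  qed simp
  have "(\<Sum>x\<in>X. (\<omega> x)\<^sup>2) = (\<Sum>x\<in>X. if t\<^sup>2 < square_fn j x then 1 else 0)"
    by (intro sum.cong) (auto simp: \<omega>_def)
  also have "\<dots> = real (card {x\<in>X. t\<^sup>2 < square_fn j x})"
    using fin by (simp add: sum.inter_filter[symmetric])
  finally have 3: "(\<Sum>x\<in>X. (strong_max m \<omega> x)\<^sup>2) \<le> 16 ^ m * real (card {x\<in>X. t\<^sup>2 < square_fn j x})"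
    using sum_square_strong_max[of \<omega>] \<omega>0 by simp
  have 4: "real (card {x\<in>X. t < strong_max m (\<lambda>x. \<bar>v x\<bar>) x}) \<le> 1 / t\<^sup>2 * (\<Sum>x\<in>X. (strong_max m (\<lambda>x. \<bar>v x\<bar>) x)\<^sup>2)"
  proof (rule cheb)
    fix x assume "t < strong_max m (\<lambda>x. \<bar>v x\<bar>) x"
    then have "t\<^sup>2 \<le> (strong_max m (\<lambda>x. \<bar>v x\<bar>) x)\<^sup>2" using t by (intro power_mono) auto
    then show "1 \<le> 1 / t\<^sup>2 * (strong_max m (\<lambda>x. \<bar>v x\<bar>) x)\<^sup>2" using t by (simp add: field_simps)
  qed simp
  have "(\<Sum>x\<in>X. (v x)\<^sup>2) = (\<Sum>l\<in>levels m ?T. \<Sum>x\<in>X. (G l x * U j l x)\<^sup>2)"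
    unfolding v_def by (rule pure_sum_square[OF pG])
  also have "\<dots> \<le> (\<Sum>l\<in>levels m ?T. 2 * (\<Sum>x\<in>X. (1 - \<omega> x) * E (up m ?T l) (\<lambda>y. (U j l y)\<^sup>2) x))"
  proof (rule sum_mono)
    fix l
    let ?u = "up m ?T l"
    define h where "h x = G l x * E ?u (\<lambda>y. (U j l y)\<^sup>2) x" for x
    have E0: "0 \<le> E ?u (\<lambda>y. (U j l y)\<^sup>2) x" for x by (rule E_nonneg) simp
    have h0: "0 \<le> h x" for x using E0 by (simp add: h_def G_def)
    have mh: "meas ?u h" using mG[of l] meas_E[of ?u] by (simp add: meas_def h_def)
    have "(\<Sum>x\<in>X. (G l x * U j l x)\<^sup>2) = (\<Sum>x\<in>X. G l x * (U j l x)\<^sup>2)"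
      by (intro sum.cong) (auto simp: G_def)
    also have "\<dots> = (\<Sum>x\<in>X. h x)" unfolding h_def by (rule sum_meas_E[OF mG, symmetric])
    \<comment> \<open>\<open>h\<close> is nonzero only on blocks where \<omega> has average below
      1/2, so at least half of its mass lies where \<omega> = 0.\<close>
    also have "\<dots> \<le> 2 * (\<Sum>x\<in>X. (1 - \<omega> x) * h x)"
    proof -
      have "(\<Sum>x\<in>X. h x * \<omega> x) = (\<Sum>x\<in>X. h x * E ?u \<omega> x)" by (rule sum_meas_E[OF mh, symmetric])
      also have "\<dots> \<le> (\<Sum>x\<in>X. h x * (1/2))"
      proof (rule sum_mono)
        fix x
        show "h x * E ?u \<omega> x \<le> h x * (1/2)"
        proof (cases "E ?u \<omega> x < 1/2")
          case True
          then show ?thesis using h0[of x] by (intro mult_left_mono) auto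
        qed (simp add: h_def G_def)
      qed
      also have "\<dots> = (\<Sum>x\<in>X. h x) / 2" by (simp add: sum_divide_distrib)
      finally show ?thesis by (simp add: algebra_simps sum_subtractf)
    qed
    also have "\<dots> \<le> 2 * (\<Sum>x\<in>X. (1 - \<omega> x) * E ?u (\<lambda>y. (U j l y)\<^sup>2) x)"
      using E0 by (intro mult_left_mono sum_mono) (auto simp: h_def G_def \<omega>_def)
    finally show "(\<Sum>x\<in>X. (G l x * U j l x)\<^sup>2) \<le> \<dots>" .
  qed
  also have "\<dots> = 2 * (\<Sum>x\<in>X. (1 - \<omega> x) * square_fn j x)"
    unfolding square_fn_def sum_distrib_left by (subst sum.swap) simp
  also have "(\<Sum>x\<in>X. (1 - \<omega> x) * square_fn j x) = (\<Sum>x\<in>X. if square_fn j x \<le> t\<^sup>2 then square_fn j x else 0)"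
    by (intro sum.cong) (auto simp: \<omega>_def)
  also have "\<dots> = (\<Sum>x\<in>{x\<in>X. square_fn j x \<le> t\<^sup>2}. square_fn j x)"
    by (rule sum.inter_filter[OF fin, symmetric])
  finally have "(\<Sum>x\<in>X. (v x)\<^sup>2) \<le> 2 * (\<Sum>x\<in>{x\<in>X. square_fn j x \<le> t\<^sup>2}. square_fn j x)" .
  then have "16 ^ m * (\<Sum>x\<in>X. \<bar>v x\<bar>\<^sup>2) \<le> 16 ^ m * (2 * (\<Sum>x\<in>{x\<in>X. square_fn j x \<le> t\<^sup>2}. square_fn j x))"
    by (intro mult_left_mono) auto
  then have "(\<Sum>x\<in>X. (strong_max m (\<lambda>x. \<bar>v x\<bar>) x)\<^sup>2) \<le> 16 ^ m * (2 * (\<Sum>x\<in>{x\<in>X. square_fn j x \<le> t\<^sup>2}. square_fn j x))"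
    by (intro order_trans[OF sum_square_strong_max]) auto
  then have "1 / t\<^sup>2 * (\<Sum>x\<in>X. (strong_max m (\<lambda>x. \<bar>v x\<bar>) x)\<^sup>2)
      \<le> 1 / t\<^sup>2 * (16 ^ m * (2 * (\<Sum>x\<in>{x\<in>X. square_fn j x \<le> t\<^sup>2}. square_fn j x)))"
    by (intro mult_left_mono) auto
  also have "\<dots> = 2 * 16 ^ m / t\<^sup>2 * (\<Sum>x\<in>{x\<in>X. square_fn j x \<le> t\<^sup>2}. square_fn j x)" by simp
  finally show ?thesis using 1 2 3 4 by linarith
qed

text \<open>\<open>weak_to_strong\<close> with the two constants of \<open>good_lambda\<close>,
  whence 96 = 16 * (4 + 2). The square root puts both functions on the same threshold t.\<close>

lemma sum_partial_max:
  assumes j: "j < m" and p: "1 < p" "p \<le> 3/2"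
  shows "(\<Sum>x\<in>X. partial_max j x powr p) \<le> 96 * 16 ^ m * (\<Sum>x\<in>X. square_fn j x powr (p / 2))"
proof -
  have lt: "t < sqrt (square_fn j x) \<longleftrightarrow> t\<^sup>2 < square_fn j x" if "0 < t" for t x
    using that square_fn_nonneg[of j x] by (metis less_le real_less_rsqrt real_sqrt_less_iff real_sqrt_abs abs_of_pos)
  have "(\<Sum>x\<in>X. partial_max j x powr p) \<le> 16 * (4 * 16 ^ m + 2 * 16 ^ m) * (\<Sum>x\<in>X. sqrt (square_fn j x) powr p)"
  proof (rule weak_to_strong[OF p fin])
    fix t :: real assume t: "0 < t"
    have 1: "{x\<in>X. t < sqrt (square_fn j x)} = {x\<in>X. t\<^sup>2 < square_fn j x}" using lt[OF t] by simp
    have 2: "{x\<in>X. sqrt (square_fn j x) \<le> t} = {x\<in>X. square_fn j x \<le> t\<^sup>2}" using lt[OF t] by (auto simp: not_less[symmetric])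
    show "real (card {x\<in>X. t < partial_max j x}) \<le> 4 * 16 ^ m * real (card {x\<in>X. t < sqrt (square_fn j x)})
        + 2 * 16 ^ m / t\<^sup>2 * (\<Sum>x\<in>{x\<in>X. sqrt (square_fn j x) \<le> t}. (sqrt (square_fn j x))\<^sup>2)"
      unfolding 1 2 using good_lambda[OF j t] square_fn_nonneg by simp
  qed (use partial_max_nonneg square_fn_nonneg in auto)
  also have "(\<Sum>x\<in>X. sqrt (square_fn j x) powr p) = (\<Sum>x\<in>X. square_fn j x powr (p / 2))"
    using square_fn_nonneg by (intro sum.cong) (simp_all add: powr_half_sqrt[symmetric] powr_powr)
  finally show ?thesis by simp
qed

text \<open>c is chosen so that c1 * a * m = c / 2. Applying \<open>young_absorb\<close> with \<eta>
  = 1 / c then leaves exactly half of the left-hand side on the right, and this finite half is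
  subtracted.\<close>

lemma sum_adm_max:
  assumes m: "1 \<le> m" and p: "1 < p" "p \<le> 3/2"
  defines "c \<equiv> 2 * (2 ^ m * real m)\<^sup>2 * (96 * 16 ^ m) * real m"
  shows "(\<Sum>x\<in>X. adm_max x powr p) \<le> c ^ 3 * (8 * K\<^sup>2 / (p - 1)) ^ (m - 1) * (\<Sum>x\<in>X. f x powr p)"
proof -
  define c1 where "c1 = (2 ^ m * real m)\<^sup>2"
  define a where "a = (96 * 16 ^ m :: real)"
  define EE where "EE = (8 * K\<^sup>2 / (p - 1)) ^ (m - 1) * (\<Sum>x\<in>X. f x powr p)"
  define ZZ where "ZZ = (\<Sum>x\<in>X. adm_max x powr p)"
  have base: "1 \<le> 2 ^ m * real m" using m one_le_mult[of "2 ^ m" "real m"] by simp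
  have c1: "1 \<le> c1" using base by (simp add: c1_def one_le_power)
  have a: "1 \<le> a" unfolding a_def by (rule one_le_mult) simp_all
  have c: "c = 2 * c1 * a * real m" by (simp add: c_def c1_def a_def)
  have cge: "1 \<le> c" unfolding c using c1 a m by (intro one_le_mult) auto
  have "ZZ \<le> (\<Sum>x\<in>X. c1 * (\<Sum>j<m. partial_max j x powr p))"
    unfolding ZZ_def
  proof (rule sum_mono)
    fix x assume x: "x \<in> X"
    define M where "M = Max ((\<lambda>j. partial_max j x) ` {..<m})"
    have ne: "(\<lambda>j. partial_max j x) ` {..<m} \<noteq> {}" using m by (auto simp: lessThan_empty_iff)
    then have "M \<in> (\<lambda>j. partial_max j x) ` {..<m}" unfolding M_def by (intro Max_in) auto
    then obtain j0 where j0: "j0 < m" "M = partial_max j0 x" by auto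
    have "(\<Sum>j<m. partial_max j x) \<le> (\<Sum>j<m. M)" unfolding M_def by (intro sum_mono Max_ge) auto
    then have "adm_max x \<le> (2 ^ m * real m) * M"
      by (intro order_trans[OF adm_max_le_partial_max[OF x]]) (simp add: mult.assoc)
    then have "adm_max x powr p \<le> ((2 ^ m * real m) * M) powr p"
      using p adm_max_nonneg by (intro powr_mono2) auto
    also have "\<dots> = (2 ^ m * real m) powr p * M powr p"
      using partial_max_nonneg by (simp add: j0 powr_mult)
    also have "\<dots> \<le> (2 ^ m * real m) powr 2 * M powr p"
      using base p by (intro mult_right_mono powr_mono) auto
    also have "(2 ^ m * real m) powr 2 = c1" by (simp add: c1_def)
    also have "c1 * M powr p \<le> c1 * (\<Sum>j<m. partial_max j x powr p)"
      unfolding j0(2) using c1 j0(1) by (intro mult_left_mono member_le_sum[of j0 "{..<m}" "\<lambda>j. partial_max j x powr p"]) auto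
    finally show "adm_max x powr p \<le> c1 * (\<Sum>j<m. partial_max j x powr p)" .
  qed
  also have "\<dots> = c1 * (\<Sum>j<m. \<Sum>x\<in>X. partial_max j x powr p)"
    unfolding sum_distrib_left[symmetric] by (subst sum.swap) simp
  also have "\<dots> \<le> c1 * (\<Sum>j<m. a * (1 / c * ZZ + c\<^sup>2 * EE))"
  proof (intro mult_left_mono sum_mono)
    fix j assume "j \<in> {..<m}"
    then have j: "j < m" by simp
    have "(\<Sum>x\<in>X. square_fn j x powr (p / 2)) \<le> (\<Sum>x\<in>X. 1 / c * adm_max x powr p + energy_fn (2 - p) j x / (1 / c)\<^sup>2)"
    proof (rule sum_mono)
      fix x assume x: "x \<in> X"
      have "square_fn j x \<le> adm_max x powr (2 - p) * energy_fn (2 - p) j x" using p by (intro square_fn_le_energy_fn[OF j x]) auto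
      then have "square_fn j x powr (p / 2) \<le> (adm_max x powr (2 - p) * energy_fn (2 - p) j x) powr (p / 2)"
        using p square_fn_nonneg by (intro powr_mono2) auto
      also have "\<dots> \<le> 1 / c * adm_max x powr p + energy_fn (2 - p) j x / (1 / c)\<^sup>2"
        using p cge adm_max_nonneg energy_fn_nonneg by (intro young_absorb) auto
      finally show "square_fn j x powr (p / 2) \<le> 1 / c * adm_max x powr p + energy_fn (2 - p) j x / (1 / c)\<^sup>2" .
    qed
    also have "\<dots> = 1 / c * ZZ + c\<^sup>2 * (\<Sum>x\<in>X. energy_fn (2 - p) j x)"
      by (simp add: ZZ_def sum.distrib sum_distrib_left sum_divide_distrib power_divide mult.commute)
    also have "\<dots> \<le> 1 / c * ZZ + c\<^sup>2 * EE"
    proof -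
      have "(\<Sum>x\<in>X. energy_fn (2 - p) j x) \<le> EE"
        using sum_energy_fn[OF j, of "2 - p"] p by (simp add: EE_def)
      then show ?thesis by (intro add_left_mono mult_left_mono) auto
    qed
    finally have "(\<Sum>x\<in>X. square_fn j x powr (p / 2)) \<le> 1 / c * ZZ + c\<^sup>2 * EE" .
    then have "a * (\<Sum>x\<in>X. square_fn j x powr (p / 2)) \<le> a * (1 / c * ZZ + c\<^sup>2 * EE)"
      using a by (intro mult_left_mono) auto
    then show "(\<Sum>x\<in>X. partial_max j x powr p) \<le> a * (1 / c * ZZ + c\<^sup>2 * EE)"
      using sum_partial_max[OF j p] unfolding a_def by (rule order_trans[rotated])
  qed (use c1 in simp)
  also have "\<dots> = c / 2 * (1 / c * ZZ + c\<^sup>2 * EE)" by (simp add: c)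
  also have "\<dots> = ZZ / 2 + c ^ 3 * EE / 2" using cge by (simp add: field_simps power2_eq_square power3_eq_cube)
  finally have "ZZ \<le> c ^ 3 * EE" by simp
  then show ?thesis by (simp add: ZZ_def EE_def mult.assoc)
qed

end

subsection \<open>Families without strictly nested members\<close>

text \<open>The first summand is the constant of \<open>sum_adm_max\<close>, for p <= 3/2. The
  second serves p > 3/2, where 2 p / (p - 1) <= 6 and 6^p <= 36.\<close>

definition rect_const :: "nat \<Rightarrow> real \<Rightarrow> real" where
  "rect_const m K = (2 * (2 ^ m * real m)\<^sup>2 * (96 * 16 ^ m) * real m) ^ 3 * (8 * K\<^sup>2) ^ (m - 1) + 36 ^ m"

lemma rect_const_ge_1: "1 \<le> rect_const m K"
proof -
  have "1 \<le> (36::real) ^ m" by (rule one_le_power) simp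
  moreover have "0 \<le> (2 * (2 ^ m * real m)\<^sup>2 * (96 * 16 ^ m) * real m) ^ 3 * (8 * K\<^sup>2) ^ (m - 1)" by simp
  ultimately show ?thesis unfolding rect_const_def by linarith
qed

context block_averages
begin

context
  fixes G :: "((nat \<Rightarrow> nat) \<times> 'x) set"
  assumes G_levels: "(k, y) \<in> G \<Longrightarrow> k \<in> levels m UNIV" and G_X: "(k, y) \<in> G \<Longrightarrow> y \<in> X"
    and G_weak: "(k, y) \<in> G \<Longrightarrow> (l, z) \<in> G \<Longrightarrow> (\<And>i. i < m \<Longrightarrow> l i < k i) \<Longrightarrow> \<not> b l z \<subseteq> b k y"
begin

definition below :: "(nat \<Rightarrow> nat) \<Rightarrow> 'x \<Rightarrow> bool" where
  "below l x \<longleftrightarrow> (\<exists>(k, y)\<in>G. (\<forall>i<m. k i \<le> l i) \<and> y \<in> b (up m UNIV l) x)"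

lemma stopped_below:
  assumes f: "\<And>x. x \<in> X \<Longrightarrow> 0 < f x"
  shows "stopped_averages X b m L K below f"
proof unfold_locales
  fix l assume "l \<in> levels m UNIV"
  show "meas (up m UNIV l) (below l)"
    unfolding meas_def
  proof (intro ballI)
    fix x y assume "x \<in> X" "y \<in> b (up m UNIV l) x"
    then have "b (up m UNIV l) y = b (up m UNIV l) x" by (rule b_eq)
    then show "below l y = below l x" unfolding below_def by (simp only:)
  qed
next
  fix x l l' assume x: "x \<in> X" and le: "\<And>i. i < m \<Longrightarrow> l i \<le> l' i" and "below l x"
  then obtain k y where ky: "(k, y) \<in> G" "\<And>i. i < m \<Longrightarrow> k i \<le> l i" "y \<in> b (up m UNIV l) x"
    by (auto simp: below_def)
  have "b (up m UNIV l) x \<subseteq> b (up m UNIV l') x"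
  proof (rule b_mono[OF x])
    fix i assume "i < m"
    then show "up m UNIV l i \<le> up m UNIV l' i" using le[of i] by (auto simp: up_def min_def)
  qed
  moreover have "\<forall>i<m. k i \<le> l' i" using ky(2) le order_trans by blast
  ultimately show "below l' x" unfolding below_def using ky by blast
qed (use f in auto)

text \<open>If l is strictly below k, the parent of level l still fits into the member of level k. A
  member counted by \<open>below l\<close> would then lie inside it and have a smaller level in
  every coordinate, against \<open>G_weak\<close>.\<close>

lemma rect_adm:
  fixes f :: "'x \<Rightarrow> real"
  assumes f: "\<And>x. x \<in> X \<Longrightarrow> 0 < f x" and ky: "(k, y) \<in> G" and x: "x \<in> X" "x \<in> b k y"
  shows "stopped_averages.adm m L below k x"
proof -
  interpret stopped_averages X b m L K below f by (rule stopped_below[OF f])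
  have yX: "y \<in> X" and kL: "k \<in> levels m UNIV" using ky G_X G_levels by auto
  have yk: "y \<in> b k x" using b_sym[OF yX x(2)] by simp
  have "b k x \<subseteq> b (up m UNIV k) x"
    by (rule b_mono[OF x(1)]) (use levels_le[OF kL] in \<open>auto simp: up_def\<close>)
  then have "below k x" unfolding below_def using ky yk by blast
  moreover have "\<exists>i<m. k i \<le> l i" if l: "l \<in> levels m UNIV" and b: "below l x" for l
  proof (rule ccontr)
    assume "\<not> (\<exists>i<m. k i \<le> l i)"
    then have lk: "\<And>i. i < m \<Longrightarrow> l i < k i" by force
    obtain k' y' where k': "(k', y') \<in> G" "\<And>i. i < m \<Longrightarrow> k' i \<le> l i" "y' \<in> b (up m UNIV l) x"
      using b by (auto simp: below_def)
    have "b (up m UNIV l) x \<subseteq> b k x"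
      by (rule b_mono[OF x(1)]) (use lk in \<open>force simp: up_def Suc_le_eq min.coboundedI1\<close>)
    then have "b k y' = b k x" using k'(3) x(1) by (intro b_eq) auto
    moreover have "b k x = b k y" by (rule b_eq[OF yX x(2)])
    moreover have "b k' y' \<subseteq> b k y'"
      by (rule b_mono[OF G_X[OF k'(1)]]) (use lk k'(2) in \<open>force intro: less_imp_le le_less_trans\<close>)
    ultimately have "b k' y' \<subseteq> b k y" by simp
    moreover have "k' i < k i" if "i < m" for i using lk[OF that] k'(2)[OF that] by simp
    ultimately show False using G_weak[OF ky k'(1)] by blast
  qed
  ultimately show ?thesis unfolding adm_def using kL by blast
qed

text \<open>\<open>h\<close> stands for the maximal function on cells. For p above 3/2 the extra
  factor of the iterated maximal inequality is harmless, as p' < 3.\<close>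

lemma rect_max_pos:
  assumes m: "1 \<le> m" and p: "1 < p" "p \<le> 2" and f: "\<And>x. x \<in> X \<Longrightarrow> 0 < f x"
    and h: "\<And>x. x \<in> X \<Longrightarrow> 0 \<le> h x"
      "\<And>x. x \<in> X \<Longrightarrow> h x = 0 \<or> (\<exists>(k, y)\<in>G. x \<in> b k y \<and> h x \<le> E k f x)"
  shows "(\<Sum>x\<in>X. h x powr p) \<le> rect_const m K * (p / (p - 1)) ^ (m - 1) * (\<Sum>x\<in>X. f x powr p)"
proof -
  interpret stopped_averages X b m L K below f by (rule stopped_below[OF f])
  define c where "c = (2 * (2 ^ m * real m)\<^sup>2 * (96 * 16 ^ m) * real m) ^ 3"
  have c: "0 \<le> c" unfolding c_def by simp
  have F: "0 \<le> (\<Sum>x\<in>X. f x powr p)" by (intro sum_nonneg) simp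
  have pp: "1 \<le> p / (p - 1)" "1 / (p - 1) \<le> p / (p - 1)" using p by (simp_all add: field_simps)
  show ?thesis
  proof (cases "p \<le> 3/2")
    case True
    have h_le: "h x \<le> adm_max x" if x: "x \<in> X" for x
    proof -
      consider "h x = 0" | k y where "(k, y) \<in> G" "x \<in> b k y" "h x \<le> E k f x" using h(2)[OF x] by auto
      then show ?thesis
      proof cases
        case 1
        then show ?thesis using adm_max_nonneg by simp
      next
        case 2
        have "adm k x" by (rule rect_adm[OF _ 2(1) x 2(2)]) (rule f)
        then show ?thesis using adm_max_upper[of k x] 2(3) by linarith
      qed
    qed
    have "(\<Sum>x\<in>X. h x powr p) \<le> (\<Sum>x\<in>X. adm_max x powr p)"
      using p h_le h(1) by (intro sum_mono powr_mono2) auto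
    also have "\<dots> \<le> c * (8 * K\<^sup>2 / (p - 1)) ^ (m - 1) * (\<Sum>x\<in>X. f x powr p)"
      unfolding c_def by (rule sum_adm_max[OF m p(1) True])
    also have "\<dots> \<le> rect_const m K * (p / (p - 1)) ^ (m - 1) * (\<Sum>x\<in>X. f x powr p)"
    proof (rule mult_right_mono[OF _ F])
      have "(8 * K\<^sup>2 / (p - 1)) ^ (m - 1) = (8 * K\<^sup>2) ^ (m - 1) * (1 / (p - 1)) ^ (m - 1)"
        by (simp add: power_divide)
      also have "\<dots> \<le> (8 * K\<^sup>2) ^ (m - 1) * (p / (p - 1)) ^ (m - 1)"
        using pp p by (intro mult_left_mono power_mono) auto
      finally have "c * (8 * K\<^sup>2 / (p - 1)) ^ (m - 1) \<le> c * ((8 * K\<^sup>2) ^ (m - 1) * (p / (p - 1)) ^ (m - 1))"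
        using c by (intro mult_left_mono)
      also have "\<dots> = (c * (8 * K\<^sup>2) ^ (m - 1)) * (p / (p - 1)) ^ (m - 1)" by simp
      also have "\<dots> \<le> rect_const m K * (p / (p - 1)) ^ (m - 1)"
        unfolding rect_const_def c_def using pp by (intro mult_right_mono) auto
      finally show "c * (8 * K\<^sup>2 / (p - 1)) ^ (m - 1) \<le> rect_const m K * (p / (p - 1)) ^ (m - 1)" .
    qed
    finally show ?thesis .
  next
    case False
    have f0: "\<And>x. x \<in> X \<Longrightarrow> 0 \<le> f x" using f less_imp_le by blast
    have hS: "h x \<le> strong_max m f x" if x: "x \<in> X" for x
    proof -
      consider "h x = 0" | k y where "(k, y) \<in> G" "x \<in> b k y" "h x \<le> E k f x" using h(2)[OF x] by auto
      then show ?thesis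
      proof cases
        case 1
        moreover have "0 \<le> strong_max m f x" by (rule strong_max_nonneg[OF f0 x])
        ultimately show ?thesis by simp
      next
        case 2
        have "E k f x \<le> strong_max m f x"
          by (rule E_le_strong_max[OF f0 _ x]) (use levels_le[OF G_levels[OF 2(1)]] in auto)
        then show ?thesis using 2 by linarith
      qed
    qed
    have "(\<Sum>x\<in>X. h x powr p) \<le> (\<Sum>x\<in>X. strong_max m f x powr p)"
      using p hS h(1) by (intro sum_mono powr_mono2) auto
    also have "\<dots> \<le> ((2 * p / (p - 1)) powr p) ^ m * (\<Sum>x\<in>X. f x powr p)"
      by (rule strong_max_bound[OF p(1) f0])
    also have "\<dots> \<le> rect_const m K * (p / (p - 1)) ^ (m - 1) * (\<Sum>x\<in>X. f x powr p)"
    proof (rule mult_right_mono[OF _ F])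
      have "(2 * p / (p - 1)) powr p \<le> 6 powr p"
        using p False by (intro powr_mono2) (auto simp: field_simps)
      also have "\<dots> \<le> 6 powr 2" using p by (intro powr_mono) auto
      finally have "(2 * p / (p - 1)) powr p \<le> 36" by simp
      then have "((2 * p / (p - 1)) powr p) ^ m \<le> 36 ^ m" by (intro power_mono) auto
      also have "\<dots> \<le> rect_const m K" unfolding rect_const_def by simp
      also have "\<dots> \<le> rect_const m K * (p / (p - 1)) ^ (m - 1)"
        using rect_const_ge_1[of m K] one_le_power[OF pp(1), of "m - 1"] by (simp add: mult_le_cancel_left1)
      finally show "((2 * p / (p - 1)) powr p) ^ m \<le> rect_const m K * (p / (p - 1)) ^ (m - 1)" .
    qed
    finally show ?thesis .
  qed
qed

text \<open>The negative powers of averages of f required f > 0; passing to f + \<epsilon> and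
  letting \<epsilon> tend to 0 removes this.\<close>

lemma rect_max_bound:
  assumes m: "1 \<le> m" and p: "1 < p" "p \<le> 2" and f: "\<And>x. x \<in> X \<Longrightarrow> 0 \<le> f x"
    and h: "\<And>x. x \<in> X \<Longrightarrow> 0 \<le> h x"
      "\<And>x. x \<in> X \<Longrightarrow> h x = 0 \<or> (\<exists>(k, y)\<in>G. x \<in> b k y \<and> h x \<le> E k f x)"
  shows "(\<Sum>x\<in>X. h x powr p) \<le> rect_const m K * (p / (p - 1)) ^ (m - 1) * (\<Sum>x\<in>X. f x powr p)"
proof (rule tendsto_lowerbound)
  show "((\<lambda>\<epsilon>. rect_const m K * (p / (p - 1)) ^ (m - 1) * (\<Sum>x\<in>X. (f x + \<epsilon>) powr p))
    \<longlongrightarrow> rect_const m K * (p / (p - 1)) ^ (m - 1) * (\<Sum>x\<in>X. f x powr p)) (at_right 0)"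
  proof (intro tendsto_mult_left tendsto_sum)
    fix x assume x: "x \<in> X"
    have "((\<lambda>\<epsilon>. f x + \<epsilon>) \<longlongrightarrow> f x + 0) (at_right 0)" by (intro tendsto_intros)
    moreover have "\<forall>\<^sub>F \<epsilon> in at_right 0. 0 \<le> f x + \<epsilon>"
      using f[OF x] by (auto simp: eventually_at_right_less intro!: eventually_at_rightI[of 0 1])
    ultimately show "((\<lambda>\<epsilon>. (f x + \<epsilon>) powr p) \<longlongrightarrow> f x powr p) (at_right 0)"
      using p by (intro tendsto_powr') auto
  qed
  show "\<forall>\<^sub>F \<epsilon> in at_right 0. (\<Sum>x\<in>X. h x powr p)
    \<le> rect_const m K * (p / (p - 1)) ^ (m - 1) * (\<Sum>x\<in>X. (f x + \<epsilon>) powr p)"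
  proof (rule eventually_at_rightI[of 0 1])
    fix \<epsilon> :: real assume "\<epsilon> \<in> {0<..<1}"
    then have \<epsilon>: "0 < \<epsilon>" by simp
    show "(\<Sum>x\<in>X. h x powr p) \<le> rect_const m K * (p / (p - 1)) ^ (m - 1) * (\<Sum>x\<in>X. (f x + \<epsilon>) powr p)"
    proof (rule rect_max_pos[OF m p _ h(1)])
      fix x assume x: "x \<in> X"
      show "0 < f x + \<epsilon>" using f[OF x] \<epsilon> by simp
      have le: "E k f x \<le> E k (\<lambda>x. f x + \<epsilon>) x" for k using \<epsilon> by (intro E_mono) auto
      show "h x = 0 \<or> (\<exists>(k, y)\<in>G. x \<in> b k y \<and> h x \<le> E k (\<lambda>x. f x + \<epsilon>) x)"
        using h(2)[OF x] order_trans[OF _ le] by blast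
    qed
  qed simp
qed simp

end

end

section \<open>Products of one-coordinate partitions\<close>

lemma PiE_Int_PiE: "PiE I A \<inter> PiE I B = PiE I (\<lambda>i. A i \<inter> B i)"
  by (auto simp: PiE_iff)

text \<open>In each coordinate one of the two levels is the coarser, so intersecting blocks are
  nested: their intersection is the finer block and the block of maximal level is the coarser one.
  The cardinality identity holds coordinatewise and multiplies.\<close>

lemma block_averages_PiE:
  fixes C :: "nat \<Rightarrow> 'c set" and B :: "nat \<Rightarrow> nat \<Rightarrow> 'c \<Rightarrow> 'c set" and K :: real
  assumes K: "1 \<le> K" and fin: "\<And>i. i < m \<Longrightarrow> finite (C i)"
    and sub: "\<And>i k c. i < m \<Longrightarrow> c \<in> C i \<Longrightarrow> B i k c \<subseteq> C i"
    and self: "\<And>i k c. i < m \<Longrightarrow> c \<in> C i \<Longrightarrow> c \<in> B i k c"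
    and eq: "\<And>i k c c'. i < m \<Longrightarrow> c \<in> C i \<Longrightarrow> c' \<in> B i k c \<Longrightarrow> B i k c' = B i k c"
    and zero: "\<And>i c. i < m \<Longrightarrow> c \<in> C i \<Longrightarrow> B i 0 c = {c}"
    and mono: "\<And>i k l c. i < m \<Longrightarrow> c \<in> C i \<Longrightarrow> k \<le> l \<Longrightarrow> B i k c \<subseteq> B i l c"
    and reg: "\<And>i k c. i < m \<Longrightarrow> c \<in> C i \<Longrightarrow> real (card (B i (Suc k) c)) \<le> K * real (card (B i k c))"
  shows "block_averages (PiE {..<m} C) (\<lambda>k x. PiE {..<m} (\<lambda>i. B i (k i) (x i))) m K"
proof
  let ?X = "PiE {..<m} C" and ?b = "\<lambda>k x. PiE {..<m} (\<lambda>i. B i (k i) (x i))"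
  show "finite ?X" using fin by (intro finite_PiE) auto
  show "1 \<le> K" by (rule K)
  fix x z k l
  assume x: "x \<in> ?X"
  have xi: "x i \<in> C i" if "i < m" for i using x that by auto
  show "?b k x \<subseteq> ?X" using sub xi by (intro PiE_mono) auto
  show "x \<in> ?b k x" using x self xi by (auto simp: PiE_iff)
  show "?b k y = ?b k x" if "y \<in> ?b k x" for y
    using that eq xi by (intro PiE_cong) (auto simp: PiE_iff)
  show "?b k x = {x}" if "\<And>i. i < m \<Longrightarrow> k i = 0"
  proof -
    have "?b k x = PiE {..<m} (\<lambda>i. {x i})" using that zero xi by (intro PiE_cong) simp
    also have "\<dots> = {x}" using x by (intro PiE_singleton) (auto simp: PiE_iff)
    finally show ?thesis .
  qed
  show "?b k x \<subseteq> ?b l x" if "\<And>i. i < m \<Longrightarrow> k i \<le> l i"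
    using that mono xi by (intro PiE_mono) auto
  show "real (card (?b (k(i := Suc (k i))) x)) \<le> K * real (card (?b k x))" for i
  proof (cases "i < m")
    case True
    let ?r = "\<Prod>j\<in>{..<m} - {i}. real (card (B j (k j) (x j)))"
    have "real (card (?b (k(i := Suc (k i))) x)) = real (card (B i (Suc (k i)) (x i))) * ?r"
      using True by (simp add: card_PiE prod.remove[of "{..<m}" i])
    also have "\<dots> \<le> (K * real (card (B i (k i) (x i)))) * ?r"
      using reg[OF True xi[OF True]] by (intro mult_right_mono prod_nonneg) auto
    also have "\<dots> = K * real (card (?b k x))"
      using True by (simp add: card_PiE prod.remove[of "{..<m}" i])
    finally show ?thesis .
  next
    case False
    then have "?b (k(i := Suc (k i))) x = ?b k x" by (intro PiE_cong) auto
    then show ?thesis using K by (simp add: mult_le_cancel_right1)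
  qed
  show "card (?b k x \<inter> ?b l z) * card (?b (\<lambda>i. max (k i) (l i)) x) = card (?b k x) * card (?b l z)"
    if zx: "z \<in> ?b (\<lambda>i. max (k i) (l i)) x"
  proof -
    have zi: "z i \<in> C i" if "i < m" for i 
      using subsetD[OF sub[OF that xi[OF that]], of "z i" "max (k i) (l i)"] zx that
      by (auto simp: PiE_iff)
    have "card (B i (k i) (x i) \<inter> B i (l i) (z i)) * card (B i (max (k i) (l i)) (x i))
      = card (B i (k i) (x i)) * card (B i (l i) (z i))" if i: "i < m" for i
    proof -
      have zi': "z i \<in> B i (max (k i) (l i)) (x i)" using zx i by (auto simp: PiE_iff)
      show ?thesis
      proof (cases "k i \<le> l i")
        case True
        then have "B i (l i) (z i) = B i (l i) (x i)" using eq[OF i xi[OF i]] zi' by (simp add: max_def)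
        moreover have "B i (k i) (x i) \<subseteq> B i (l i) (x i)" by (rule mono[OF i xi[OF i] True])
        ultimately show ?thesis using True by (simp add: max_def Int_absorb2)
      next
        case False
        then have "B i (k i) (z i) = B i (k i) (x i)" using eq[OF i xi[OF i]] zi' by (simp add: max_def)
        moreover have "B i (l i) (z i) \<subseteq> B i (k i) (z i)" using False by (intro mono[OF i zi[OF i]]) simp
        ultimately show ?thesis using False by (simp add: max_def Int_absorb1)
      qed
    qed
    then show ?thesis unfolding PiE_Int_PiE by (simp add: card_PiE prod.distrib[symmetric])
  qed
  assume z: "z \<in> ?X"
  have zi: "z i \<in> C i" if "i < m" for i using z that by auto
  show "z \<in> ?b (\<lambda>i. max (k i) (l i)) x" if ne: "?b k x \<inter> ?b l z \<noteq> {}"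
  proof -
    obtain w where w: "w \<in> ?b k x" "w \<in> ?b l z" using ne by blast
    have "z i \<in> B i (max (k i) (l i)) (x i)" if i: "i < m" for i
    proof -
      have "w i \<in> B i (max (k i) (l i)) (x i)" "w i \<in> B i (max (k i) (l i)) (z i)"
        using w i mono[OF i xi[OF i], of "k i" "max (k i) (l i)"] mono[OF i zi[OF i], of "l i" "max (k i) (l i)"]
        by (auto simp: PiE_iff)
      then have "B i (max (k i) (l i)) (x i) = B i (max (k i) (l i)) (z i)"
        using eq[OF i xi[OF i]] eq[OF i zi[OF i]] by metis
      then show ?thesis using self[OF i zi[OF i]] by simp
    qed
    then show ?thesis using z by (auto simp: PiE_iff)
  qed
qed

subsection \<open>Dyadic cubes\<close>

lemma is_cube_nonempty: "is_cube k l Q \<Longrightarrow> 0 < l \<Longrightarrow> Q \<noteq> {}"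
  by (auto simp: is_cube_def PiE_eq_empty_iff)

lemma is_cube_sets: "is_cube k l Q \<Longrightarrow> Q \<in> sets (\<Pi>\<^sub>M j\<in>{..<k}. lborel)"
  unfolding is_cube_def by (auto intro!: sets_PiM_I_finite)

lemma is_cube_emeasure:
  assumes "is_cube k l Q" "0 \<le> l"
  shows "emeasure (\<Pi>\<^sub>M j\<in>{..<k}. lborel) Q = ennreal (l ^ k)"
proof -
  interpret product_sigma_finite "\<lambda>_ :: nat. lborel :: real measure" ..
  obtain a where "Q = (\<Pi>\<^sub>E j\<in>{..<k}. {a j..<a j + l})" using assms(1) by (auto simp: is_cube_def)
  then show ?thesis using assms(2) by (simp add: emeasure_PiM ennreal_power)
qed

lemma is_cube_subset:
  assumes "is_cube k l Q" "is_cube k l' R" "0 < l" "1 \<le> k" "Q \<subseteq> R"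
  shows "l \<le> l'" "l = l' \<Longrightarrow> Q = R"
proof -
  obtain a b where Q: "Q = (\<Pi>\<^sub>E j\<in>{..<k}. {a j..<a j + l})" and R: "R = (\<Pi>\<^sub>E j\<in>{..<k}. {b j..<b j + l'})"
    using assms by (auto simp: is_cube_def)
  have "Q \<noteq> {}" using assms is_cube_nonempty by blast
  then have le: "b j \<le> a j" "a j + l \<le> b j + l'" if "j < k" for j
    using assms(3,5) that by (auto simp: Q R subset_PiE atLeastLessThan_subset_iff)
  show "l \<le> l'" using le[of 0] assms(4) by simp
  show "Q = R" if "l = l'"
  proof -
    have "a j = b j" if "j < k" for j using le[OF that] \<open>l = l'\<close> by simp
    then show ?thesis unfolding Q R \<open>l = l'\<close> by (intro PiE_cong) auto
  qed
qed

locale cube_grid =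
  fixes n :: nat and D :: "vec set set"
  assumes grid: "dyadic_grid n D" and n: "1 \<le> n"
begin

definition cubes :: "int \<Rightarrow> vec set set" where
  "cubes s = {Q\<in>D. is_cube n (2 powi s) Q}"

lemma cubes_D: "Q \<in> cubes s \<Longrightarrow> Q \<in> D" and cubes_is_cube: "Q \<in> cubes s \<Longrightarrow> is_cube n (2 powi s) Q"
  by (auto simp: cubes_def)

lemma D_cubes: "Q \<in> D \<Longrightarrow> \<exists>s. Q \<in> cubes s"
  using grid by (auto simp: dyadic_grid_def cubes_def)

lemma cubes_partition: "partition_on (euc n) (cubes s)"
  using grid by (auto simp: dyadic_grid_def cubes_def)

lemma cubes_nonempty: "Q \<in> cubes s \<Longrightarrow> Q \<noteq> {}"
  using is_cube_nonempty[OF cubes_is_cube] by simp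

lemma cubes_euc: "Q \<in> cubes s \<Longrightarrow> Q \<subseteq> euc n"
  using partition_onD1[OF cubes_partition] by blast

lemma cubes_eq: "Q \<in> cubes s \<Longrightarrow> R \<in> cubes s \<Longrightarrow> Q \<inter> R \<noteq> {} \<Longrightarrow> Q = R"
  using partition_onD2[OF cubes_partition] by (meson disjointD)

lemma cubes_subset_scale:
  assumes "Q \<in> cubes s" "R \<in> cubes t" "Q \<subseteq> R"
  shows "s \<le> t"
proof -
  have "(2::real) powi s \<le> 2 powi t"
    using assms n by (intro is_cube_subset[OF cubes_is_cube cubes_is_cube]) auto
  then show ?thesis using power_int_strict_increasing[of t s "2::real"] by force
qed

lemma scale_unique: "Q \<in> cubes s \<Longrightarrow> Q \<in> cubes t \<Longrightarrow> s = t"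
  using cubes_subset_scale[of Q s Q t] cubes_subset_scale[of Q t Q s] by simp

lemma cubes_nested:
  assumes Q: "Q \<in> cubes s" and R: "R \<in> cubes t" and st: "s \<le> t" and "Q \<inter> R \<noteq> {}"
  shows "Q \<subseteq> R"
proof -
  have "Q \<subseteq> R \<or> R \<subseteq> Q" using grid assms cubes_D unfolding dyadic_grid_def by blast
  moreover have "R = Q" if "R \<subseteq> Q"
  proof -
    have "t = s" using cubes_subset_scale[OF R Q that] st by simp
    then show ?thesis using cubes_eq[of R t Q] Q R assms(4) by (auto simp: Int_commute)
  qed
  ultimately show ?thesis by blast
qed

text \<open>Chosen by meeting Q rather than containing it, so that a choice exists for every t. For
  t at least the scale of Q it is the unique cube of that scale containing Q.\<close>

definition ancestor :: "int \<Rightarrow> vec set \<Rightarrow> vec set" where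
  "ancestor t Q = (SOME R. R \<in> cubes t \<and> Q \<inter> R \<noteq> {})"

lemma ancestor_ex:
  assumes "Q \<in> cubes s"
  shows "\<exists>R. R \<in> cubes t \<and> Q \<inter> R \<noteq> {}"
proof -
  obtain x where "x \<in> Q" using cubes_nonempty[OF assms] by blast
  moreover then obtain R where "R \<in> cubes t" "x \<in> R"
    using cubes_euc[OF assms] partition_onD1[OF cubes_partition[of t]] by blast
  ultimately show ?thesis by blast
qed

lemma ancestor_cubes: "Q \<in> cubes s \<Longrightarrow> ancestor t Q \<in> cubes t"
  using someI_ex[OF ancestor_ex] by (simp add: ancestor_def)

lemma ancestor_Int: "Q \<in> cubes s \<Longrightarrow> Q \<inter> ancestor t Q \<noteq> {}"
  using someI_ex[OF ancestor_ex] unfolding ancestor_def by blast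

lemma ancestor_subset: "Q \<in> cubes s \<Longrightarrow> s \<le> t \<Longrightarrow> Q \<subseteq> ancestor t Q"
  using cubes_nested[OF _ ancestor_cubes _ ancestor_Int] by blast

lemma ancestor_unique:
  assumes "Q \<in> cubes s" "s \<le> t" "R \<in> cubes t" "Q \<subseteq> R"
  shows "ancestor t Q = R"
proof (rule cubes_eq[OF ancestor_cubes[OF assms(1)] assms(3)])
  show "ancestor t Q \<inter> R \<noteq> {}" using ancestor_subset[OF assms(1,2)] assms(4) cubes_nonempty[OF assms(1)] by blast
qed

definition sub :: "int \<Rightarrow> vec set \<Rightarrow> vec set set" where
  "sub a R = {Q \<in> cubes a. Q \<subseteq> R}"

lemma sub_Union:
  assumes R: "R \<in> cubes t" and at: "a \<le> t"
  shows "\<Union>(sub a R) = R"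
proof -
  have "x \<in> \<Union>(sub a R)" if x: "x \<in> R" for x
  proof -
    obtain Q where Q: "Q \<in> cubes a" "x \<in> Q"
      using cubes_euc[OF R] x partition_onD1[OF cubes_partition[of a]] by blast
    then have "Q \<subseteq> R" using x by (intro cubes_nested[OF Q(1) R at]) auto
    then show ?thesis using Q by (auto simp: sub_def)
  qed
  then show ?thesis by (auto simp: sub_def)
qed

lemma emeasure_Union_cubes:
  assumes "S \<subseteq> cubes a" "finite S"
  shows "emeasure (\<Pi>\<^sub>M j\<in>{..<n}. lborel) (\<Union>S) = ennreal (real (card S) * (2 powi a) ^ n)"
proof -
  have "emeasure (\<Pi>\<^sub>M j\<in>{..<n}. lborel) (\<Union>(id ` S)) = (\<Sum>Q\<in>S. emeasure (\<Pi>\<^sub>M j\<in>{..<n}. lborel) (id Q))"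
  proof (rule sum_emeasure[symmetric])
    show "id ` S \<subseteq> sets (\<Pi>\<^sub>M j\<in>{..<n}. lborel)" using assms(1) cubes_is_cube is_cube_sets by auto
    show "disjoint_family_on id S" using assms(1) cubes_eq by (fastforce simp: disjoint_family_on_def)
  qed fact
  also have "\<dots> = (\<Sum>Q\<in>S. ennreal ((2 powi a) ^ n))"
    using assms(1) by (intro sum.cong refl) (auto intro!: is_cube_emeasure cubes_is_cube)
  also have "\<dots> = ennreal (real (card S) * (2 powi a) ^ n)"
    by (simp add: ennreal_mult ennreal_of_nat_eq_real_of_nat)
  finally show ?thesis by simp
qed

text \<open>Both claims come from volumes: finitely many cubes of scale a inside R are disjoint, so
  their total volume is at most that of R.\<close>

lemma sub_card:
  assumes R: "R \<in> cubes t" and at: "a \<le> t"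
  shows "finite (sub a R)" "real (card (sub a R)) * (2 powi a) ^ n = (2 powi t) ^ n"
proof -
  have eR: "emeasure (\<Pi>\<^sub>M j\<in>{..<n}. lborel) R = ennreal ((2 powi t) ^ n)"
    by (rule is_cube_emeasure[OF cubes_is_cube[OF R]]) simp
  have sub: "sub a R \<subseteq> cubes a" by (auto simp: sub_def)
  have "finite (sub a R) \<and> card (sub a R) \<le> nat \<lfloor>(2 powi t) ^ n / (2 powi a) ^ n :: real\<rfloor>"
  proof (rule finite_if_finite_subsets_card_bdd)
    fix S assume S: "S \<subseteq> sub a R" "finite S"
    have "emeasure (\<Pi>\<^sub>M j\<in>{..<n}. lborel) (\<Union>S) \<le> emeasure (\<Pi>\<^sub>M j\<in>{..<n}. lborel) R"
      using S(1) is_cube_sets[OF cubes_is_cube[OF R]] by (intro emeasure_mono) (auto simp: sub_def)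
    then have "real (card S) * (2 powi a) ^ n \<le> (2 powi t) ^ n"
      unfolding eR emeasure_Union_cubes[OF order_trans[OF S(1) sub] S(2)] by simp
    then have "real (card S) \<le> (2 powi t) ^ n / (2 powi a) ^ n" by (simp add: pos_le_divide_eq)
    then show "card S \<le> nat \<lfloor>(2 powi t) ^ n / (2 powi a) ^ n :: real\<rfloor>" by (simp add: le_nat_floor)
  qed
  then show fin: "finite (sub a R)" ..
  show "real (card (sub a R)) * (2 powi a) ^ n = (2 powi t) ^ n"
    using emeasure_Union_cubes[OF sub fin] unfolding sub_Union[OF R at] eR by simp
qed

text \<open>The cap at L keeps blocks of every level inside the top cubes of scale a + L, so that
  finitely many cells suffice.\<close>

definition blk :: "int \<Rightarrow> nat \<Rightarrow> nat \<Rightarrow> vec set \<Rightarrow> vec set set" where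
  "blk a L k Q = sub a (ancestor (a + int (min k L)) Q)"

lemma blk_eq:
  assumes Q: "Q \<in> cubes a" and R: "R \<in> cubes (a + int k)" and QR: "Q \<subseteq> R" and k: "k \<le> L"
  shows "blk a L k Q = sub a R"
  unfolding blk_def using ancestor_unique[OF Q _ R QR] k by simp

lemma blk_props:
  assumes Q: "Q \<in> cubes a"
  shows "Q \<in> blk a L k Q" "Q' \<in> blk a L k Q \<Longrightarrow> blk a L k Q' = blk a L k Q" "blk a L 0 Q = {Q}"
    "k \<le> l \<Longrightarrow> blk a L k Q \<subseteq> blk a L l Q"
    "real (card (blk a L (Suc k) Q)) \<le> 2 ^ n * real (card (blk a L k Q))"
    "T \<in> cubes (a + int L) \<Longrightarrow> Q \<subseteq> T \<Longrightarrow> blk a L k Q \<subseteq> sub a T"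
proof -
  have anc: "ancestor (a + int k) Q \<in> cubes (a + int k)" for k by (rule ancestor_cubes[OF Q])
  have sup: "Q \<subseteq> ancestor (a + int k) Q" for k by (rule ancestor_subset[OF Q]) simp
  have nest: "ancestor (a + int k) Q \<subseteq> T" if "T \<in> cubes (a + int l)" "Q \<subseteq> T" "k \<le> l" for k l T
    using that sup[of k] cubes_nonempty[OF Q] by (intro cubes_nested[OF anc that(1)]) auto
  show "Q \<in> blk a L k Q" using Q sup by (simp add: blk_def sub_def)
  show "blk a L k Q' = blk a L k Q" if "Q' \<in> blk a L k Q"
    using that ancestor_unique[OF _ _ anc, of Q' a "min k L"] by (simp add: blk_def sub_def)
  have "R = Q" if "R \<in> cubes a" "R \<subseteq> ancestor a Q" for R
    using cubes_eq[OF that(1) ancestor_cubes[OF Q, of a]] cubes_eq[OF Q ancestor_cubes[OF Q, of a]]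
      cubes_nonempty[OF that(1)] ancestor_Int[OF Q, of a] that(2) by auto
  then show "blk a L 0 Q = {Q}" using Q ancestor_subset[OF Q, of a] by (auto simp: blk_def sub_def)
  show "blk a L k Q \<subseteq> blk a L l Q" if "k \<le> l"
  proof -
    have "ancestor (a + int (min k L)) Q \<subseteq> ancestor (a + int (min l L)) Q"
      by (rule nest[OF anc sup]) (use that in simp)
    then show ?thesis by (auto simp: blk_def sub_def)
  qed
  show "blk a L k Q \<subseteq> sub a T" if "T \<in> cubes (a + int L)" "Q \<subseteq> T"
  proof -
    have "ancestor (a + int (min k L)) Q \<subseteq> T" by (rule nest[OF that]) simp
    then show ?thesis by (auto simp: blk_def sub_def)
  qed
  show "real (card (blk a L (Suc k) Q)) \<le> 2 ^ n * real (card (blk a L k Q))"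
  proof (cases "k < L")
    case True
    have "real (card (blk a L k Q)) * (2 powi a) ^ n = (2 powi (a + int k)) ^ n"
      using sub_card(2)[OF anc[of k], of a] True by (simp add: blk_def)
    moreover have "real (card (blk a L (Suc k) Q)) * (2 powi a) ^ n = (2 powi (a + int (Suc k))) ^ n"
      using sub_card(2)[OF anc[of "Suc k"], of a] True by (simp add: blk_def)
    moreover have "((2::real) powi (a + int (Suc k))) ^ n = 2 ^ n * (2 powi (a + int k)) ^ n"
    proof -
      have "(2::real) powi (a + int (Suc k)) = 2 * 2 powi (a + int k)"
        by (simp add: power_int_add)
      then show ?thesis by (simp add: power_mult_distrib)
    qed
    ultimately have "real (card (blk a L (Suc k) Q)) * (2 powi a) ^ n = (2 ^ n * real (card (blk a L k Q))) * (2 powi a) ^ n"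
      by simp
    then show ?thesis by (subst (asm) mult_cancel_right) auto
  next
    case False
    then have "blk a L (Suc k) Q = blk a L k Q" by (simp add: blk_def)
    then show ?thesis by (simp add: mult_le_cancel_right1)
  qed
qed

end

subsection \<open>Transfer to Lebesgue measure\<close>

lemma ennreal_powr_ennreal: "0 \<le> t \<Longrightarrow> ennreal_powr (ennreal t) a = ennreal (t powr a)"
  by (simp add: ennreal_powr_def)

lemma ennreal_powr_mono: "0 \<le> a \<Longrightarrow> s \<le> t \<Longrightarrow> ennreal_powr s a \<le> ennreal_powr t a"
  by (auto simp: ennreal_powr_def top.not_eq_extremum enn2real_mono top_unique intro!: ennreal_leI powr_mono2)

lemma powr_tangent:
  fixes t a p :: real
  assumes "1 < p" "0 \<le> t" "0 \<le> a"
  shows "p * a powr (p - 1) * t \<le> t powr p + (p - 1) * a powr p"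
proof -
  have "t * a powr (p - 1) \<le> t powr p / p + a powr p / (p / (p - 1))"
  proof -
    have "t * a powr (p - 1) \<le> t powr p / p + (a powr (p - 1)) powr (p / (p - 1)) / (p / (p - 1))"
      using assms by (intro Youngs_inequality) (auto simp: field_simps)
    also have "(a powr (p - 1)) powr (p / (p - 1)) = a powr p" unfolding powr_powr using assms by simp
    finally show ?thesis .
  qed
  then have "p * (t * a powr (p - 1)) \<le> p * (t powr p / p + a powr p / (p / (p - 1)))"
    using assms by (intro mult_left_mono) auto
  also have "\<dots> = t powr p + (p - 1) * a powr p" using assms by (simp add: field_simps)
  finally show ?thesis by (simp add: mult_ac)
qed

text \<open>Integrates the tangent line of t^p at the mean g. Its negative constant term is carried
  on the other side and cancelled at the end, \<open>d * w\<close> being finite.\<close>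

lemma nn_integral_jensen_powr:
  fixes u :: "'a \<Rightarrow> real"
  assumes p: "1 < p" and S: "S \<in> sets M" "emeasure M S = ennreal w" and w: "0 < w" and g: "0 \<le> g"
    and u: "u \<in> borel_measurable M" "\<And>y. 0 \<le> u y" and eq: "(\<integral>\<^sup>+y\<in>S. ennreal (u y) \<partial>M) = ennreal (w * g)"
  shows "ennreal (w * g powr p) \<le> (\<integral>\<^sup>+y\<in>S. ennreal (u y powr p) \<partial>M)"
proof -
  define c where "c = p * g powr (p - 1)"
  define d where "d = (p - 1) * g powr p"
  have c: "0 \<le> c" and d: "0 \<le> d" using p by (simp_all add: c_def d_def)
  have "ennreal (c * (w * g)) = ennreal c * (\<integral>\<^sup>+y\<in>S. ennreal (u y) \<partial>M)"
    unfolding eq using c w g by (simp add: ennreal_mult)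
  also have "\<dots> = (\<integral>\<^sup>+y. ennreal (c * u y) * indicator S y \<partial>M)"
    using c u S by (subst nn_integral_cmult[symmetric]) (auto simp: ennreal_mult mult.assoc)
  also have "\<dots> \<le> (\<integral>\<^sup>+y. (ennreal (u y powr p) + ennreal d) * indicator S y \<partial>M)"
  proof (intro nn_integral_mono mult_right_mono)
    fix y
    have "c * u y \<le> u y powr p + d" unfolding c_def d_def by (rule powr_tangent[OF p u(2) g])
    then show "ennreal (c * u y) \<le> ennreal (u y powr p) + ennreal d"
      using d by (simp add: ennreal_plus[symmetric] del: ennreal_plus)
  qed simp
  also have "\<dots> = (\<integral>\<^sup>+y\<in>S. ennreal (u y powr p) \<partial>M) + ennreal (d * w)"
    using S u d w by (simp add: distrib_right nn_integral_add nn_integral_cmult ennreal_mult)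
  finally have "ennreal (c * (w * g)) \<le> (\<integral>\<^sup>+y\<in>S. ennreal (u y powr p) \<partial>M) + ennreal (d * w)" .
  moreover have "c * (w * g) = w * g powr p + d * w"
  proof -
    have "g powr (p - 1) * g = g powr p" using g p by (cases "g = 0") (simp_all add: powr_diff)
    then have "c * (w * g) = p * w * g powr p" by (simp add: c_def)
    then show ?thesis by (simp add: d_def algebra_simps)
  qed
  ultimately have "ennreal (w * g powr p) + ennreal (d * w) \<le> (\<integral>\<^sup>+y\<in>S. ennreal (u y powr p) \<partial>M) + ennreal (d * w)"
    using w d by (simp add: ennreal_plus)
  then show ?thesis by (simp add: ennreal_add_left_cancel_le add.commute)
qed

text \<open>Members of F are unions of cells of equal measure, so their averages of |f| are plain
  means of the cell averages \<open>g\<close>, and the maximal function is constant on each cell.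
  Jensen's inequality on the cells compares the p-th powers of \<open>g\<close> with the integral of
  |f|^p.\<close>

lemma maximal_transfer:
  fixes M :: "'a measure" and f :: "'a \<Rightarrow> real" and cell :: "'x \<Rightarrow> 'a set" and R :: "'a set \<Rightarrow> 'x set"
  assumes X: "finite X" and F: "finite F" and w: "0 < w" and A: "0 \<le> A" and p: "1 < p"
    and cell_sets: "\<And>x. x \<in> X \<Longrightarrow> cell x \<in> sets M"
    and cell_measure: "\<And>x. x \<in> X \<Longrightarrow> emeasure M (cell x) = ennreal w"
    and disj: "disjoint_family_on cell X"
    and R: "\<And>I. I \<in> F \<Longrightarrow> R I \<subseteq> X" "\<And>I. I \<in> F \<Longrightarrow> R I \<noteq> {}" "\<And>I. I \<in> F \<Longrightarrow> I = (\<Union>x\<in>R I. cell x)"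
    and bound: "\<And>g h :: 'x \<Rightarrow> real. (\<And>x. x \<in> X \<Longrightarrow> 0 \<le> g x) \<Longrightarrow> (\<And>x. x \<in> X \<Longrightarrow> 0 \<le> h x) \<Longrightarrow>
       (\<And>x. x \<in> X \<Longrightarrow> h x = 0 \<or> (\<exists>I\<in>F. x \<in> R I \<and> h x \<le> (\<Sum>y\<in>R I. g y) / real (card (R I)))) \<Longrightarrow>
       (\<Sum>x\<in>X. h x powr p) \<le> A * (\<Sum>x\<in>X. g x powr p)"
    and f: "f \<in> borel_measurable M" "(\<integral>\<^sup>+x. ennreal (\<bar>f x\<bar> powr p) \<partial>M) < \<infinity>"
  shows "(\<integral>\<^sup>+x. ennreal_powr (maximal_fun M F f x) p \<partial>M) \<le> ennreal A * (\<integral>\<^sup>+x. ennreal (\<bar>f x\<bar> powr p) \<partial>M)"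
proof -
  define J where "J x = (\<integral>\<^sup>+y\<in>cell x. ennreal \<bar>f y\<bar> \<partial>M)" for x
  define g where "g x = enn2real (J x) / w" for x
  have g0: "0 \<le> g x" for x using w by (simp add: g_def)
  have Jg: "J x = ennreal (w * g x)" if x: "x \<in> X" for x
  proof -
    \<comment> \<open>Integrability of f on a cell of finite measure, from |f| <= 1 + |f|^p.\<close>
    have "J x \<le> (\<integral>\<^sup>+y. indicator (cell x) y + ennreal (\<bar>f y\<bar> powr p) \<partial>M)"
      unfolding J_def
    proof (intro nn_integral_mono)
      fix y
      have "\<bar>f y\<bar> \<le> 1 + \<bar>f y\<bar> powr p"
      proof (cases "\<bar>f y\<bar> \<le> 1")
        case False
        then have "\<bar>f y\<bar> powr 1 \<le> \<bar>f y\<bar> powr p" using p by (intro powr_mono) auto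
        then show ?thesis using False by simp
      qed (simp add: add_increasing2)
      then have "ennreal \<bar>f y\<bar> \<le> 1 + ennreal (\<bar>f y\<bar> powr p)"
        by (metis ennreal_1 ennreal_leI ennreal_plus powr_ge_zero zero_le_one)
      then show "ennreal \<bar>f y\<bar> * indicator (cell x) y \<le> indicator (cell x) y + ennreal (\<bar>f y\<bar> powr p)"
        by (simp add: indicator_def)
    qed
    also have "\<dots> = ennreal w + (\<integral>\<^sup>+y. ennreal (\<bar>f y\<bar> powr p) \<partial>M)"
      using cell_sets[OF x] cell_measure[OF x] f(1) by (subst nn_integral_add) auto
    also have "\<dots> < \<infinity>" using f(2) by simp
    finally show ?thesis using w by (simp add: g_def)
  qed
  have jensen: "ennreal (w * g x powr p) \<le> (\<integral>\<^sup>+y\<in>cell x. ennreal (\<bar>f y\<bar> powr p) \<partial>M)" if x: "x \<in> X" for x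
    using Jg[OF x] unfolding J_def
    by (intro nn_integral_jensen_powr[OF p cell_sets[OF x] cell_measure[OF x] w g0]) (use f in auto)
  have split: "(\<Sum>x\<in>S. indicator (cell x) y) = (indicator (\<Union>x\<in>S. cell x) y :: ennreal)" if "S \<subseteq> X" for S y
    by (intro indicator_UN_disjoint[symmetric] finite_subset[OF that X] disjoint_family_on_mono[OF that disj])
  have int_split: "(\<integral>\<^sup>+y\<in>(\<Union>x\<in>S. cell x). u y \<partial>M) = (\<Sum>x\<in>S. \<integral>\<^sup>+y\<in>cell x. u y \<partial>M)"
    if S: "S \<subseteq> X" and u: "u \<in> borel_measurable M" for S and u :: "'a \<Rightarrow> ennreal"
  proof -
    have "(\<integral>\<^sup>+y\<in>(\<Union>x\<in>S. cell x). u y \<partial>M) = (\<integral>\<^sup>+y. (\<Sum>x\<in>S. u y * indicator (cell x) y) \<partial>M)"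
      unfolding split[OF S, symmetric] sum_distrib_left ..
    also have "\<dots> = (\<Sum>x\<in>S. \<integral>\<^sup>+y\<in>cell x. u y \<partial>M)"
      using S u cell_sets by (intro nn_integral_sum) auto
    finally show ?thesis .
  qed
  define av where "av I = (\<Sum>y\<in>R I. g y) / real (card (R I))" for I
  have avg: "(\<integral>\<^sup>+y\<in>I. ennreal \<bar>f y\<bar> \<partial>M) / emeasure M I = ennreal (av I)" if I: "I \<in> F" for I
  proof -
    have fin: "finite (R I)" using R(1)[OF I] X finite_subset by blast
    have c: "0 < real (card (R I))" using fin R(2)[OF I] by (simp add: card_gt_0_iff)
    have "(\<integral>\<^sup>+y\<in>I. ennreal \<bar>f y\<bar> \<partial>M) = (\<Sum>x\<in>R I. J x)"
      unfolding J_def by (subst R(3)[OF I], rule int_split[OF R(1)[OF I]]) (use f in auto)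
    also have "\<dots> = (\<Sum>x\<in>R I. ennreal (w * g x))" using R(1)[OF I] Jg by (intro sum.cong) auto
    also have "\<dots> = ennreal (w * (\<Sum>x\<in>R I. g x))"
      using w g0 by (simp add: sum_ennreal sum_distrib_left)
    finally have 1: "(\<integral>\<^sup>+y\<in>I. ennreal \<bar>f y\<bar> \<partial>M) = ennreal (w * (\<Sum>x\<in>R I. g x))" .
    have "(\<Union>x\<in>R I. cell x) \<in> sets M" using R(1)[OF I] fin cell_sets by (intro sets.finite_UN) auto
    then have "I \<in> sets M" by (subst R(3)[OF I])
    then have "emeasure M I = (\<integral>\<^sup>+y\<in>I. 1 \<partial>M)" by simp
    also have "\<dots> = (\<Sum>x\<in>R I. \<integral>\<^sup>+y\<in>cell x. 1 \<partial>M)" by (subst R(3)[OF I], rule int_split[OF R(1)[OF I]]) simp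
    also have "\<dots> = (\<Sum>x\<in>R I. ennreal w)"
      using R(1)[OF I] cell_sets cell_measure by (intro sum.cong) auto
    also have "\<dots> = ennreal (real (card (R I)) * w)"
      using w by (simp add: ennreal_mult ennreal_of_nat_eq_real_of_nat)
    finally have 2: "emeasure M I = ennreal (real (card (R I)) * w)" .
    show ?thesis unfolding 1 2 av_def using w c g0 by (subst divide_ennreal) (auto simp: sum_nonneg)
  qed
  define h where "h x = Max (insert 0 (av ` {I\<in>F. x \<in> R I}))" for x
  have hfin: "finite (insert 0 (av ` {I\<in>F. x \<in> R I}))" for x using F by simp
  have h0: "0 \<le> h x" for x unfolding h_def using hfin by (intro Max_ge) auto
  have hle: "av I \<le> h x" if "I \<in> F" "x \<in> R I" for I x unfolding h_def using hfin that by (intro Max_ge) auto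
  have h: "(\<Sum>x\<in>X. h x powr p) \<le> A * (\<Sum>x\<in>X. g x powr p)"
  proof (rule bound)
    fix x assume "x \<in> X"
    have "h x \<in> insert 0 (av ` {I\<in>F. x \<in> R I})" unfolding h_def using hfin by (intro Max_in) auto
    then show "h x = 0 \<or> (\<exists>I\<in>F. x \<in> R I \<and> h x \<le> (\<Sum>y\<in>R I. g y) / real (card (R I)))"
      by (auto simp: av_def)
  qed (use g0 h0 in auto)
  have pt: "ennreal_powr (maximal_fun M F f y) p \<le> (\<Sum>x\<in>X. ennreal (h x powr p) * indicator (cell x) y)" for y
  proof (cases "\<exists>x\<in>X. y \<in> cell x")
    case True
    then obtain x where x: "x \<in> X" "y \<in> cell x" by blast
    have "maximal_fun M F f y \<le> ennreal (h x)"
      unfolding maximal_fun_def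
    proof (rule SUP_least)
      fix I assume "I \<in> {I\<in>F. y \<in> I}"
      then have I: "I \<in> F" "y \<in> I" by auto
      then obtain x' where x': "x' \<in> R I" "y \<in> cell x'" using R(3) by blast
      then have "x' = x" using disj R(1)[OF I(1)] x by (auto simp: disjoint_family_on_def)
      then show "(\<integral>\<^sup>+y\<in>I. ennreal \<bar>f y\<bar> \<partial>M) / emeasure M I \<le> ennreal (h x)"
        unfolding avg[OF I(1)] using hle[OF I(1)] x'(1) by (intro ennreal_leI) simp
    qed
    then have "ennreal_powr (maximal_fun M F f y) p \<le> ennreal_powr (ennreal (h x)) p"
      using p by (intro ennreal_powr_mono) auto
    also have "\<dots> = ennreal (h x powr p) * indicator (cell x) y"
      using h0 x by (simp add: ennreal_powr_ennreal)
    also have "\<dots> \<le> (\<Sum>x\<in>X. ennreal (h x powr p) * indicator (cell x) y)"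
      by (rule member_le_sum) (use x X in auto)
    finally show ?thesis .
  next
    case False
    have "{I\<in>F. y \<in> I} = {}" using False R(1,3) by blast
    then have "maximal_fun M F f y = 0" unfolding maximal_fun_def by (simp only: image_empty Sup_empty bot_ennreal)
    then show ?thesis by (simp add: ennreal_powr_def)
  qed
  have "(\<integral>\<^sup>+y. ennreal_powr (maximal_fun M F f y) p \<partial>M) \<le> (\<integral>\<^sup>+y. (\<Sum>x\<in>X. ennreal (h x powr p) * indicator (cell x) y) \<partial>M)"
    by (intro nn_integral_mono pt)
  also have "\<dots> = (\<Sum>x\<in>X. \<integral>\<^sup>+y. ennreal (h x powr p) * indicator (cell x) y \<partial>M)"
    by (intro nn_integral_sum) (use cell_sets in auto)
  also have "\<dots> = (\<Sum>x\<in>X. ennreal (h x powr p * w))"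
    using cell_sets cell_measure w by (intro sum.cong) (auto simp: nn_integral_cmult_indicator ennreal_mult)
  also have "\<dots> = ennreal ((\<Sum>x\<in>X. h x powr p) * w)"
    using w by (simp add: sum_ennreal sum_distrib_right)
  also have "\<dots> \<le> ennreal ((A * (\<Sum>x\<in>X. g x powr p)) * w)"
    using h w by (intro ennreal_leI mult_right_mono) auto
  also have "\<dots> = ennreal A * (\<Sum>x\<in>X. ennreal (w * g x powr p))"
    using w A by (simp add: sum_ennreal ennreal_mult[symmetric] sum_nonneg sum_distrib_left mult_ac)
  also have "\<dots> \<le> ennreal A * (\<Sum>x\<in>X. \<integral>\<^sup>+y\<in>cell x. ennreal (\<bar>f y\<bar> powr p) \<partial>M)"
    by (intro mult_left_mono sum_mono jensen) auto
  also have "\<dots> = ennreal A * (\<integral>\<^sup>+y\<in>(\<Union>x\<in>X. cell x). ennreal (\<bar>f y\<bar> powr p) \<partial>M)"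
    using f by (subst int_split) auto
  also have "\<dots> \<le> ennreal A * (\<integral>\<^sup>+y. ennreal (\<bar>f y\<bar> powr p) \<partial>M)"
    by (intro mult_left_mono nn_integral_mono) (auto simp: indicator_def)
  finally show ?thesis .
qed

lemma PiE_Union: "PiE I (\<lambda>i. \<Union>(S i)) = (\<Union>x\<in>PiE I S. PiE I x)"
proof (intro equalityI subsetI)
  fix z assume z: "z \<in> PiE I (\<lambda>i. \<Union>(S i))"
  define x where "x = (\<lambda>i\<in>I. SOME Q. Q \<in> S i \<and> z i \<in> Q)"
  have x: "x i \<in> S i \<and> z i \<in> x i" if "i \<in> I" for i
  proof -
    have "\<exists>Q. Q \<in> S i \<and> z i \<in> Q" using z that by (auto simp: PiE_iff)
    from someI_ex[OF this] show ?thesis using that by (simp add: x_def)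
  qed
  then have "x \<in> PiE I S" by (auto simp: PiE_iff x_def)
  moreover have "z \<in> PiE I x" using x z by (auto simp: PiE_iff)
  ultimately show "z \<in> (\<Union>x\<in>PiE I S. PiE I x)" by blast
qed (auto simp: PiE_iff)

lemma factor_PiE:
  assumes "\<And>j. j < m \<Longrightarrow> K j \<noteq> {}" "i < m"
  shows "factor i (PiE {..<m} K) = K i"
  unfolding factor_def image_projection_PiE using assms by (auto simp: PiE_eq_empty_iff)

lemma leb_rectangle:
  assumes K: "\<And>i. i < m \<Longrightarrow> K i \<in> sets (\<Pi>\<^sub>M j\<in>{..<n i}. lborel)"
  shows "PiE {..<m} K \<in> sets (leb m n)"
    and "emeasure (leb m n) (PiE {..<m} K) = (\<Prod>i<m. emeasure (\<Pi>\<^sub>M j\<in>{..<n i}. lborel) (K i))"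
proof -
  interpret L: product_sigma_finite "\<lambda>_ :: nat. lborel :: real measure" ..
  interpret P: product_sigma_finite "\<lambda>i. \<Pi>\<^sub>M j\<in>{..<n i}. lborel :: real measure"
    by (simp add: product_sigma_finite_def L.sigma_finite)
  have 1: "PiE {..<m} K \<in> sets (\<Pi>\<^sub>M i\<in>{..<m}. \<Pi>\<^sub>M j\<in>{..<n i}. lborel)"
    using K by (intro sets_PiM_I_finite) auto
  then show "PiE {..<m} K \<in> sets (leb m n)" unfolding leb_def by (rule sets_completionI_sets)
  show "emeasure (leb m n) (PiE {..<m} K) = (\<Prod>i<m. emeasure (\<Pi>\<^sub>M j\<in>{..<n i}. lborel) (K i))"
    
    unfolding leb_def emeasure_completion[OF sets_completionI_sets[OF 1]] main_part[OF 1]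
    using K by (intro P.emeasure_PiM) auto
qed

lemma finite_family_maximal:
  fixes f :: "point \<Rightarrow> real"
  assumes m: "1 \<le> m" and n: "\<And>i. i < m \<Longrightarrow> 1 \<le> n i" "(\<Sum>i<m. n i) = d"
    and grid: "\<And>i. i < m \<Longrightarrow> dyadic_grid (n i) (\<D> i)"
    and F: "F \<subseteq> dyadic_rectangles m \<D>" "finite F"
    and weak: "\<And>I J. I \<in> F \<Longrightarrow> J \<in> F \<Longrightarrow> I \<subseteq> J \<Longrightarrow> \<exists>i<m. factor i I = factor i J"
    and p: "1 < p" "p \<le> 2"
    and f: "f \<in> borel_measurable (leb m n)" "(\<integral>\<^sup>+x. ennreal (\<bar>f x\<bar> powr p) \<partial>leb m n) < \<infinity>"
  shows "(\<integral>\<^sup>+x. ennreal_powr (maximal_fun (leb m n) F f x) p \<partial>leb m n)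
    \<le> ennreal (rect_const m (2 ^ d) * (p / (p - 1)) ^ (m - 1)) * (\<integral>\<^sup>+x. ennreal (\<bar>f x\<bar> powr p) \<partial>leb m n)"
proof -
  have cg: "cube_grid (n i) (\<D> i)" if "i < m" for i
    using grid[OF that] n(1)[OF that] by (simp add: cube_grid_def)
  define cub where "cub i = cube_grid.cubes (n i) (\<D> i)" for i
  define sb where "sb i = cube_grid.sub (n i) (\<D> i)" for i
  define anc where "anc i = cube_grid.ancestor (n i) (\<D> i)" for i
  have "\<forall>I\<in>F. \<exists>K. I = PiE {..<m} K \<and> (\<forall>i<m. K i \<in> \<D> i)"
    using F(1) by (auto simp: dyadic_rectangles_def)
  then obtain K where K: "\<And>I. I \<in> F \<Longrightarrow> I = PiE {..<m} (K I)" "\<And>I i. I \<in> F \<Longrightarrow> i < m \<Longrightarrow> K I i \<in> \<D> i"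
    by metis
  define sc where "sc I i = (SOME s. K I i \<in> cub i s)" for I i
  have sc: "K I i \<in> cub i (sc I i)" if "I \<in> F" "i < m" for I i
    unfolding sc_def cub_def by (rule someI_ex[OF cube_grid.D_cubes[OF cg[OF that(2)] K(2)[OF that]]])
  \<comment> \<open>Inserting 0 makes \<open>Min\<close> and \<open>Max\<close> meaningful for empty
    F; a spare scale only refines the cells or enlarges L.\<close>
  define S where "S = insert 0 ((\<lambda>(I, i). sc I i) ` (F \<times> {..<m}))"
  have S: "finite S" using F(2) by (simp add: S_def)
  define a where "a = Min S"
  define L where "L = nat (Max S - a)"
  define k where "k I i = (if i < m then nat (sc I i - a) else 0)" for I i
  have ksc: "sc I i = a + int (k I i)" "k I i \<le> L" if "I \<in> F" "i < m" for I i
  proof -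
    have "sc I i \<in> S" using that by (auto simp: S_def)
    then have "a \<le> sc I i" "sc I i \<le> Max S" using S by (simp_all add: a_def)
    then show "sc I i = a + int (k I i)" "k I i \<le> L" using that(2) by (simp_all add: k_def L_def)
  qed
  \<comment> \<open>All cells below the top ancestors are taken, not only those inside members, so
    that blocks of every level stay in the model.\<close>
  define C where "C i = (\<Union>I\<in>F. sb i a (anc i (a + int L) (K I i)))" for i
  have sbD: "Q \<in> cub i a" "Q \<subseteq> R" if "i < m" "Q \<in> sb i a R" for i Q R
    using that(2) unfolding sb_def cub_def by (simp_all add: cube_grid.sub_def[OF cg[OF that(1)]])
  have ancF: "anc i (a + int L) (K I i) \<in> cub i (a + int L)" "K I i \<subseteq> anc i (a + int L) (K I i)" if "I \<in> F" "i < m" for I i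
  proof -
    note Kc = sc[OF that, unfolded cub_def]
    show "anc i (a + int L) (K I i) \<in> cub i (a + int L)"
      unfolding anc_def cub_def by (rule cube_grid.ancestor_cubes[OF cg[OF that(2)] Kc])
    show "K I i \<subseteq> anc i (a + int L) (K I i)"
      unfolding anc_def by (rule cube_grid.ancestor_subset[OF cg[OF that(2)] Kc]) (use ksc[OF that] in simp)
  qed
  have Ccub: "c \<in> cub i a" if "i < m" "c \<in> C i" for i c using that sbD by (auto simp: C_def)
  define X where "X = PiE {..<m} C"
  define B where "B i = cube_grid.blk (n i) (\<D> i) a L" for i
  define b where "b k x = PiE {..<m} (\<lambda>i. B i (k i) (x i))" for k :: "nat \<Rightarrow> nat" and x
  have "block_averages (PiE {..<m} C) (\<lambda>k x. PiE {..<m} (\<lambda>i. B i (k i) (x i))) m (2 ^ d)"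
  proof (rule block_averages_PiE)
    show "(1::real) \<le> 2 ^ d" by (rule one_le_power) simp
    fix i assume i: "i < m"
    show "finite (C i)"
      unfolding C_def sb_def using F(2) cube_grid.sub_card(1)[OF cg[OF i] ancF(1)[OF _ i, unfolded cub_def]]
      by (intro finite_UN_I) auto
    fix c k assume c: "c \<in> C i"
    note props = cube_grid.blk_props[OF cg[OF i] Ccub[OF i c, unfolded cub_def], where L = L, folded B_def]
    show "B i k c \<subseteq> C i"
    proof -
      obtain I where I: "I \<in> F" "c \<in> sb i a (anc i (a + int L) (K I i))" using c by (auto simp: C_def)
      have "B i k c \<subseteq> sb i a (anc i (a + int L) (K I i))"
        unfolding sb_def
        by (rule props(6)[OF ancF(1)[OF I(1) i, unfolded cub_def] sbD(2)[OF i I(2)]])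
      then show ?thesis using I(1) by (auto simp: C_def)
    qed
    show "c \<in> B i k c" by (rule props(1))
    show "B i k c' = B i k c" if "c' \<in> B i k c" for c' by (rule props(2)[OF that])
    show "B i 0 c = {c}" by (rule props(3))
    show "B i k c \<subseteq> B i l c" if "k \<le> l" for l by (rule props(4)[OF that])
    \<comment> \<open>Passing from a block to its parent multiplies the number of cells by at most
      2^(n i); bounding this by 2^d leaves a constant that depends on d alone.\<close>
    have "n i \<le> d" using i member_le_sum[of i "{..<m}" n] n(2) by simp
    then have "(2::real) ^ n i \<le> 2 ^ d" by (intro power_increasing) auto
    then show "real (card (B i (Suc k) c)) \<le> 2 ^ d * real (card (B i k c))"
      using props(5) by (meson mult_right_mono of_nat_0_le_iff order_trans)
  qed
  then interpret block_averages X b m L "2 ^ d"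
    unfolding X_def b_def[abs_def] .
  define R where "R I = PiE {..<m} (\<lambda>i. sb i a (K I i))" for I
  have subU: "\<Union>(sb i a (K I i)) = K I i" if "I \<in> F" "i < m" for I i
    unfolding sb_def using ksc[OF that]
    by (intro cube_grid.sub_Union[OF cg[OF that(2)] sc[OF that, unfolded cub_def]]) simp
  have Kne: "K I i \<noteq> {}" if "I \<in> F" "i < m" for I i
    by (rule cube_grid.cubes_nonempty[OF cg[OF that(2)] sc[OF that, unfolded cub_def]])
  have fac: "factor i I = K I i" if "I \<in> F" "i < m" for I i
    by (subst K(1)[OF that(1)], rule factor_PiE[OF _ that(2)]) (rule Kne[OF that(1)])
  have RX: "R I \<subseteq> X" if "I \<in> F" for I
    unfolding R_def X_def
  proof (rule PiE_mono)
    fix i assume "i \<in> {..<m}"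
    then have i: "i < m" by simp
    have "sb i a (K I i) \<subseteq> sb i a (anc i (a + int L) (K I i))"
      using ancF(2)[OF that i] unfolding sb_def by (auto simp: cube_grid.sub_def[OF cg[OF i]])
    then show "sb i a (K I i) \<subseteq> C i" using that by (auto simp: C_def)
  qed
  have Rne: "R I \<noteq> {}" if "I \<in> F" for I
  proof -
    have "sb i a (K I i) \<noteq> {}" if "i < m" for i using subU[OF \<open>I \<in> F\<close> that] Kne[OF \<open>I \<in> F\<close> that] by auto
    then show ?thesis by (simp add: R_def PiE_eq_empty_iff)
  qed
  have IR: "I = (\<Union>x\<in>R I. PiE {..<m} x)" if "I \<in> F" for I
  proof -
    have "I = PiE {..<m} (\<lambda>i. \<Union>(sb i a (K I i)))"
      by (subst K(1)[OF that], rule PiE_cong) (use subU[OF that] in auto)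
    then show ?thesis by (simp add: PiE_Union R_def)
  qed
  define y where "y I = (SOME x. x \<in> R I)" for I
  have y: "y I \<in> R I" if "I \<in> F" for I unfolding y_def using Rne[OF that] by (simp add: some_in_eq)
  have bR: "b (k I) (y I) = R I" if "I \<in> F" for I
    unfolding b_def R_def
  proof (rule PiE_cong)
    fix i assume "i \<in> {..<m}"
    then have i: "i < m" by simp
    have yi: "y I i \<in> sb i a (K I i)" using y[OF that] i by (auto simp: R_def)
    show "B i (k I i) (y I i) = sb i a (K I i)"
      unfolding B_def sb_def
      using sbD[OF i yi] sc[OF that i] ksc[OF that i] unfolding cub_def
      by (intro cube_grid.blk_eq[OF cg[OF i]]) auto
  qed
  define w :: real where "w = (\<Prod>i<m. (2 powi a) ^ n i)"
  show ?thesis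
  proof (rule maximal_transfer[where X = X and cell = "PiE {..<m}" and R = R and w = w])
    show "finite X" by (rule fin)
    show "0 < w" by (simp add: w_def prod_pos)
    show "0 \<le> rect_const m (2 ^ d) * (p / (p - 1)) ^ (m - 1)"
      using rect_const_ge_1[of m "2 ^ d"] p by (intro mult_nonneg_nonneg) auto
    fix x assume x: "x \<in> X"
    have xc: "is_cube (n i) (2 powi a) (x i)" if "i < m" for i
      using x Ccub[OF that, of "x i"] cube_grid.cubes_is_cube[OF cg[OF that], of "x i" a] that
      by (auto simp: X_def cub_def)
    show "PiE {..<m} x \<in> sets (leb m n)" by (rule leb_rectangle(1)) (rule is_cube_sets[OF xc])
    have "emeasure (leb m n) (PiE {..<m} x) = (\<Prod>i<m. ennreal ((2 powi a) ^ n i))"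
      by (subst leb_rectangle(2)) (use is_cube_sets[OF xc] is_cube_emeasure[OF xc] in auto)
    also have "\<dots> = ennreal w" unfolding w_def by (rule prod_ennreal) simp
    finally show "emeasure (leb m n) (PiE {..<m} x) = ennreal w" .
  next
    show "disjoint_family_on (PiE {..<m}) X"
      unfolding disjoint_family_on_def
    proof (intro ballI impI, rule ccontr)
      fix x x' assume x: "x \<in> X" "x' \<in> X" and ne: "x \<noteq> x'" and "PiE {..<m} x \<inter> PiE {..<m} x' \<noteq> {}"
      then obtain z where z: "z \<in> PiE {..<m} x" "z \<in> PiE {..<m} x'" by blast
      have "x i = x' i" if i: "i < m" for i
      proof (rule cube_grid.cubes_eq[OF cg[OF i]])
        show "x i \<in> cube_grid.cubes (n i) (\<D> i) a" "x' i \<in> cube_grid.cubes (n i) (\<D> i) a"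
          using x Ccub[OF i] i by (auto simp: X_def cub_def)
        show "x i \<inter> x' i \<noteq> {}" using z i by (auto simp: PiE_iff)
      qed
      then have "x = x'" using x unfolding X_def by (intro PiE_ext[of x "{..<m}" C]) auto
      then show False using ne by simp
    qed
  next
    fix g h :: "(nat \<Rightarrow> vec set) \<Rightarrow> real"
    assume g: "\<And>x. x \<in> X \<Longrightarrow> 0 \<le> g x" and h: "\<And>x. x \<in> X \<Longrightarrow> 0 \<le> h x"
      "\<And>x. x \<in> X \<Longrightarrow> h x = 0 \<or> (\<exists>I\<in>F. x \<in> R I \<and> h x \<le> (\<Sum>y\<in>R I. g y) / real (card (R I)))"
    define G where "G = (\<lambda>I. (k I, y I)) ` F"
    show "(\<Sum>x\<in>X. h x powr p) \<le> rect_const m (2 ^ d) * (p / (p - 1)) ^ (m - 1) * (\<Sum>x\<in>X. g x powr p)"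
    proof (rule rect_max_bound[where G = G, OF _ _ _ m p g h(1)])
      show "k' \<in> levels m UNIV" if "(k', y') \<in> G" for k' y'
        using that ksc(2) by (auto simp: G_def levels_def k_def)
      show "y' \<in> X" if "(k', y') \<in> G" for k' y' using that y RX by (auto simp: G_def)
      show "\<not> b l z \<subseteq> b k' y'" if kG: "(k', y') \<in> G" and lG: "(l, z) \<in> G" and less: "\<And>i. i < m \<Longrightarrow> l i < k' i" for k' y' l z
      proof
        assume sub: "b l z \<subseteq> b k' y'"
        obtain I J where IJ: "I \<in> F" "J \<in> F" "k' = k I" "y' = y I" "l = k J" "z = y J" using kG lG by (auto simp: G_def)
        have "R J \<subseteq> R I" using sub IJ bR by simp
        then have "(\<Union>x\<in>R J. PiE {..<m} x) \<subseteq> (\<Union>x\<in>R I. PiE {..<m} x)" by (intro UN_mono) auto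
        then have "J \<subseteq> I" unfolding IR[OF IJ(1), symmetric] IR[OF IJ(2), symmetric] .
        then obtain i where i: "i < m" "factor i J = factor i I" using weak[OF IJ(2,1)] by blast
        \<comment> \<open>A common factor forces a common scale in coordinate i, which contradicts
          the strict inequality between the levels.\<close>
        have "factor i I = K I i" "factor i J = K J i" using fac i(1) IJ by blast+
        then have "K I i \<in> cub i (sc I i)" "K I i \<in> cub i (sc J i)"
          using sc[OF IJ(1) i(1)] sc[OF IJ(2) i(1)] i(2) by simp_all
        then have "sc I i = sc J i" unfolding cub_def by (rule cube_grid.scale_unique[OF cg[OF i(1)]])
        then show False using less[OF i(1)] ksc(1)[OF IJ(1) i(1)] ksc(1)[OF IJ(2) i(1)] IJ by simp
      qed
      fix x assume x: "x \<in> X"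
      show "h x = 0 \<or> (\<exists>(k, y)\<in>G. x \<in> b k y \<and> h x \<le> E k g x)"
      proof (cases "h x = 0")
        case False
        then obtain I where I: "I \<in> F" "x \<in> R I" "h x \<le> (\<Sum>y\<in>R I. g y) / real (card (R I))" using h(2)[OF x] by blast
        have "b (k I) x = R I" using b_eq[of "y I" x "k I"] y[OF I(1)] RX[OF I(1)] I(2) bR[OF I(1)] by auto
        then have "h x \<le> E (k I) g x" using I(3) x by (simp add: E_def)
        moreover have "x \<in> b (k I) (y I)" using I bR by simp
        moreover have "(k I, y I) \<in> G" using I(1) by (simp add: G_def)
        ultimately show ?thesis by blast
      qed simp
    qed
  qed (use F(2) p(1) f RX Rne IR in auto)
qed

subsection \<open>Countable and sparse families\<close>

lemma ennreal_powr_top: "ennreal_powr \<infinity> a = \<infinity>"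
  by (simp add: ennreal_powr_def)

lemma ennreal_powr_inverse: "0 < a \<Longrightarrow> ennreal_powr (ennreal_powr t a) (1 / a) = t"
  by (cases t) (simp_all add: ennreal_powr_ennreal powr_powr ennreal_powr_top[unfolded infinity_ennreal_def])

lemma ennreal_powr_mult:
  assumes "0 < c" "0 < a"
  shows "ennreal_powr (ennreal c * t) a = ennreal (c powr a) * ennreal_powr t a"
  using assms by (cases t) (simp_all add: ennreal_powr_ennreal ennreal_mult[symmetric] powr_mult
      ennreal_powr_top[unfolded infinity_ennreal_def] ennreal_mult_top)

text \<open>Obtained from monotonicity of the inverse power, without any continuity.\<close>

lemma ennreal_powr_SUP_le:
  assumes "0 < a"
  shows "ennreal_powr (SUP k. u k) a \<le> (SUP k. ennreal_powr (u k) a)"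
proof -
  let ?s = "SUP k. ennreal_powr (u k) a"
  have "u k \<le> ennreal_powr ?s (1 / a)" for k
  proof -
    have "ennreal_powr (ennreal_powr (u k) a) (1 / a) \<le> ennreal_powr ?s (1 / a)"
      using assms by (intro ennreal_powr_mono SUP_upper) auto
    then show ?thesis by (simp add: ennreal_powr_inverse assms)
  qed
  then have "(SUP k. u k) \<le> ennreal_powr ?s (1 / a)" by (rule SUP_least)
  then have "ennreal_powr (SUP k. u k) a \<le> ennreal_powr (ennreal_powr ?s (1 / a)) a"
    using assms by (intro ennreal_powr_mono) auto
  also have "\<dots> = ?s" using ennreal_powr_inverse[of "1 / a" ?s] assms by simp
  finally show ?thesis .
qed

lemma borel_measurable_ennreal_powr [measurable]: "(\<lambda>t. ennreal_powr t a) \<in> borel_measurable borel"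
  unfolding ennreal_powr_def by measurable

lemma nn_integral_powr_SUP_le:
  assumes a: "0 < a" and u: "\<And>k :: nat. u k \<in> borel_measurable M" "incseq u"
    and le: "\<And>k. (\<integral>\<^sup>+x. ennreal_powr (u k x) a \<partial>M) \<le> B"
  shows "(\<integral>\<^sup>+x. ennreal_powr (SUP k. u k x) a \<partial>M) \<le> B"
proof -
  have "(\<integral>\<^sup>+x. ennreal_powr (SUP k. u k x) a \<partial>M) \<le> (\<integral>\<^sup>+x. (SUP k. ennreal_powr (u k x) a) \<partial>M)"
    using a by (intro nn_integral_mono ennreal_powr_SUP_le)
  also have "\<dots> = (SUP k. \<integral>\<^sup>+x. ennreal_powr (u k x) a \<partial>M)"
  proof (rule nn_integral_monotone_convergence_SUP)
    show "incseq (\<lambda>k x. ennreal_powr (u k x) a)"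
      using u(2) a by (auto simp: incseq_def le_fun_def intro!: ennreal_powr_mono)
    show "(\<lambda>x. ennreal_powr (u k x) a) \<in> borel_measurable M" for k
      using measurable_compose[OF u(1) borel_measurable_ennreal_powr] by simp
  qed
  also have "\<dots> \<le> B" by (intro SUP_least le)
  finally show ?thesis .
qed

text \<open>As a supremum over all of G of multiples of indicators, the maximal function is visibly
  measurable for countable G and splits over unions. The extra terms are 0, the least value.\<close>

lemma maximal_fun_indicator:
  "maximal_fun M G f x = (SUP I\<in>G. (\<integral>\<^sup>+y\<in>I. ennreal \<bar>f y\<bar> \<partial>M) / emeasure M I * indicator I x)"
  unfolding maximal_fun_def
proof (rule antisym)
  let ?c = "\<lambda>I. (\<integral>\<^sup>+y\<in>I. ennreal \<bar>f y\<bar> \<partial>M) / emeasure M I"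
  show "(SUP I\<in>{I\<in>G. x \<in> I}. ?c I) \<le> (SUP I\<in>G. ?c I * indicator I x)"
    by (rule SUP_least) (auto intro!: SUP_upper2)
  show "(SUP I\<in>G. ?c I * indicator I x) \<le> (SUP I\<in>{I\<in>G. x \<in> I}. ?c I)"
  proof (rule SUP_least)
    fix I assume "I \<in> G"
    then show "?c I * indicator I x \<le> (SUP I\<in>{I\<in>G. x \<in> I}. ?c I)"
      by (cases "x \<in> I") (auto intro!: SUP_upper)
  qed
qed

lemma borel_measurable_maximal_fun:
  assumes "countable G" "\<And>I. I \<in> G \<Longrightarrow> I \<in> sets M"
  shows "maximal_fun M G f \<in> borel_measurable M"
proof -
  have "(\<lambda>x. SUP I\<in>G. (\<integral>\<^sup>+y\<in>I. ennreal \<bar>f y\<bar> \<partial>M) / emeasure M I * indicator I x) \<in> borel_measurable M"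
    using assms by (intro borel_measurable_SUP) auto
  then show ?thesis by (simp add: maximal_fun_indicator[abs_def])
qed

lemma countable_exhaustion:
  assumes "countable G"
  obtains F :: "nat \<Rightarrow> 'a set" where "incseq F" "\<And>k. finite (F k)" "\<And>k. F k \<subseteq> G" "(\<Union>k. F k) = G"
    "\<And>S. finite S \<Longrightarrow> S \<subseteq> G \<Longrightarrow> \<exists>k. S \<subseteq> F k"
proof (cases "G = {}")
  case True
  then show ?thesis by (intro that[of "\<lambda>_. {}"]) (auto simp: incseq_def)
next
  case False
  then obtain e :: "nat \<Rightarrow> 'a" where e: "G = range e" using assms range_from_nat_into by metis
  show ?thesis
  proof (rule that[of "\<lambda>k. e ` {..k}"])
    show "incseq (\<lambda>k. e ` {..k})" by (auto simp: incseq_def)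
    fix S assume "finite S" "S \<subseteq> G"
    then obtain C where C: "finite C" "S = e ` C" using e finite_subset_image by metis
    then have "S \<subseteq> e ` {..Max (insert 0 C)}" by auto
    then show "\<exists>k. S \<subseteq> e ` {..k}" by blast
  qed (use e in auto)
qed

lemma maximal_fun_exhaustion:
  assumes "(\<Union>k. F k) = G"
  shows "maximal_fun M G f x = (SUP k. maximal_fun M (F k) f x)"
  unfolding maximal_fun_indicator assms[symmetric] by (rule SUP_UNION)

lemma countable_family_maximal:
  assumes G: "countable G" "\<And>I. I \<in> G \<Longrightarrow> I \<in> sets M" and p: "0 < p"
    and le: "\<And>F. finite F \<Longrightarrow> F \<subseteq> G \<Longrightarrow> (\<integral>\<^sup>+x. ennreal_powr (maximal_fun M F f x) p \<partial>M) \<le> B"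
  shows "(\<integral>\<^sup>+x. ennreal_powr (maximal_fun M G f x) p \<partial>M) \<le> B"
proof -
  obtain F :: "nat \<Rightarrow> 'a set set" where F: "incseq F" "\<And>k. finite (F k)" "\<And>k. F k \<subseteq> G" "(\<Union>k. F k) = G"
    using countable_exhaustion[OF G(1)] by metis
  show ?thesis
    unfolding maximal_fun_exhaustion[OF F(4)]
  proof (rule nn_integral_powr_SUP_le[OF p])
    show "maximal_fun M (F k) f \<in> borel_measurable M" for k
      by (intro borel_measurable_maximal_fun countable_finite F(2) G(2)) (use F(3) in blast)
    show "incseq (\<lambda>k. maximal_fun M (F k) f)"
      using F(1) unfolding incseq_def le_fun_def maximal_fun_def by (auto intro!: SUP_subset_mono)
    show "(\<integral>\<^sup>+x. ennreal_powr (maximal_fun M (F k) f x) p \<partial>M) \<le> B" for k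
      by (rule le[OF F(2,3)])
  qed
qed

lemma counting_fun_finite: "finite F \<Longrightarrow> counting_fun F x = (\<Sum>I\<in>F. indicator I x)"
  by (simp add: counting_fun_def)

lemma counting_fun_exhaustion:
  assumes F: "\<And>k. finite (F k)" "\<And>k. F k \<subseteq> G" "\<And>S. finite S \<Longrightarrow> S \<subseteq> G \<Longrightarrow> \<exists>k. S \<subseteq> F k"
  shows "counting_fun G x = (SUP k. counting_fun (F k) x)"
proof -
  let ?s = "sum (\<lambda>I. indicator I x :: ennreal)"
  have "counting_fun G x = (SUP S\<in>{S. finite S \<and> S \<subseteq> G}. ?s S)"
    unfolding counting_fun_def by (rule nonneg_infsum_complete) simp
  also have "\<dots> = (SUP k. ?s (F k))"
  proof (rule antisym)
    show "(SUP S\<in>{S. finite S \<and> S \<subseteq> G}. ?s S) \<le> (SUP k. ?s (F k))"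
    proof (rule SUP_least)
      fix S assume "S \<in> {S. finite S \<and> S \<subseteq> G}"
      then obtain k where "S \<subseteq> F k" using F(3) by blast
      then have "?s S \<le> ?s (F k)" using F(1) by (intro sum_mono2) auto
      then show "?s S \<le> (SUP k. ?s (F k))" by (rule SUP_upper2[OF UNIV_I])
    qed
    show "(SUP k. ?s (F k)) \<le> (SUP S\<in>{S. finite S \<and> S \<subseteq> G}. ?s S)"
      by (rule SUP_least, rule SUP_upper) (use F in auto)
  qed
  finally show ?thesis using F(1) by (simp add: counting_fun_finite)
qed

lemma borel_measurable_counting_fun:
  assumes G: "countable G" "\<And>I. I \<in> G \<Longrightarrow> I \<in> sets M"
  shows "counting_fun G \<in> borel_measurable M"
proof -
  obtain F :: "nat \<Rightarrow> 'a set set" where F: "\<And>k. finite (F k)" "\<And>k. F k \<subseteq> G"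
      "\<And>S. finite S \<Longrightarrow> S \<subseteq> G \<Longrightarrow> \<exists>k. S \<subseteq> F k"
    using countable_exhaustion[OF G(1)] by metis
  have "(\<lambda>x. SUP k. counting_fun (F k) x) \<in> borel_measurable M"
    unfolding counting_fun_finite[OF F(1)]
    by (intro borel_measurable_SUP borel_measurable_sum borel_measurable_indicator G(2)) (use F(2) in auto)
  moreover have "counting_fun G x = (SUP k. counting_fun (F k) x)" for x
    by (rule counting_fun_exhaustion) (use F in auto)
  ultimately show ?thesis by presburger
qed

lemma countable_family_counting:
  assumes G: "countable G" "\<And>I. I \<in> G \<Longrightarrow> I \<in> sets M" and q: "0 < q"
    and le: "\<And>F. finite F \<Longrightarrow> F \<subseteq> G \<Longrightarrow> (\<integral>\<^sup>+x. ennreal_powr (counting_fun F x) q \<partial>M) \<le> B"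
  shows "(\<integral>\<^sup>+x. ennreal_powr (counting_fun G x) q \<partial>M) \<le> B"
proof -
  obtain F :: "nat \<Rightarrow> 'a set set" where F: "incseq F" "\<And>k. finite (F k)" "\<And>k. F k \<subseteq> G"
      "\<And>S. finite S \<Longrightarrow> S \<subseteq> G \<Longrightarrow> \<exists>k. S \<subseteq> F k"
    using countable_exhaustion[OF G(1)] by metis
  have eq: "counting_fun G x = (SUP k. counting_fun (F k) x)" for x
    by (rule counting_fun_exhaustion) (use F in auto)
  show ?thesis
    unfolding eq
  proof (rule nn_integral_powr_SUP_le[OF q])
    show "counting_fun (F k) \<in> borel_measurable M" for k
      by (intro borel_measurable_counting_fun countable_finite F(2) G(2)) (use F(3) in blast)
    show "incseq (\<lambda>k. counting_fun (F k))"
      using F(1,2) by (auto simp: incseq_def le_fun_def counting_fun_finite intro!: sum_mono2)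
    show "(\<integral>\<^sup>+x. ennreal_powr (counting_fun (F k) x) q \<partial>M) \<le> B" for k
      by (rule le[OF F(2,3)])
  qed
qed

section \<open>Duality for sparse families\<close>

text \<open>Above the level l one has a = a^(1 - p) a^p <= l^(1 - p) a^p. This takes the place of
  Hoelder's inequality in the duality argument.\<close>

lemma ennreal_le_level:
  fixes a :: ennreal
  assumes "1 < p" "0 < l"
  shows "a \<le> ennreal l + ennreal (l powr (1 - p)) * ennreal_powr a p"
proof (cases a)
  case (real r)
  have "r \<le> l + l powr (1 - p) * r powr p"
  proof (cases "r \<le> l")
    case False
    then have "r = r powr (1 - p) * r powr p" using assms by (simp add: powr_add[symmetric])
    also have "\<dots> \<le> l powr (1 - p) * r powr p" using False assms by (intro mult_right_mono powr_mono2') auto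
    finally show ?thesis using assms by linarith
  qed (simp add: add_increasing2)
  then have "ennreal r \<le> ennreal (l + l powr (1 - p) * r powr p)" by (rule ennreal_leI)
  then show ?thesis using real assms by (simp add: ennreal_powr_ennreal ennreal_mult[symmetric] ennreal_plus)
next
  case top
  then show ?thesis using assms by (simp add: ennreal_powr_top[unfolded infinity_ennreal_def] ennreal_mult_top)
qed

text \<open>
  Duality: \<open>\<eta> \<integral>h\<^sup>q = \<eta> \<Sum>\<^sub>I \<integral>\<^sub>I h\<^bsup>q-1\<^esup> \<le> \<Sum>\<^sub>I \<integral>\<^bsub>E I\<^esub> M h\<^bsup>q-1\<^esup> \<le> \<integral>\<^bsub>sh\<^esub> M h\<^bsup>q-1\<^esup>\<close>, and the last integral is at most
  \<open>l |sh| + l\<^bsup>1-p\<^esup> A \<integral>h\<^sup>q\<close> for every \<open>l > 0\<close>.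
\<close>

lemma sparse_counting_finite:
  fixes M :: "'a measure" and F :: "'a set set"
  assumes F: "finite F" "\<And>I. I \<in> F \<Longrightarrow> I \<in> sets M" "\<And>I. I \<in> F \<Longrightarrow> 0 < emeasure M I" "\<And>I. I \<in> F \<Longrightarrow> emeasure M I < \<infinity>"
    and E: "disjoint_family_on E F" "\<And>I. I \<in> F \<Longrightarrow> E I \<in> sets M" "\<And>I. I \<in> F \<Longrightarrow> E I \<subseteq> I"
      "\<And>I. I \<in> F \<Longrightarrow> ennreal \<eta> * emeasure M I \<le> emeasure M (E I)"
    and \<eta>: "0 < \<eta>" and q: "2 \<le> q" and A: "1 \<le> A"
    and max: "\<And>f. f \<in> borel_measurable M \<Longrightarrow> (\<integral>\<^sup>+x. ennreal (\<bar>f x\<bar> powr (q / (q - 1))) \<partial>M) < \<infinity> \<Longrightarrow>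
      (\<integral>\<^sup>+x. ennreal_powr (maximal_fun M F f x) (q / (q - 1)) \<partial>M) \<le> ennreal A * (\<integral>\<^sup>+x. ennreal (\<bar>f x\<bar> powr (q / (q - 1))) \<partial>M)"
  shows "(\<integral>\<^sup>+x. ennreal_powr (counting_fun F x) q \<partial>M) \<le> ennreal ((2 * A / \<eta>) powr q) * emeasure M (\<Union>F)"
proof -
  define p where "p = q / (q - 1)"
  have p: "1 < p" "p * (q - 1) = q" "(1 - p) * (q - 1) = -1" using q by (simp_all add: p_def field_simps)
  define h where "h x = (\<Sum>I\<in>F. indicator I x :: real)" for x
  have h0: "0 \<le> h x" for x by (simp add: h_def sum_nonneg)
  have hm: "h \<in> borel_measurable M" unfolding h_def using F(2) by (intro borel_measurable_sum) auto
  have ch: "counting_fun F x = ennreal (h x)" for x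
    unfolding counting_fun_finite[OF F(1)] h_def
    by (subst sum_ennreal[symmetric]) (simp_all add: ennreal_indicator)
  \<comment> \<open>With p conjugate to q, \<phi>^p = h^q, so the maximal bound for \<phi> leads
    back to \<open>H\<close>.\<close>
  define \<phi> where "\<phi> x = h x powr (q - 1)" for x
  have \<phi>m: "\<phi> \<in> borel_measurable M" unfolding \<phi>_def using hm by measurable
  have \<phi>p: "\<bar>\<phi> x\<bar> powr p = h x powr q" for x
    by (simp add: \<phi>_def powr_powr p(2) mult.commute[of "q - 1"])
  define H where "H = (\<integral>\<^sup>+x. ennreal (h x powr q) \<partial>M)"
  define s where "s = emeasure M (\<Union>F)"
  have UF: "\<Union>F \<in> sets M" using F by (intro sets.finite_Union) auto
  have sfin: "s < \<infinity>"
  proof -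
    have "s \<le> (\<Sum>I\<in>F. emeasure M I)" unfolding s_def
      using emeasure_subadditive_finite[of F "\<lambda>I. I" M] F by auto
    also have "\<dots> < \<infinity>" using F by (simp add: ennreal_sum_less_top)
    finally show ?thesis .
  qed
  have hU: "h x = 0" if "x \<notin> \<Union>F" for x using that by (auto simp: h_def intro!: sum.neutral)
  have hcard: "h x \<le> real (card F)" for x
    unfolding h_def using sum_mono[of F "\<lambda>I. indicator I x :: real" "\<lambda>_. 1"] by (simp add: indicator_def)
  \<comment> \<open>Finiteness is what permits subtracting \<open>\<eta> / 2 * H\<close> at the
    end.\<close>
  have Hfin: "H < \<infinity>"
  proof -
    have "H \<le> (\<integral>\<^sup>+x. ennreal (real (card F) powr q) * indicator (\<Union>F) x \<partial>M)"
      unfolding H_def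
    proof (intro nn_integral_mono)
      fix x
      show "ennreal (h x powr q) \<le> ennreal (real (card F) powr q) * indicator (\<Union>F) x"
        using hU[of x] h0[of x] hcard[of x] q by (cases "x \<in> \<Union>F") (auto intro!: ennreal_leI powr_mono2)
    qed
    also have "\<dots> = ennreal (real (card F) powr q) * s" unfolding s_def using UF by (rule nn_integral_cmult_indicator)
    also have "\<dots> < \<infinity>" using sfin by (simp add: ennreal_mult_less_top)
    finally show ?thesis .
  qed
  let ?m = "maximal_fun M F \<phi>"
  have mm: "?m \<in> borel_measurable M" using F by (intro borel_measurable_maximal_fun countable_finite) auto
  have \<phi>H: "(\<integral>\<^sup>+x. ennreal (\<bar>\<phi> x\<bar> powr p) \<partial>M) = H" unfolding \<phi>p H_def ..
  have maxH: "(\<integral>\<^sup>+x. ennreal_powr (?m x) p \<partial>M) \<le> ennreal A * H"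
    using max[OF \<phi>m] \<phi>H Hfin by (simp add: p_def)
  have "ennreal \<eta> * H \<le> (\<integral>\<^sup>+x. indicator (\<Union>F) x * ?m x \<partial>M)"
  proof -
    have "h x powr q = h x * \<phi> x" for x
      using h0[of x] q by (cases "h x = 0") (simp_all add: \<phi>_def powr_diff)
    then have "H = (\<integral>\<^sup>+x. (\<Sum>I\<in>F. ennreal \<bar>\<phi> x\<bar> * indicator I x) \<partial>M)"
      unfolding H_def
      by (intro nn_integral_cong)
        (simp add: ch[symmetric] counting_fun_finite[OF F(1)] ennreal_mult h0 \<phi>_def sum_distrib_right mult.commute)
    also have "\<dots> = (\<Sum>I\<in>F. \<integral>\<^sup>+x\<in>I. ennreal \<bar>\<phi> x\<bar> \<partial>M)"
      using F \<phi>m by (intro nn_integral_sum) auto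
    finally have "ennreal \<eta> * H = (\<Sum>I\<in>F. ennreal \<eta> * (\<integral>\<^sup>+x\<in>I. ennreal \<bar>\<phi> x\<bar> \<partial>M))"
      by (simp add: sum_distrib_left)
    also have "\<dots> \<le> (\<Sum>I\<in>F. \<integral>\<^sup>+x. indicator (E I) x * ?m x \<partial>M)"
    proof (rule sum_mono)
      fix I assume I: "I \<in> F"
      define c where "c = (\<integral>\<^sup>+x\<in>I. ennreal \<bar>\<phi> x\<bar> \<partial>M) / emeasure M I"
      have "(\<integral>\<^sup>+x\<in>I. ennreal \<bar>\<phi> x\<bar> \<partial>M) = c * emeasure M I"
        unfolding c_def using F(3,4)[OF I]
        by (subst ennreal_divide_times) (simp add: ennreal_mult_divide_eq)
      then have "ennreal \<eta> * (\<integral>\<^sup>+x\<in>I. ennreal \<bar>\<phi> x\<bar> \<partial>M) = c * (ennreal \<eta> * emeasure M I)"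
        by (simp add: mult.left_commute)
      also have "\<dots> \<le> c * emeasure M (E I)" using E(4)[OF I] by (intro mult_left_mono) auto
      also have "\<dots> = (\<integral>\<^sup>+x. c * indicator (E I) x \<partial>M)" using E(2)[OF I] by (simp add: nn_integral_cmult_indicator)
      also have "\<dots> \<le> (\<integral>\<^sup>+x. indicator (E I) x * ?m x \<partial>M)"
      proof (intro nn_integral_mono)
        fix x
        have "c \<le> ?m x" if "x \<in> I"
          unfolding c_def maximal_fun_def using that I by (intro SUP_upper2[of I]) auto
        then show "c * indicator (E I) x \<le> indicator (E I) x * ?m x"
          using E(3)[OF I] by (auto simp: indicator_def)
      qed
      finally show "ennreal \<eta> * (\<integral>\<^sup>+x\<in>I. ennreal \<bar>\<phi> x\<bar> \<partial>M) \<le> (\<integral>\<^sup>+x. indicator (E I) x * ?m x \<partial>M)" .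
    qed
    also have "\<dots> = (\<integral>\<^sup>+x. (\<Sum>I\<in>F. indicator (E I) x * ?m x) \<partial>M)"
      using E(2) mm by (intro nn_integral_sum[symmetric]) auto
    also have "\<dots> \<le> (\<integral>\<^sup>+x. indicator (\<Union>F) x * ?m x \<partial>M)"
    proof (intro nn_integral_mono)
      fix x
      have "(\<Sum>I\<in>F. indicator (E I) x) = (indicator (\<Union>I\<in>F. E I) x :: ennreal)"
        using F(1) E(1) by (rule indicator_UN_disjoint[symmetric])
      also have "\<dots> \<le> indicator (\<Union>F) x" using E(3) by (auto simp: indicator_def)
      finally show "(\<Sum>I\<in>F. indicator (E I) x * ?m x) \<le> indicator (\<Union>F) x * ?m x"
        unfolding sum_distrib_right[symmetric] by (intro mult_right_mono) auto
    qed
    finally show ?thesis .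
  qed
  also have "\<dots> \<le> ennreal ((2 * A / \<eta>) powr (q - 1)) * s + ennreal (\<eta> / 2) * H"
  proof -
    \<comment> \<open>Chosen so that l^(1 - p) * A = \<eta> / 2, by (1 - p) * (q - 1) = -1.\<close>
    define l where "l = (2 * A / \<eta>) powr (q - 1)"
    have l: "0 < l" using A \<eta> by (simp add: l_def)
    have l1: "l powr (1 - p) * A = \<eta> / 2"
      using A \<eta> unfolding l_def powr_powr by (simp add: mult.commute[of "q - 1"] p(3) powr_minus)
    have "(\<integral>\<^sup>+x. indicator (\<Union>F) x * ?m x \<partial>M)
        \<le> (\<integral>\<^sup>+x. ennreal l * indicator (\<Union>F) x + ennreal (l powr (1 - p)) * ennreal_powr (?m x) p \<partial>M)"
      using ennreal_le_level[OF p(1) l] by (intro nn_integral_mono) (auto simp: indicator_def)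
    also have "\<dots> = ennreal l * s + ennreal (l powr (1 - p)) * (\<integral>\<^sup>+x. ennreal_powr (?m x) p \<partial>M)"
      using UF mm measurable_compose[OF mm borel_measurable_ennreal_powr]
      by (simp add: nn_integral_add nn_integral_cmult s_def)
    also have "\<dots> \<le> ennreal l * s + ennreal (l powr (1 - p)) * (ennreal A * H)"
      by (intro add_left_mono mult_left_mono maxH) auto
    also have "ennreal (l powr (1 - p)) * (ennreal A * H) = ennreal (\<eta> / 2) * H"
      using A by (simp add: mult.assoc[symmetric] ennreal_mult[symmetric] l1)
    finally show ?thesis by (simp add: l_def)
  qed
  finally have main: "ennreal \<eta> * H \<le> ennreal ((2 * A / \<eta>) powr (q - 1)) * s + ennreal (\<eta> / 2) * H" .
  obtain H' s' where H': "H = ennreal H'" "0 \<le> H'" and s': "s = ennreal s'" "0 \<le> s'"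
    using Hfin sfin by (metis ennreal_cases infinity_ennreal_def less_irrefl)
  have "\<eta> * H' \<le> (2 * A / \<eta>) powr (q - 1) * s' + \<eta> / 2 * H'"
    using main \<eta> H'(2) s'(2) unfolding H'(1) s'(1)
    by (simp add: ennreal_mult[symmetric] ennreal_plus[symmetric] del: ennreal_plus)
  then have "H' \<le> (2 / \<eta>) * ((2 * A / \<eta>) powr (q - 1) * s')" using \<eta> by (simp add: field_simps)
  \<comment> \<open>A >= 1 turns the spare factor 2 / \<eta> into 2 * A / \<eta>, which completes
    the q-th power.\<close>
  also have "\<dots> \<le> (2 * A / \<eta>) * ((2 * A / \<eta>) powr (q - 1) * s')"
    using A \<eta> s'(2) by (intro mult_right_mono divide_right_mono) auto
  also have "\<dots> = (2 * A / \<eta>) powr q * s'" using A \<eta> by (simp add: powr_diff)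
  finally have "H \<le> ennreal ((2 * A / \<eta>) powr q) * s"
    unfolding H'(1) s'(1) using s'(2) by (simp add: ennreal_mult[symmetric])
  then show ?thesis unfolding ch H_def s_def by (simp add: ennreal_powr_ennreal h0)
qed

section \<open>Exponential integrability from moments\<close>

text \<open>For finite u this is the exponential series without its first term; for infinite u the
  summand n = 0 is already infinite.\<close>

lemma exp_minus_1_le_suminf:
  assumes c: "0 < c" and N: "1 \<le> N"
  shows "ennreal_exp (ennreal c * ennreal_powr u (1 / real N)) - 1
    \<le> (\<Sum>n. ennreal (c ^ Suc n / fact (Suc n)) * ennreal_powr u (real (Suc n) / real N))"
proof (cases u)
  case (real r)
  define t where "t = c * r powr (1 / real N)"
  have t: "0 \<le> t" using c by (simp add: t_def)
  have terms: "ennreal (c ^ Suc n / fact (Suc n)) * ennreal_powr u (real (Suc n) / real N) = ennreal (t ^ Suc n / fact (Suc n))" for n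
  proof -
    have "(r powr (1 / real N)) ^ Suc n = r powr (real (Suc n) / real N)"
      by (cases "r = 0") (use real in \<open>simp_all add: powr_realpow[symmetric] powr_powr del: power_Suc\<close>)
    then have "t ^ Suc n = c ^ Suc n * r powr (real (Suc n) / real N)" by (simp only: t_def power_mult_distrib)
    then show ?thesis using real c by (simp add: ennreal_powr_ennreal ennreal_mult[symmetric] del: power_Suc)
  qed
  have "(\<lambda>n. t ^ n / fact n) sums exp t" using exp_converges[of t] by (simp add: divide_inverse mult.commute)
  then have s: "(\<lambda>n. t ^ Suc n / fact (Suc n)) sums (exp t - 1)"
    using sums_Suc_iff[of "\<lambda>n. t ^ n / fact n" "exp t - 1"] by simp
  have "(\<Sum>n. ennreal (t ^ Suc n / fact (Suc n))) = ennreal (exp t - 1)"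
    using s t by (subst suminf_ennreal_eq[OF _ s]) (simp_all del: power_Suc fact_Suc)
  moreover have "ennreal_exp (ennreal c * ennreal_powr u (1 / real N)) = ennreal (exp t)"
    using real c by (simp add: ennreal_powr_ennreal ennreal_mult[symmetric] ennreal_exp_def t_def)
  moreover have "ennreal (exp t) - 1 = ennreal (exp t - 1)"
    by (metis ennreal_1 ennreal_minus zero_le_one)
  ultimately show ?thesis unfolding terms by simp
next
  case top
  have "\<infinity> = ennreal (c ^ Suc 0 / fact (Suc 0)) * ennreal_powr u (real (Suc 0) / real N)"
    using top c by (simp add: ennreal_powr_def ennreal_mult_top)
  also have "\<dots> \<le> (\<Sum>n. ennreal (c ^ Suc n / fact (Suc n)) * ennreal_powr u (real (Suc n) / real N))"
    using sum_le_suminf[of "\<lambda>n. ennreal (c ^ Suc n / fact (Suc n)) * ennreal_powr u (real (Suc n) / real N)" "{0}"]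
    by simp
  finally show ?thesis by (simp add: top_unique)
qed

text \<open>Divided by n!, the left-hand side is a single term of the series of exp n.\<close>

lemma power_le_exp_fact: "real n ^ n \<le> exp (real n) * fact n"
proof -
  have s: "(\<lambda>k. real n ^ k / fact k) sums exp (real n)"
    using exp_converges[of "real n"] by (simp add: divide_inverse mult.commute)
  have "real n ^ n / fact n \<le> exp (real n)"
    using sum_le_suminf[OF sums_summable[OF s], of "{n}"] sums_unique[OF s] by simp
  then show ?thesis by (simp add: pos_divide_le_eq)
qed

text \<open>With q = n / N, (2 R q^N)^q = (2 R)^q q^n is at most (2 R)^n n^n, hence at most (2 R
  e)^n n!. The constant 1 / (4 R e) then leaves (1/2)^n.\<close>

lemma exp_moment_coefficient:
  fixes R :: real
  assumes R: "1 \<le> R" and N: "1 \<le> N" and n: "2 * N \<le> n"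
  shows "(1 / (4 * R * exp 1)) ^ n / fact n * (2 * R * (real n / real N) ^ N) powr (real n / real N) \<le> (1 / 2) ^ n"
proof -
  have n0: "0 < n" using n N by simp
  have "(2 * R * (real n / real N) ^ N) powr (real n / real N)
      = (2 * R) powr (real n / real N) * ((real n / real N) ^ N) powr (real n / real N)"
    using R by (simp add: powr_mult)
  also have "((real n / real N) ^ N) powr (real n / real N) = (real n / real N) ^ n"
    using n0 N by (simp add: powr_realpow[symmetric] powr_powr)
  also have "(2 * R) powr (real n / real N) * (real n / real N) ^ n \<le> (2 * R) ^ n * real n ^ n"
  proof (rule mult_mono)
    have "(2 * R) powr (real n / real N) \<le> (2 * R) powr real n"
      using R N by (intro powr_mono) (simp_all add: divide_le_eq mult_le_cancel_left1)
    then show "(2 * R) powr (real n / real N) \<le> (2 * R) ^ n" using R by (simp add: powr_realpow)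
    show "(real n / real N) ^ n \<le> real n ^ n"
      using N by (intro power_mono) (simp_all add: divide_le_eq mult_le_cancel_left1)
  qed (use R in auto)
  also have "\<dots> \<le> (2 * R) ^ n * (exp (real n) * fact n)"
    using R by (intro mult_left_mono power_le_exp_fact) auto
  also have "\<dots> = (2 * R * exp 1) ^ n * fact n" by (simp add: power_mult_distrib exp_of_nat_mult[symmetric])
  finally have "(1 / (4 * R * exp 1)) ^ n / fact n * (2 * R * (real n / real N) ^ N) powr (real n / real N)
      \<le> (1 / (4 * R * exp 1)) ^ n / fact n * ((2 * R * exp 1) ^ n * fact n)"
    using R by (intro mult_left_mono) auto
  also have "\<dots> = (1 / (4 * R * exp 1) * (2 * R * exp 1)) ^ n" by (simp only: power_mult_distrib) simp
  also have "1 / (4 * R * exp 1) * (2 * R * exp 1) = 1 / 2" using R by simp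
  finally show ?thesis .
qed

text \<open>The n-th term of the exponential series is the moment of order n / N. Orders from 2 on
  are covered by \<open>exp_moment_coefficient\<close>, smaller ones by u^q <= 1 + u^2, which costs
  the factor B. As the series starts at n = 1, the powers of 1/2 sum to 1.\<close>

lemma exp_integrable_of_moments:
  fixes M :: "'a measure" and u :: "'a \<Rightarrow> ennreal" and R :: real
  assumes R: "1 \<le> R" and N: "1 \<le> N" and S: "S \<in> sets M" and u: "u \<in> borel_measurable M"
    and moments: "\<And>q. 2 \<le> q \<Longrightarrow> (\<integral>\<^sup>+x\<in>S. ennreal_powr (u x) q \<partial>M) \<le> ennreal ((2 * R * q ^ N) powr q) * emeasure M S"
  shows "(\<integral>\<^sup>+x\<in>S. (ennreal_exp (ennreal (1 / (4 * R * exp 1)) * ennreal_powr (u x) (1 / real N)) - 1) \<partial>M)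
    \<le> ennreal (1 + (2 * R * 2 ^ N)\<^sup>2) * emeasure M S"
proof -
  define c where "c = 1 / (4 * R * exp 1)"
  define B where "B = 1 + (2 * R * 2 ^ N)\<^sup>2"
  have c: "0 < c" "c \<le> 1/2"
  proof -
    show "0 < c" using R by (simp add: c_def)
    have "1 * 1 \<le> R * exp 1" using R by (intro mult_mono) auto
    then show "c \<le> 1/2" using R by (simp add: c_def divide_le_eq)
  qed
  have B: "1 \<le> B" by (simp add: B_def)
  have um: "(\<lambda>x. ennreal_powr (u x) a) \<in> borel_measurable M" for a
    using measurable_compose[OF u borel_measurable_ennreal_powr] by simp
  have m: "ennreal (c ^ n / fact n) * (\<integral>\<^sup>+x\<in>S. ennreal_powr (u x) (real n / real N) \<partial>M)
      \<le> ennreal ((1/2) ^ n * B) * emeasure M S" if n: "1 \<le> n" for n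
  proof (cases "2 * N \<le> n")
    case True
    define q where "q = real n / real N"
    have q: "2 \<le> q" using True N by (simp add: q_def le_divide_eq mult.commute)
    have "ennreal (c ^ n / fact n) * (\<integral>\<^sup>+x\<in>S. ennreal_powr (u x) q \<partial>M)
        \<le> ennreal (c ^ n / fact n) * (ennreal ((2 * R * q ^ N) powr q) * emeasure M S)"
      by (intro mult_left_mono moments q) simp
    also have "\<dots> = ennreal (c ^ n / fact n * (2 * R * q ^ N) powr q) * emeasure M S"
    proof -
      have "0 \<le> c ^ n / fact n" "0 \<le> (2 * R * q ^ N) powr q" using c by simp_all
      then show ?thesis by (simp only: ennreal_mult mult.assoc)
    qed
    also have "\<dots> \<le> ennreal ((1/2) ^ n * B) * emeasure M S"
    proof (intro mult_right_mono ennreal_leI)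
      have "c ^ n / fact n * (2 * R * q ^ N) powr q \<le> (1/2) ^ n"
        unfolding c_def q_def by (rule exp_moment_coefficient[OF R N True])
      also have "\<dots> \<le> (1/2) ^ n * B" using B by (simp add: mult_le_cancel_left1)
      finally show "c ^ n / fact n * (2 * R * q ^ N) powr q \<le> (1/2) ^ n * B" .
    qed simp
    finally show ?thesis by (simp add: q_def)
  next
    case False
    define q where "q = real n / real N"
    have "real n \<le> real (2 * N)" using False by (intro of_nat_mono) simp
    then have q: "0 < q" "q \<le> 2" using n N by (simp_all add: q_def divide_le_eq)
    have pt: "ennreal_powr t q \<le> 1 + ennreal_powr t 2" for t
    proof (cases t)
      case (real r)
      have "r powr q \<le> 1 + r powr 2"
      proof (cases "r \<le> 1")
        case True
        then have "r powr q \<le> 1 powr q" using real q by (intro powr_mono2) auto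
        then show ?thesis by (simp add: add_increasing2)
      next
        case False
        then have "r powr q \<le> r powr 2" using q by (intro powr_mono) auto
        then show ?thesis by simp
      qed
      then have "ennreal (r powr q) \<le> ennreal (1 + r powr 2)" by (rule ennreal_leI)
      then show ?thesis using real by (simp add: ennreal_powr_ennreal ennreal_plus)
    qed (simp add: ennreal_powr_def)
    have "(\<integral>\<^sup>+x\<in>S. ennreal_powr (u x) q \<partial>M) \<le> (\<integral>\<^sup>+x. indicator S x + ennreal_powr (u x) 2 * indicator S x \<partial>M)"
      using pt by (intro nn_integral_mono) (auto simp: indicator_def)
    also have "\<dots> = emeasure M S + (\<integral>\<^sup>+x\<in>S. ennreal_powr (u x) 2 \<partial>M)"
      using S um by (subst nn_integral_add) auto
    also have "\<dots> \<le> emeasure M S + ennreal ((2 * R * 2 ^ N) powr 2) * emeasure M S"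
      by (intro add_left_mono moments) simp
    also have "\<dots> = ennreal B * emeasure M S"
      using R by (simp add: B_def ennreal_plus distrib_right)
    finally have "ennreal (c ^ n / fact n) * (\<integral>\<^sup>+x\<in>S. ennreal_powr (u x) q \<partial>M) \<le> ennreal ((1/2) ^ n) * (ennreal B * emeasure M S)"
    proof (intro mult_mono)
      have "c ^ n / fact n \<le> c ^ n / 1" using c by (intro divide_left_mono) auto
      also have "\<dots> \<le> (1/2) ^ n" using c by (simp add: power_mono del: power_divide)
      finally show "ennreal (c ^ n / fact n) \<le> ennreal ((1/2) ^ n)" by (rule ennreal_leI)
    qed auto
    then show ?thesis using B by (simp add: q_def ennreal_mult mult.assoc)
  qed
  have "(\<integral>\<^sup>+x\<in>S. (ennreal_exp (ennreal c * ennreal_powr (u x) (1 / real N)) - 1) \<partial>M)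
      \<le> (\<integral>\<^sup>+x. (\<Sum>n. ennreal (c ^ Suc n / fact (Suc n)) * (ennreal_powr (u x) (real (Suc n) / real N) * indicator S x)) \<partial>M)"
  proof (intro nn_integral_mono)
    fix x
    show "(ennreal_exp (ennreal c * ennreal_powr (u x) (1 / real N)) - 1) * indicator S x
      \<le> (\<Sum>n. ennreal (c ^ Suc n / fact (Suc n)) * (ennreal_powr (u x) (real (Suc n) / real N) * indicator S x))"
      using exp_minus_1_le_suminf[OF c(1) N, of "u x"] by (cases "x \<in> S") (simp_all del: power_Suc fact_Suc of_nat_Suc)
  qed
  also have "\<dots> = (\<Sum>n. \<integral>\<^sup>+x. ennreal (c ^ Suc n / fact (Suc n)) * (ennreal_powr (u x) (real (Suc n) / real N) * indicator S x) \<partial>M)"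
    using S um by (intro nn_integral_suminf) auto
  also have "\<dots> = (\<Sum>n. ennreal (c ^ Suc n / fact (Suc n)) * (\<integral>\<^sup>+x\<in>S. ennreal_powr (u x) (real (Suc n) / real N) \<partial>M))"
    using S um by (intro suminf_cong nn_integral_cmult) auto
  also have "\<dots> \<le> (\<Sum>n. ennreal ((1/2) ^ Suc n * B) * emeasure M S)"
    by (intro suminf_le m) auto
  also have "\<dots> = (\<Sum>n. ennreal ((1/2) ^ Suc n * B)) * emeasure M S" by simp
  also have "(\<Sum>n. ennreal ((1/2) ^ Suc n * B)) = ennreal (1 * B)"
  proof (rule suminf_ennreal_eq)
    show "(\<lambda>n. (1/2) ^ Suc n * B) sums (1 * B)" by (intro sums_mult2 power_half_series)
  qed (use B in simp)
  finally show ?thesis by (simp add: c_def B_def)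
qed

section \<open>Assembling the estimates for a family of dyadic rectangles\<close>

text \<open>Cubes of one scale are disjoint and each contains a point with rational
  coordinates.\<close>

lemma (in cube_grid) countable_D: "countable D"
proof -
  have "countable (cubes s)" for s
  proof -
    have "\<exists>r. r \<in> PiE {..<n} (\<lambda>_. \<rat>) \<and> r \<in> Q" if Q: "Q \<in> cubes s" for Q
    proof -
      obtain a where a: "Q = (\<Pi>\<^sub>E j\<in>{..<n}. {a j..<a j + 2 powi s})"
        using cubes_is_cube[OF Q] by (auto simp: is_cube_def)
      have "\<exists>r\<in>\<rat>. a j < r \<and> r < a j + 2 powi s" for j by (rule Rats_dense_in_real) simp
      then obtain r where r: "\<And>j. r j \<in> \<rat>" "\<And>j. a j < r j" "\<And>j. r j < a j + 2 powi s" by metis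
      then show ?thesis by (intro exI[of _ "restrict r {..<n}"]) (auto simp: a less_imp_le)
    qed
    then obtain r where r: "\<And>Q. Q \<in> cubes s \<Longrightarrow> r Q \<in> PiE {..<n} (\<lambda>_. \<rat>) \<and> r Q \<in> Q" by metis
    have "inj_on r (cubes s)" using r cubes_eq by (intro inj_onI) (metis IntI empty_iff)
    moreover have "countable (r ` cubes s)"
      using countable_PiE[of "{..<n}" "\<lambda>_. \<rat> :: real set"] r
      by (intro countable_subset[of "r ` cubes s"]) (auto simp: countable_rat)
    ultimately show ?thesis by (rule countable_image_inj_on[rotated])
  qed
  moreover have "D \<subseteq> (\<Union>s. cubes s)" using D_cubes by blast
  ultimately show ?thesis by (intro countable_subset[of D "\<Union>s. cubes s"] countable_UN) auto
qed

lemma countable_dyadic_rectangles: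
  assumes "\<And>i. i < m \<Longrightarrow> cube_grid (n i) (\<D> i)"
  shows "countable (dyadic_rectangles m \<D>)"
proof -
  have "dyadic_rectangles m \<D> \<subseteq> PiE {..<m} ` PiE {..<m} \<D>"
  proof
    fix I assume "I \<in> dyadic_rectangles m \<D>"
    then obtain K where K: "I = PiE {..<m} K" "\<And>i. i < m \<Longrightarrow> K i \<in> \<D> i" by (auto simp: dyadic_rectangles_def)
    have "I = PiE {..<m} (restrict K {..<m})" unfolding K(1) by (rule PiE_cong) simp
    moreover have "restrict K {..<m} \<in> PiE {..<m} \<D>" using K(2) by auto
    ultimately show "I \<in> PiE {..<m} ` PiE {..<m} \<D>" by blast
  qed
  moreover have "countable (PiE {..<m} \<D>)"
    using cube_grid.countable_D[OF assms] by (intro countable_PiE) auto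
  ultimately show ?thesis by (meson countable_image countable_subset)
qed

lemma dyadic_rectangle_measure:
  assumes grid: "\<And>i. i < m \<Longrightarrow> cube_grid (n i) (\<D> i)" and I: "I \<in> dyadic_rectangles m \<D>"
  shows "I \<in> sets (leb m n)" "0 < emeasure (leb m n) I" "emeasure (leb m n) I < \<infinity>"
proof -
  obtain K where K: "I = PiE {..<m} K" "\<And>i. i < m \<Longrightarrow> K i \<in> \<D> i" using I by (auto simp: dyadic_rectangles_def)
  have "\<exists>s. is_cube (n i) (2 powi s) (K i)" if i: "i < m" for i
    using cube_grid.D_cubes[OF grid[OF i] K(2)[OF i]] cube_grid.cubes_is_cube[OF grid[OF i]] by blast
  then obtain s where s: "\<And>i. i < m \<Longrightarrow> is_cube (n i) (2 powi s i) (K i)" by metis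
  show "I \<in> sets (leb m n)" unfolding K(1) by (rule leb_rectangle(1)) (rule is_cube_sets[OF s])
  have "emeasure (leb m n) I = (\<Prod>i<m. ennreal ((2 powi s i) ^ n i))"
    unfolding K(1) by (subst leb_rectangle(2)) (use is_cube_sets[OF s] is_cube_emeasure[OF s] in auto)
  also have "\<dots> = ennreal (\<Prod>i<m. (2 powi s i) ^ n i)" by (rule prod_ennreal) simp
  finally have e: "emeasure (leb m n) I = ennreal (\<Prod>i<m. (2 powi s i) ^ n i)" .
  show "emeasure (leb m n) I < \<infinity>" unfolding e by simp
  show "0 < emeasure (leb m n) I" unfolding e by (simp add: prod_pos)
qed

context
  fixes m d :: nat and n :: "nat \<Rightarrow> nat" and \<D> :: "nat \<Rightarrow> vec set set" and G :: "point set set"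
  assumes m: "1 \<le> m" and n: "\<And>i. i < m \<Longrightarrow> 1 \<le> n i" "(\<Sum>i<m. n i) = d"
    and grid: "\<And>i. i < m \<Longrightarrow> dyadic_grid (n i) (\<D> i)"
    and G: "G \<subseteq> dyadic_rectangles m \<D>"
    and weak: "\<And>I J. I \<in> G \<Longrightarrow> J \<in> G \<Longrightarrow> I \<subseteq> J \<Longrightarrow> \<exists>i<m. factor i I = factor i J"
begin

lemma grids: "i < m \<Longrightarrow> cube_grid (n i) (\<D> i)"
  using grid n(1) by (simp add: cube_grid_def)

lemma G_props:
  shows "countable G" and "I \<in> G \<Longrightarrow> I \<in> sets (leb m n)" and "I \<in> G \<Longrightarrow> 0 < emeasure (leb m n) I"
    and "I \<in> G \<Longrightarrow> emeasure (leb m n) I < \<infinity>"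
proof -
  show "countable G" by (rule countable_subset[OF G countable_dyadic_rectangles[OF grids]])
  assume "I \<in> G"
  then have I: "I \<in> dyadic_rectangles m \<D>" using G by blast
  show "I \<in> sets (leb m n)" "0 < emeasure (leb m n) I" "emeasure (leb m n) I < \<infinity>"
    by (rule dyadic_rectangle_measure[OF grids I]; assumption)+
qed

lemma maximal_moment:
  assumes p: "1 < p" "p \<le> 2" and F: "F \<subseteq> G"
    and f: "f \<in> borel_measurable (leb m n)" "(\<integral>\<^sup>+x. ennreal (\<bar>f x\<bar> powr p) \<partial>leb m n) < \<infinity>"
  shows "(\<integral>\<^sup>+x. ennreal_powr (maximal_fun (leb m n) F f x) p \<partial>leb m n)
    \<le> ennreal (rect_const m (2 ^ d) * (p / (p - 1)) ^ (m - 1)) * (\<integral>\<^sup>+x. ennreal (\<bar>f x\<bar> powr p) \<partial>leb m n)"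
proof (rule countable_family_maximal)
  show "countable F" using countable_subset[OF F G_props(1)] .
  show "I \<in> sets (leb m n)" if "I \<in> F" for I using that F G_props(2) by blast
  fix F' assume F': "finite F'" "F' \<subseteq> F"
  show "(\<integral>\<^sup>+x. ennreal_powr (maximal_fun (leb m n) F' f x) p \<partial>leb m n)
    \<le> ennreal (rect_const m (2 ^ d) * (p / (p - 1)) ^ (m - 1)) * (\<integral>\<^sup>+x. ennreal (\<bar>f x\<bar> powr p) \<partial>leb m n)"
  proof (rule finite_family_maximal[OF m n grid _ F'(1) _ p f])
    show "F' \<subseteq> dyadic_rectangles m \<D>" using F' F G by blast
    show "\<exists>i<m. factor i I = factor i J" if "I \<in> F'" "J \<in> F'" "I \<subseteq> J" for I J
      using that F' F by (intro weak) auto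
  qed
qed (use p in simp)

lemma maximal_Lp:
  assumes p: "1 < p" "p \<le> 2" and f: "in_Lp (leb m n) p f"
  shows "Lp_norm (leb m n) p (maximal_fun (leb m n) G f)
    \<le> ennreal (rect_const m (2 ^ d) * (p / (p - 1)) ^ (m - 1)) * Lp_norm (leb m n) p (\<lambda>x. ennreal \<bar>f x\<bar>)"
proof -
  define A where "A = rect_const m (2 ^ d) * (p / (p - 1)) ^ (m - 1)"
  define S where "S = (\<integral>\<^sup>+x. ennreal (\<bar>f x\<bar> powr p) \<partial>leb m n)"
  have N: "Lp_norm (leb m n) p (\<lambda>x. ennreal \<bar>f x\<bar>) = ennreal_powr S (1 / p)"
    by (simp add: Lp_norm_def S_def ennreal_powr_ennreal)
  have "S < \<infinity>"
    using f N by (cases "S = \<infinity>") (auto simp: in_Lp_def ennreal_powr_def top.not_eq_extremum)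
  then have "(\<integral>\<^sup>+x. ennreal_powr (maximal_fun (leb m n) G f x) p \<partial>leb m n) \<le> ennreal A * S"
    unfolding A_def S_def using f by (intro maximal_moment[OF p]) (auto simp: in_Lp_def)
  then have "Lp_norm (leb m n) p (maximal_fun (leb m n) G f) \<le> ennreal_powr (ennreal A * S) (1 / p)"
    unfolding Lp_norm_def using p by (intro ennreal_powr_mono) auto
  also have "1 \<le> p / (p - 1)" using p by (simp add: field_simps)
  then have A: "1 \<le> A" unfolding A_def by (intro one_le_mult rect_const_ge_1 one_le_power)
  then have "ennreal_powr (ennreal A * S) (1 / p) = ennreal (A powr (1 / p)) * ennreal_powr S (1 / p)"
    using p by (intro ennreal_powr_mult) auto
  also have "\<dots> \<le> ennreal A * ennreal_powr S (1 / p)"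
  proof (intro mult_right_mono ennreal_leI)
    \<comment> \<open>The p-th root may be dropped because A >= 1; the bound for p-th powers already
      carries the right power of p'.\<close>
    have "A powr (1 / p) \<le> A powr 1" using A p by (intro powr_mono) auto
    then show "A powr (1 / p) \<le> A" using A by simp
  qed simp
  finally show ?thesis unfolding N A_def .
qed

lemma shadow_sets: "shadow G \<in> sets (leb m n)"
  unfolding shadow_def using G_props(1,2) by (intro sets.countable_Union) auto

lemma sparse_moment:
  assumes \<eta>: "0 < \<eta>" and sparse: "sparse_family (leb m n) \<eta> G" and q: "2 \<le> q"
  shows "(\<integral>\<^sup>+x. ennreal_powr (counting_fun G x) q \<partial>leb m n)
    \<le> ennreal ((2 * (rect_const m (2 ^ d) * q ^ (m - 1)) / \<eta>) powr q) * emeasure (leb m n) (shadow G)"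
proof (rule countable_family_counting[OF G_props(1,2)])
  show "0 < q" using q by simp
  fix F assume F: "finite F" "F \<subseteq> G"
  obtain E where E: "disjoint_family_on E G" "\<And>I. I \<in> G \<Longrightarrow> E I \<in> sets (leb m n)" "\<And>I. I \<in> G \<Longrightarrow> E I \<subseteq> I"
      "\<And>I. I \<in> G \<Longrightarrow> ennreal \<eta> * emeasure (leb m n) I \<le> emeasure (leb m n) (E I)"
    using sparse by (auto simp: sparse_family_def)
  \<comment> \<open>p' = q turns the factor of the maximal bound into q^(m - 1), and q >= 2 gives p
    <= 2.\<close>
  define p where "p = q / (q - 1)"
  have p: "1 < p" "p \<le> 2" "p / (p - 1) = q" using q by (simp_all add: p_def field_simps)
  have "(\<integral>\<^sup>+x. ennreal_powr (counting_fun F x) q \<partial>leb m n)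
      \<le> ennreal ((2 * (rect_const m (2 ^ d) * q ^ (m - 1)) / \<eta>) powr q) * emeasure (leb m n) (\<Union>F)"
  proof (rule sparse_counting_finite[where E = E])
    show "disjoint_family_on E F" by (rule disjoint_family_on_mono[OF F(2) E(1)])
    show "E I \<subseteq> I" if "I \<in> F" for I using E(3) F(2) that by blast
    show "1 \<le> rect_const m (2 ^ d) * q ^ (m - 1)"
      using q by (intro one_le_mult rect_const_ge_1 one_le_power) auto
    show "(\<integral>\<^sup>+x. ennreal_powr (maximal_fun (leb m n) F f x) (q / (q - 1)) \<partial>leb m n)
        \<le> ennreal (rect_const m (2 ^ d) * q ^ (m - 1)) * (\<integral>\<^sup>+x. ennreal (\<bar>f x\<bar> powr (q / (q - 1))) \<partial>leb m n)"
      if "f \<in> borel_measurable (leb m n)" "(\<integral>\<^sup>+x. ennreal (\<bar>f x\<bar> powr (q / (q - 1))) \<partial>leb m n) < \<infinity>" for f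
      using maximal_moment[OF p(1,2) F(2) that(1)] that(2) unfolding p(3) p_def[symmetric] by simp
  qed (use F G_props E \<eta> q in auto)
  also have "\<dots> \<le> ennreal ((2 * (rect_const m (2 ^ d) * q ^ (m - 1)) / \<eta>) powr q) * emeasure (leb m n) (shadow G)"
    using F(2) shadow_sets by (intro mult_left_mono emeasure_mono) (auto simp: shadow_def)
  finally show "(\<integral>\<^sup>+x. ennreal_powr (counting_fun F x) q \<partial>leb m n) \<le> \<dots>" .
qed

lemma sparse_Lp:
  assumes \<eta>: "0 < \<eta>" and sparse: "sparse_family (leb m n) \<eta> G" and q: "2 \<le> q"
  shows "Lp_norm (leb m n) q (counting_fun G)
    \<le> ennreal (2 * rect_const m (2 ^ d) * (1 / \<eta>) * q ^ (m - 1)) * ennreal_powr (emeasure (leb m n) (shadow G)) (1 / q)"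
proof -
  define B where "B = 2 * (rect_const m (2 ^ d) * q ^ (m - 1)) / \<eta>"
  have "1 \<le> rect_const m (2 ^ d) * q ^ (m - 1)"
    using q by (intro one_le_mult rect_const_ge_1 one_le_power) auto
  then have B: "0 < B" using \<eta> by (simp add: B_def)
  have "Lp_norm (leb m n) q (counting_fun G) \<le> ennreal_powr (ennreal (B powr q) * emeasure (leb m n) (shadow G)) (1 / q)"
    unfolding Lp_norm_def B_def using q by (intro ennreal_powr_mono sparse_moment \<eta> sparse) auto
  also have "\<dots> = ennreal B * ennreal_powr (emeasure (leb m n) (shadow G)) (1 / q)"
    using B q by (simp add: ennreal_powr_mult powr_powr)
  also have "B = 2 * rect_const m (2 ^ d) * (1 / \<eta>) * q ^ (m - 1)" by (simp add: B_def)
  finally show ?thesis .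
qed

text \<open>The q-th moment of the counting function carries \<eta>^(-q), so multiplying that
  function by \<eta> leaves moment bounds free of \<eta>, with growth exponent N = m - 1.\<close>

lemma sparse_exp:
  assumes m2: "2 \<le> m" and \<eta>: "0 < \<eta>" and sparse: "sparse_family (leb m n) \<eta> G"
  defines "R \<equiv> rect_const m (2 ^ d)"
  shows "(\<integral>\<^sup>+x\<in>shadow G. (ennreal_exp (ennreal (1 / (4 * R * exp 1)) *
        ennreal_powr (ennreal \<eta> * counting_fun G x) (1 / real (m - 1))) - 1) \<partial>leb m n)
    \<le> ennreal (1 + (2 * R * 2 ^ (m - 1))\<^sup>2) * emeasure (leb m n) (shadow G)"
proof (rule exp_integrable_of_moments)
  show R: "1 \<le> R" unfolding R_def by (rule rect_const_ge_1)
  show "1 \<le> m - 1" using m2 by simp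
  show "shadow G \<in> sets (leb m n)" by (rule shadow_sets)
  have cm: "counting_fun G \<in> borel_measurable (leb m n)"
    by (rule borel_measurable_counting_fun[OF G_props(1,2)])
  then show "(\<lambda>x. ennreal \<eta> * counting_fun G x) \<in> borel_measurable (leb m n)" by measurable
  fix q :: real assume q: "2 \<le> q"
  define t where "t = 2 * R * q ^ (m - 1)"
  have t: "0 \<le> t" using R q by (simp add: t_def)
  have "(\<integral>\<^sup>+x\<in>shadow G. ennreal_powr (ennreal \<eta> * counting_fun G x) q \<partial>leb m n)
      \<le> (\<integral>\<^sup>+x. ennreal (\<eta> powr q) * ennreal_powr (counting_fun G x) q \<partial>leb m n)"
    using \<eta> q by (intro nn_integral_mono) (auto simp: indicator_def ennreal_powr_mult)
  also have "\<dots> = ennreal (\<eta> powr q) * (\<integral>\<^sup>+x. ennreal_powr (counting_fun G x) q \<partial>leb m n)"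
    using measurable_compose[OF cm borel_measurable_ennreal_powr] by (intro nn_integral_cmult) simp
  also have "\<dots> \<le> ennreal (\<eta> powr q) * (ennreal ((t / \<eta>) powr q) * emeasure (leb m n) (shadow G))"
    using sparse_moment[OF \<eta> sparse q] by (intro mult_left_mono) (simp_all add: t_def R_def mult.assoc)
  also have "\<dots> = ennreal (\<eta> powr q * (t / \<eta>) powr q) * emeasure (leb m n) (shadow G)"
    by (simp add: ennreal_mult mult.assoc)
  also have "\<eta> powr q * (t / \<eta>) powr q = t powr q"
    using \<eta> t by (simp add: powr_mult[symmetric])
  finally show "(\<integral>\<^sup>+x\<in>shadow G. ennreal_powr (ennreal \<eta> * counting_fun G x) q \<partial>leb m n)
      \<le> ennreal ((2 * R * q ^ (m - 1)) powr q) * emeasure (leb m n) (shadow G)" by (simp add: t_def)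
qed

end

theorem theorem6p2:
  fixes m d :: nat
  assumes "m \<ge> 2"
  shows "\<exists>c>0::real. \<exists>C>0::real.
    \<forall>(n :: nat \<Rightarrow> nat) (\<D> :: nat \<Rightarrow> vec set set) (\<G> :: point set set).
      (\<forall>i<m. n i \<ge> 1) \<and> (\<Sum>i<m. n i) = d \<and>
      (\<forall>i<m. dyadic_grid (n i) (\<D> i)) \<and>
      \<G> \<subseteq> dyadic_rectangles m \<D> \<and>
      (\<forall>I\<in>\<G>. \<forall>J\<in>\<G>. I \<subseteq> J \<longrightarrow> (\<exists>i<m. factor i I = factor i J))
      \<longrightarrow>
      (\<forall>(p::real) f. 1 < p \<and> p \<le> 2 \<and> in_Lp (leb m n) p f \<longrightarrow>
         Lp_norm (leb m n) p (maximal_fun (leb m n) \<G> f)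
           \<le> ennreal (C * (p / (p - 1)) ^ (m - 1)) * Lp_norm (leb m n) p (\<lambda>x. ennreal \<bar>f x\<bar>)) \<and>
      (\<forall>\<eta>::real. 0 < \<eta> \<and> \<eta> \<le> 1 \<and> sparse_family (leb m n) \<eta> \<G> \<and>
                  emeasure (leb m n) (shadow \<G>) < \<infinity> \<longrightarrow>
         (\<forall>q::real. 2 \<le> q \<longrightarrow>
            Lp_norm (leb m n) q (counting_fun \<G>)
              \<le> ennreal (C * (1 / \<eta>) * q ^ (m - 1)) *
                 ennreal_powr (emeasure (leb m n) (shadow \<G>)) (1 / q)) \<and>
         (\<integral>\<^sup>+x\<in>shadow \<G>.
             (ennreal_exp (ennreal c *
                ennreal_powr (ennreal \<eta> * counting_fun \<G> x) (1 / real (m - 1))) - 1) \<partial>leb m n)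
           \<le> ennreal C * emeasure (leb m n) (shadow \<G>))"
proof -
  define R where "R = rect_const m (2 ^ d)"
  \<comment> \<open>The constant of the exponential bound also serves the other two: 2 * R * 2^(m -
    1) >= 1, so its square dominates it and hence 2 * R.\<close>
  define C where "C = 1 + (2 * R * 2 ^ (m - 1))\<^sup>2"
  have R: "1 \<le> R" unfolding R_def by (rule rect_const_ge_1)
  have CR: "2 * R \<le> C"
  proof -
    define t where "t = 2 * R * 2 ^ (m - 1)"
    have "2 * R * 1 \<le> t" unfolding t_def using R by (intro mult_left_mono one_le_power) auto
    moreover have "t * 1 \<le> t * t" using R calculation by (intro mult_left_mono) auto
    ultimately show ?thesis unfolding C_def t_def[symmetric] power2_eq_square by linarith
  qed
  have R1: "R * b \<le> C * b" "2 * R * b \<le> C * b" if "0 \<le> b" for b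
    using CR R that by (intro mult_right_mono; simp)+
  show ?thesis
  proof (rule exI[of _ "1 / (4 * R * exp 1)"], intro conjI exI[of _ C] allI impI)
    show "0 < 1 / (4 * R * exp 1)" "0 < C" using R CR by simp_all
  next
    fix n \<D> \<G> and p :: real and f
    assume H: "(\<forall>i<m. n i \<ge> 1) \<and> (\<Sum>i<m. n i) = d \<and> (\<forall>i<m. dyadic_grid (n i) (\<D> i)) \<and>
        \<G> \<subseteq> dyadic_rectangles m \<D> \<and> (\<forall>I\<in>\<G>. \<forall>J\<in>\<G>. I \<subseteq> J \<longrightarrow> (\<exists>i<m. factor i I = factor i J))"
      and p: "1 < p \<and> p \<le> 2 \<and> in_Lp (leb m n) p f"
    have "Lp_norm (leb m n) p (maximal_fun (leb m n) \<G> f)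
        \<le> ennreal (R * (p / (p - 1)) ^ (m - 1)) * Lp_norm (leb m n) p (\<lambda>x. ennreal \<bar>f x\<bar>)"
      unfolding R_def by (rule maximal_Lp[where \<D> = \<D>]) (use assms H p in auto)
    also have "\<dots> \<le> ennreal (C * (p / (p - 1)) ^ (m - 1)) * Lp_norm (leb m n) p (\<lambda>x. ennreal \<bar>f x\<bar>)"
      using p by (intro mult_right_mono ennreal_leI R1) auto
    finally show "Lp_norm (leb m n) p (maximal_fun (leb m n) \<G> f) \<le> \<dots>" .
  next
    fix n \<D> \<G> and \<eta> q :: real
    assume H: "(\<forall>i<m. n i \<ge> 1) \<and> (\<Sum>i<m. n i) = d \<and> (\<forall>i<m. dyadic_grid (n i) (\<D> i)) \<and>
        \<G> \<subseteq> dyadic_rectangles m \<D> \<and> (\<forall>I\<in>\<G>. \<forall>J\<in>\<G>. I \<subseteq> J \<longrightarrow> (\<exists>i<m. factor i I = factor i J))"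
      and \<eta>: "0 < \<eta> \<and> \<eta> \<le> 1 \<and> sparse_family (leb m n) \<eta> \<G> \<and> emeasure (leb m n) (shadow \<G>) < \<infinity>"
      and q: "2 \<le> q"
    have "Lp_norm (leb m n) q (counting_fun \<G>)
        \<le> ennreal (2 * R * (1 / \<eta>) * q ^ (m - 1)) * ennreal_powr (emeasure (leb m n) (shadow \<G>)) (1 / q)"
      unfolding R_def by (rule sparse_Lp[where \<D> = \<D>]) (use assms H \<eta> q in auto)
    also have "\<dots> \<le> ennreal (C * (1 / \<eta>) * q ^ (m - 1)) * ennreal_powr (emeasure (leb m n) (shadow \<G>)) (1 / q)"
      using \<eta> q CR by (intro mult_right_mono ennreal_leI) auto
    finally show "Lp_norm (leb m n) q (counting_fun \<G>) \<le> \<dots>" .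
  next
    fix n \<D> \<G> and \<eta> :: real
    assume H: "(\<forall>i<m. n i \<ge> 1) \<and> (\<Sum>i<m. n i) = d \<and> (\<forall>i<m. dyadic_grid (n i) (\<D> i)) \<and>
        \<G> \<subseteq> dyadic_rectangles m \<D> \<and> (\<forall>I\<in>\<G>. \<forall>J\<in>\<G>. I \<subseteq> J \<longrightarrow> (\<exists>i<m. factor i I = factor i J))"
      and \<eta>: "0 < \<eta> \<and> \<eta> \<le> 1 \<and> sparse_family (leb m n) \<eta> \<G> \<and> emeasure (leb m n) (shadow \<G>) < \<infinity>"
    show "(\<integral>\<^sup>+x\<in>shadow \<G>. (ennreal_exp (ennreal (1 / (4 * R * exp 1)) *
          ennreal_powr (ennreal \<eta> * counting_fun \<G> x) (1 / real (m - 1))) - 1) \<partial>leb m n)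
        \<le> ennreal C * emeasure (leb m n) (shadow \<G>)"
      unfolding R_def C_def by (rule sparse_exp[where \<D> = \<D>]) (use assms H \<eta> in auto)
  qed
qed

end
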